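(* Let $\mu$ be a regular uncountable cardinal, $R$ a ring, $M$ an $R$-module, and $\mathcal{C}$ a class of $<\mu$-presented $R$-modules. If Player 1 has a winning strategy in the game $\mathcal{G}^{\mathrm{Filt}(\mathcal{C})}_{\mu}(M)$, then for every $\mathcal{C}$-filtered $R$-module $P$, Spoiler has a winning strategy in the Ehrenfeucht–Fraïssé game $\mathrm{EF}_{\mu}(M,P)$.
   Context: A filtration of $M$: increasing, continuous-at-limits sequence $\langle M_i:i<\eta\rangle$ of submodules with union $M$; $M$ is $\mathcal{C}$-filtered if it has one with $M_0=\{0\}$ and each $M_{i+1}/M_i$ ($i+1<\eta$) isomorphic to a member of $\mathcal{C}$. The game $\mathcal{G}^{\mathrm{Filt}(\mathcal{C})}_{\mu}(M)$: at round $i<\mu$ Player 1 plays $X_i\subseteq M$ with $|X_i|<\mu$; Player 2 responds with $Z_i\subseteq M$, $|Z_i|<\mu$, such that $X_i\cup\bigcup_{k<i}Z_k\subseteq\langle Z_i\rangle$ and $\langle Z_i\rangle/\langle\bigcup_{k<i}Z_k\rangle$ is $\mathcal{C}$-filtered; Player 2 wins iff she lasts $\mu$ rounds. $\mathrm{EF}_\mu(M,P)$: $R$-modules are viewed as structures in a language with predicates describing scalar multiplication, so that a map $\sigma:X\to Y$ ($X\subseteq M$, $Y\subseteq P$) is a partial isomorphism iff it lifts to an $R$-module isomorphism $\langle X\rangle\to\langle Y\rangle$. The game lasts at most $\mu$ innings; in each inning Spoiler plays an element of $M$ or of $P$ and Duplicator responds with an element of the other structure so that the pairs chosen so far form a partial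 isomorphism. Duplicator wins iff she lasts $\mu$ innings; otherwise Spoiler wins. *)

theory Defs
  imports "HOL-Algebra.Module" "HOL-Algebra.QuotRing" "HOL.Hull"
begin

unbundle cardinal_syntax

section \<open>Modules over a not necessarily commutative ring\<close>

text \<open>
  The library locale \<^locale>\<open>module\<close> demands a commutative ring of scalars.  The locale below has
  the same axioms for unital left modules over an arbitrary ring with one, on the same record type.
  Right modules are the left modules over the opposite ring.
\<close>

locale left_module = R?: ring R + M?: abelian_group M
  for R :: "('r, 'x) ring_scheme" (structure) and M :: "('r, 'm) module" (structure) +
  assumes lsmult_closed:
      "a \<in> carrier R \<Longrightarrow> x \<in> carrier M \<Longrightarrow> a \<odot>\<^bsub>M\<^esub> x \<in> carrier M"
    and lsmult_l_distr:
      "a \<in> carrier R \<Longrightarrow> b \<in> carrier R \<Longrightarrow> x \<in> carrier M \<Longrightarrow>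
        (a \<oplus>\<^bsub>R\<^esub> b) \<odot>\<^bsub>M\<^esub> x = a \<odot>\<^bsub>M\<^esub> x \<oplus>\<^bsub>M\<^esub> b \<odot>\<^bsub>M\<^esub> x"
    and lsmult_r_distr:
      "a \<in> carrier R \<Longrightarrow> x \<in> carrier M \<Longrightarrow> y \<in> carrier M \<Longrightarrow>
        a \<odot>\<^bsub>M\<^esub> (x \<oplus>\<^bsub>M\<^esub> y) = a \<odot>\<^bsub>M\<^esub> x \<oplus>\<^bsub>M\<^esub> a \<odot>\<^bsub>M\<^esub> y"
    and lsmult_assoc:
      "a \<in> carrier R \<Longrightarrow> b \<in> carrier R \<Longrightarrow> x \<in> carrier M \<Longrightarrow>
        (a \<otimes>\<^bsub>R\<^esub> b) \<odot>\<^bsub>M\<^esub> x = a \<odot>\<^bsub>M\<^esub> (b \<odot>\<^bsub>M\<^esub> x)"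
    and lsmult_one:
      "x \<in> carrier M \<Longrightarrow> \<one>\<^bsub>R\<^esub> \<odot>\<^bsub>M\<^esub> x = x"

text \<open>Meaningful for \<open>X \<subseteq> carrier M\<close> only; otherwise no submodule contains \<open>X\<close> and the hull is \<open>UNIV\<close>.\<close>

definition gen_submodule ::
    "('r, 'x) ring_scheme \<Rightarrow> ('r, 'm) module \<Rightarrow> 'm set \<Rightarrow> 'm set" where
  "gen_submodule R M X = (\<lambda>H. submodule H R M) hull X"

abbreviation restrict_module :: "('r, 'm) module \<Rightarrow> 'm set \<Rightarrow> ('r, 'm) module" where
  "restrict_module M H \<equiv> M\<lparr>carrier := H\<rparr>"

text \<open>
  The record type of modules extends that of rings, so the fields \<open>mult\<close> and \<open>one\<close> have to be filled;
  no notion below depends on them.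
\<close>

definition quot_module :: "('r, 'm) module \<Rightarrow> 'm set \<Rightarrow> ('r, 'm set) module" where
  "quot_module M N =
    \<lparr>carrier = a_rcosets\<^bsub>M\<^esub> N, mult = rcoset_mult M N, one = N +>\<^bsub>M\<^esub> \<one>\<^bsub>M\<^esub>,
     zero = N, add = set_add M, smult = (\<lambda>a X. \<Union>x\<in>X. N +>\<^bsub>M\<^esub> (a \<odot>\<^bsub>M\<^esub> x))\<rparr>"

definition module_iso ::
    "('r, 'x) ring_scheme \<Rightarrow> ('r, 'm) module \<Rightarrow> ('r, 'n) module \<Rightarrow> ('m \<Rightarrow> 'n) set" where
  "module_iso R M N =
    {h \<in> iso (add_monoid M) (add_monoid N).
       \<forall>a\<in>carrier R. \<forall>x\<in>carrier M. h (a \<odot>\<^bsub>M\<^esub> x) = a \<odot>\<^bsub>N\<^esub> h x}"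

definition module_isomorphic ::
    "('r, 'x) ring_scheme \<Rightarrow> ('r, 'm) module \<Rightarrow> ('r, 'n) module \<Rightarrow> bool" where
  "module_isomorphic R M N \<longleftrightarrow> module_iso R M N \<noteq> {}"

definition free_module :: "('r, 'x) ring_scheme \<Rightarrow> 'k set \<Rightarrow> ('r, 'k \<Rightarrow> 'r) module" where
  "free_module R I =
    \<lparr>carrier = {f. (\<forall>i\<in>I. f i \<in> carrier R) \<and> (\<forall>i. i \<notin> I \<longrightarrow> f i = \<zero>\<^bsub>R\<^esub>) \<and>
                   finite {i. f i \<noteq> \<zero>\<^bsub>R\<^esub>}},
     mult = undefined, one = undefined,
     zero = (\<lambda>_. \<zero>\<^bsub>R\<^esub>), add = (\<lambda>f g i. f i \<oplus>\<^bsub>R\<^esub> g i),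
     smult = (\<lambda>a f i. a \<otimes>\<^bsub>R\<^esub> f i)\<rparr>"

text \<open>
  Fewer than \<open>\<mu>\<close> generators and fewer than \<open>\<mu>\<close> relations.  The generators are indexed by a set over
  the type underlying \<open>\<mu>\<close>, in which every cardinal below \<open>\<mu>\<close> is realized.
\<close>

definition less_presented ::
    "('r, 'x) ring_scheme \<Rightarrow> 'k rel \<Rightarrow> ('r, 'm) module \<Rightarrow> bool" where
  "less_presented R \<mu> N \<longleftrightarrow>
    (\<exists>(I :: 'k set) K. |I| <o \<mu> \<and> K \<subseteq> carrier (free_module R I) \<and> |K| <o \<mu> \<and>
       module_isomorphic R
         (quot_module (free_module R I) (gen_submodule R (free_module R I) K)) N)"


section \<open>Filtrations\<close>

text \<open>
  An ordinal \<open>\<eta>\<close> is given by a well-order \<open>r\<close> of type \<open>\<eta>\<close>, the ordinals below \<open>\<eta>\<close> being the elements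
  of \<open>Field r\<close>.  Thus \<open>underS r i = {}\<close> says that \<open>i\<close> is zero, \<open>AboveS r {i} \<noteq> {}\<close> that \<open>i + 1 < \<eta>\<close>,
  and then \<open>wo_rel.suc r {i}\<close> is \<open>i + 1\<close>.
\<close>

definition limit_elem :: "'i rel \<Rightarrow> 'i \<Rightarrow> bool" where
  "limit_elem r i \<longleftrightarrow> i \<in> Field r \<and> underS r i \<noteq> {} \<and>
    (\<forall>k\<in>underS r i. \<exists>l\<in>underS r i. k \<in> underS r l)"

definition filtration ::
    "('r, 'x) ring_scheme \<Rightarrow> ('r, 'm) module \<Rightarrow> 'i rel \<Rightarrow> ('i \<Rightarrow> 'm set) \<Rightarrow> bool" where
  "filtration R M r F \<longleftrightarrow>
    Well_order r \<and>
    (\<forall>i\<in>Field r. submodule (F i) R M) \<and>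
    (\<forall>i j. (i, j) \<in> r \<longrightarrow> F i \<subseteq> F j) \<and>
    (\<forall>i. limit_elem r i \<longrightarrow> F i = (\<Union>k\<in>underS r i. F k)) \<and>
    (\<Union>i\<in>Field r. F i) = carrier M"

definition class_filtration ::
    "('r, 'x) ring_scheme \<Rightarrow> ('r, 'c) module set \<Rightarrow> ('r, 'm) module \<Rightarrow>
     'i rel \<Rightarrow> ('i \<Rightarrow> 'm set) \<Rightarrow> bool" where
  "class_filtration R C M r F \<longleftrightarrow>
    filtration R M r F \<and>
    (\<forall>i\<in>Field r. underS r i = {} \<longrightarrow> F i = {\<zero>\<^bsub>M\<^esub>}) \<and>
    (\<forall>i\<in>Field r. AboveS r {i} \<noteq> {} \<longrightarrow>
       (\<exists>N\<in>C. module_isomorphic R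
          (quot_module (restrict_module M (F (wo_rel.suc r {i}))) (F i)) N))"

text \<open>
  The length of the filtration ranges over the well-orders on the type \<open>'m set\<close>.  This is no
  restriction: see \<open>class_filtered_if_class_filtration\<close> below, where the index type is arbitrary.
\<close>

definition class_filtered ::
    "('r, 'x) ring_scheme \<Rightarrow> ('r, 'c) module set \<Rightarrow> ('r, 'm) module \<Rightarrow> bool" where
  "class_filtered R C M \<longleftrightarrow> (\<exists>(r :: 'm set rel) F. class_filtration R C M r F)"


section \<open>Games of transfinite length\<close>

text \<open>
  The innings are the ordinals below the order type of \<open>\<mu>\<close>, i.e. the elements of \<open>Field \<mu>\<close>.  In
  inning \<open>i\<close> the first player plays \<open>x i\<close> and then the second player answers \<open>y i\<close>;
  \<open>legal1 i x y\<close> and \<open>legal2 i x y\<close> say that these moves obey the rules.  The second player wins iff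
  she lasts all innings, so the first player wins iff the first violation of the rules is committed
  by the second player.  (A player without legal moves necessarily commits a violation.)
  A strategy maps the moves of both players in the innings before \<open>i\<close> to a move in inning \<open>i\<close>.
\<close>

definition follows_strategy ::
    "'k rel \<Rightarrow> ('k \<Rightarrow> ('k \<Rightarrow> 'a \<times> 'b) \<Rightarrow> 'a) \<Rightarrow> ('k \<Rightarrow> 'a) \<Rightarrow> ('k \<Rightarrow> 'b) \<Rightarrow> bool" where
  "follows_strategy \<mu> \<sigma> x y \<longleftrightarrow>
    (\<forall>i\<in>Field \<mu>. x i = \<sigma> i (restrict (\<lambda>k. (x k, y k)) (underS \<mu> i)))"

definition first_player_wins_run ::
    "'k rel \<Rightarrow> ('k \<Rightarrow> ('k \<Rightarrow> 'a) \<Rightarrow> ('k \<Rightarrow> 'b) \<Rightarrow> bool) \<Rightarrow>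
     ('k \<Rightarrow> ('k \<Rightarrow> 'a) \<Rightarrow> ('k \<Rightarrow> 'b) \<Rightarrow> bool) \<Rightarrow> ('k \<Rightarrow> 'a) \<Rightarrow> ('k \<Rightarrow> 'b) \<Rightarrow> bool" where
  "first_player_wins_run \<mu> legal1 legal2 x y \<longleftrightarrow>
    (\<exists>i\<in>Field \<mu>. \<not> legal2 i x y \<and> (\<forall>k\<in>under \<mu> i. legal1 k x y))"

definition first_player_has_winning_strategy ::
    "'k rel \<Rightarrow> ('k \<Rightarrow> ('k \<Rightarrow> 'a) \<Rightarrow> ('k \<Rightarrow> 'b) \<Rightarrow> bool) \<Rightarrow>
     ('k \<Rightarrow> ('k \<Rightarrow> 'a) \<Rightarrow> ('k \<Rightarrow> 'b) \<Rightarrow> bool) \<Rightarrow> bool" where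
  "first_player_has_winning_strategy \<mu> legal1 legal2 \<longleftrightarrow>
    (\<exists>\<sigma>. \<forall>x y. follows_strategy \<mu> \<sigma> x y \<longrightarrow> first_player_wins_run \<mu> legal1 legal2 x y)"


section \<open>The filtration game\<close>

definition filt_game_legal1 ::
    "'k rel \<Rightarrow> ('r, 'm) module \<Rightarrow> 'k \<Rightarrow> ('k \<Rightarrow> 'm set) \<Rightarrow> ('k \<Rightarrow> 'm set) \<Rightarrow> bool" where
  "filt_game_legal1 \<mu> M i X Z \<longleftrightarrow> X i \<subseteq> carrier M \<and> |X i| <o \<mu>"

definition filt_game_legal2 ::
    "('r, 'x) ring_scheme \<Rightarrow> ('r, 'c) module set \<Rightarrow> 'k rel \<Rightarrow> ('r, 'm) module \<Rightarrow>
     'k \<Rightarrow> ('k \<Rightarrow> 'm set) \<Rightarrow> ('k \<Rightarrow> 'm set) \<Rightarrow> bool" where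
  "filt_game_legal2 R C \<mu> M i X Z \<longleftrightarrow>
    Z i \<subseteq> carrier M \<and> |Z i| <o \<mu> \<and>
    X i \<union> (\<Union>k\<in>underS \<mu> i. Z k) \<subseteq> gen_submodule R M (Z i) \<and>
    class_filtered R C
      (quot_module (restrict_module M (gen_submodule R M (Z i)))
        (gen_submodule R M (\<Union>k\<in>underS \<mu> i. Z k)))"

definition player1_wins_filt_game ::
    "('r, 'x) ring_scheme \<Rightarrow> ('r, 'c) module set \<Rightarrow> 'k rel \<Rightarrow> ('r, 'm) module \<Rightarrow> bool" where
  "player1_wins_filt_game R C \<mu> M \<longleftrightarrow>
    first_player_has_winning_strategy \<mu> (filt_game_legal1 \<mu> M) (filt_game_legal2 R C \<mu> M)"


section \<open>The Ehrenfeucht-Fraisse game\<close>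

definition partial_isomorphism ::
    "('r, 'x) ring_scheme \<Rightarrow> ('r, 'm) module \<Rightarrow> ('r, 'p) module \<Rightarrow> ('m \<times> 'p) set \<Rightarrow> bool" where
  "partial_isomorphism R M P S \<longleftrightarrow>
    (\<exists>h\<in>module_iso R (restrict_module M (gen_submodule R M (fst ` S)))
                     (restrict_module P (gen_submodule R P (snd ` S))).
       \<forall>(m, p)\<in>S. h m = p)"

text \<open>
  A move is an element of \<open>M\<close>, tagged \<open>Inl\<close>, or an element of \<open>P\<close>, tagged \<open>Inr\<close>; this keeps the two
  structures apart even when their carriers overlap.
\<close>

fun ef_pairs :: "'m + 'p \<Rightarrow> 'm + 'p \<Rightarrow> ('m \<times> 'p) set" where
  "ef_pairs (Inl m) (Inr p) = {(m, p)}"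
| "ef_pairs (Inr p) (Inl m) = {(m, p)}"
| "ef_pairs _ _ = {}"

definition ef_legal_spoiler ::
    "('r, 'm) module \<Rightarrow> ('r, 'p) module \<Rightarrow> 'k \<Rightarrow> ('k \<Rightarrow> 'm + 'p) \<Rightarrow> ('k \<Rightarrow> 'm + 'p) \<Rightarrow> bool" where
  "ef_legal_spoiler M P i s d \<longleftrightarrow> s i \<in> carrier M <+> carrier P"

definition ef_legal_duplicator ::
    "('r, 'x) ring_scheme \<Rightarrow> 'k rel \<Rightarrow> ('r, 'm) module \<Rightarrow> ('r, 'p) module \<Rightarrow>
     'k \<Rightarrow> ('k \<Rightarrow> 'm + 'p) \<Rightarrow> ('k \<Rightarrow> 'm + 'p) \<Rightarrow> bool" where
  "ef_legal_duplicator R \<mu> M P i s d \<longleftrightarrow>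
    d i \<in> carrier M <+> carrier P \<and> (isl (d i) \<longleftrightarrow> \<not> isl (s i)) \<and>
    partial_isomorphism R M P (\<Union>k\<in>under \<mu> i. ef_pairs (s k) (d k))"

definition spoiler_wins_ef_game ::
    "('r, 'x) ring_scheme \<Rightarrow> 'k rel \<Rightarrow> ('r, 'm) module \<Rightarrow> ('r, 'p) module \<Rightarrow> bool" where
  "spoiler_wins_ef_game R \<mu> M P \<longleftrightarrow>
    first_player_has_winning_strategy \<mu> (ef_legal_spoiler M P) (ef_legal_duplicator R \<mu> M P)"


section \<open>Independence of the index type of filtrations\<close>

text \<open>Deleting repetitions, a filtration is indexed by the set of its own members.\<close>

lemma class_filtered_if_class_filtration:
  fixes r :: "'i rel" and F :: "'i \<Rightarrow> 'm set"
  assumes "class_filtration R C M r F"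
  shows "class_filtered R C M"
proof -
  have fil: "filtration R M r F"
    and zero: "\<And>i. i \<in> Field r \<Longrightarrow> underS r i = {} \<Longrightarrow> F i = {\<zero>\<^bsub>M\<^esub>}"
    and step: "\<And>i. i \<in> Field r \<Longrightarrow> AboveS r {i} \<noteq> {} \<Longrightarrow>
       \<exists>N\<in>C. module_isomorphic R
          (quot_module (restrict_module M (F (wo_rel.suc r {i}))) (F i)) N"
    using assms unfolding class_filtration_def by auto
  have wo: "Well_order r"
    and sub: "\<And>i. i \<in> Field r \<Longrightarrow> submodule (F i) R M"
    and mono: "\<And>i j. (i, j) \<in> r \<Longrightarrow> F i \<subseteq> F j"
    and lim: "\<And>i. limit_elem r i \<Longrightarrow> F i = (\<Union>k\<in>underS r i. F k)"
    and un: "(\<Union>i\<in>Field r. F i) = carrier M"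
    using fil unfolding filtration_def by auto
  interpret r: wo_rel r using wo by (simp add: wo_rel_def)
  have tot: "(i, j) \<in> r \<or> (j, i) \<in> r" if "i \<in> Field r" "j \<in> Field r" for i j
    using that r.TOTALS by blast
  have refl: "(i, i) \<in> r" if "i \<in> Field r" for i
    using tot[OF that that] by blast
  have less: "(i, j) \<in> r" "i \<noteq> j" if "i \<in> Field r" "j \<in> Field r" "F i \<subset> F j" for i j
    using tot[OF that(1,2)] mono[of j i] that(3) by auto
  define s where "s = {(A, B). A \<in> F ` Field r \<and> B \<in> F ` Field r \<and> A \<subseteq> B}"
  have Fs: "Field s = F ` Field r" unfolding s_def Field_def by auto
  have uS: "underS s B = {A \<in> F ` Field r. A \<subset> B}" if "B \<in> F ` Field r" for B
    using that unfolding s_def underS_def by auto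
  have AS: "AboveS s {A} = {B \<in> F ` Field r. A \<subset> B}" if "A \<in> F ` Field r" for A
    using that unfolding AboveS_def Fs unfolding s_def by auto
  have least: "\<exists>j\<in>Field r. F j \<in> Q \<and> (\<forall>k\<in>Field r. F k \<in> Q \<longrightarrow> (j, k) \<in> r)"
    if "Q \<subseteq> F ` Field r" "Q \<noteq> {}" for Q
  proof -
    let ?J = "{j \<in> Field r. F j \<in> Q}"
    have J: "?J \<subseteq> Field r" "?J \<noteq> {}" using that by auto
    show ?thesis
      using r.minim_in[OF J] r.minim_least[OF J(1)] by blast
  qed
  have linS: "Linear_order s"
    unfolding linear_order_on_def partial_order_on_def preorder_on_def refl_on_def
      trans_def antisym_def total_on_def Fs
  proof (intro conjI ballI allI impI)
    fix A B assume "A \<in> F ` Field r" "B \<in> F ` Field r" "A \<noteq> B"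
    then obtain i j where "i \<in> Field r" "j \<in> Field r" "A = F i" "B = F j" by auto
    then show "(A, B) \<in> s \<or> (B, A) \<in> s"
      using tot[of i j] mono[of i j] mono[of j i] unfolding s_def by auto
  qed (auto simp: s_def)
  have wfS: "wf (s - Id)"
  proof (rule wfI_min)
    fix A and Q :: "'m set set" assume AQ: "A \<in> Q"
    show "\<exists>z\<in>Q. \<forall>y. (y, z) \<in> s - Id \<longrightarrow> y \<notin> Q"
    proof (cases "Q \<inter> F ` Field r = {}")
      case True
      then have "\<forall>y. (y, A) \<in> s - Id \<longrightarrow> y \<notin> Q" using AQ unfolding s_def by auto
      then show ?thesis using AQ by blast
    next
      case False
      then obtain j where j: "j \<in> Field r" "F j \<in> Q"
        "\<And>k. k \<in> Field r \<Longrightarrow> F k \<in> Q \<Longrightarrow> (j, k) \<in> r"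
        using least[of "Q \<inter> F ` Field r"] by auto
      have "y \<notin> Q" if y: "(y, F j) \<in> s - Id" for y
      proof
        assume "y \<in> Q"
        moreover obtain k where k: "k \<in> Field r" "y = F k" "F k \<subset> F j"
          using y unfolding s_def by auto
        ultimately have "F j \<subseteq> F k" using j(3)[of k] mono by blast
        then show False using k(3) by blast
      qed
      then show ?thesis using j(2) by blast
    qed
  qed
  have woS: "Well_order s" unfolding well_order_on_def using linS wfS by blast
  interpret s: wo_rel s using woS by (simp add: wo_rel_def)
  have first: "\<exists>j\<in>Field r. F j = B \<and> (\<forall>k\<in>underS r j. F k \<subset> B)" if B: "B \<in> F ` Field r" for B
  proof -
    obtain j where j: "j \<in> Field r" "F j = B" "\<And>k. k \<in> Field r \<Longrightarrow> F k = B \<Longrightarrow> (j, k) \<in> r"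
      using least[of "{B}"] B by auto
    have "F k \<subset> B" if k: "k \<in> underS r j" for k
    proof -
      have kj: "(k, j) \<in> r" "k \<noteq> j" "k \<in> Field r"
        using k unfolding underS_def Field_def by auto
      then have "F k \<noteq> B" using j(3)[of k] r.ANTISYM unfolding antisym_def by blast
      then show ?thesis using mono[OF kj(1)] j(2) by blast
    qed
    then show ?thesis using j by blast
  qed
  have trich: "underS r j = {} \<or> limit_elem r j \<or>
      (\<exists>k\<in>underS r j. AboveS r {k} \<noteq> {} \<and> wo_rel.suc r {k} = j \<and>
         (\<forall>l\<in>underS r j. (l, k) \<in> r))" if j: "j \<in> Field r" for j
  proof (cases "underS r j = {} \<or> limit_elem r j")
    case False
    then obtain k where k: "k \<in> underS r j" "\<forall>l\<in>underS r j. k \<notin> underS r l"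
      unfolding limit_elem_def using j by auto
    have kj: "(k, j) \<in> r" "k \<noteq> j" "k \<in> Field r"
      using k(1) unfolding underS_def Field_def by auto
    have top: "(l, k) \<in> r" if l: "l \<in> underS r j" for l
    proof -
      have "l \<in> Field r" using l unfolding underS_def Field_def by auto
      then show ?thesis using k(2) l tot[of l k] refl[of k] kj(3) unfolding underS_def by auto
    qed
    have jA: "j \<in> AboveS r {k}" using kj j unfolding AboveS_def by auto
    have "j = wo_rel.suc r {k}"
    proof (rule r.equals_suc_AboveS)
      show "{k} \<subseteq> Field r" using kj(3) by auto
      show "j \<in> AboveS r {k}" by (rule jA)
      fix b assume b: "b \<in> AboveS r {k}"
      show "(j, b) \<in> r"
      proof (rule ccontr)
        assume nb: "(j, b) \<notin> r"
        have bF: "b \<in> Field r" "b \<noteq> k" "(k, b) \<in> r" using b unfolding AboveS_def by auto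
        then have "b \<in> underS r j" using nb tot[OF j bF(1)] refl[OF j] unfolding underS_def by auto
        then have "(b, k) \<in> r" by (rule top)
        then show False using bF r.ANTISYM unfolding antisym_def by blast
      qed
    qed
    then show ?thesis using k(1) jA top by blast
  qed blast
  have "class_filtration R C M s id"
    unfolding class_filtration_def filtration_def Fs
  proof (intro conjI ballI allI impI)
    show "well_order_on (F ` Field r) s" using woS by (simp add: Fs)
  next
    fix B assume "B \<in> F ` Field r"
    then show "submodule (id B) R M" using sub by auto
  next
    fix A B assume "(A, B) \<in> s"
    then show "id A \<subseteq> id B" unfolding s_def by auto
  next
    fix B assume l: "limit_elem s B"
    then have B: "B \<in> F ` Field r" unfolding limit_elem_def Fs by blast
    then obtain j where j: "j \<in> Field r" "F j = B" "\<forall>k\<in>underS r j. F k \<subset> B"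
      using first by blast
    have below: "\<exists>k\<in>underS r j. A = F k" if A: "A \<in> underS s B" for A
    proof -
      obtain k where k: "k \<in> Field r" "A = F k" "F k \<subset> F j" using A uS[OF B] j(2) by auto
      then have "k \<in> underS r j" using less[OF k(1) j(1) k(3)] unfolding underS_def by auto
      then show ?thesis using k(2) by blast
    qed
    have mem: "F k \<in> underS s B" if k: "k \<in> underS r j" for k
    proof -
      have "k \<in> Field r" using k unfolding underS_def Field_def by auto
      then show ?thesis using uS[OF B] j(3) k by auto
    qed
    have eq: "underS s B = F ` underS r j" using below mem by auto
    have "underS r j \<noteq> {}" using l eq unfolding limit_elem_def by auto
    moreover have "\<not> (\<exists>k\<in>underS r j. \<forall>l\<in>underS r j. (l, k) \<in> r)"
    proof
      assume "\<exists>k\<in>underS r j. \<forall>l\<in>underS r j. (l, k) \<in> r"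
      then obtain k where k: "k \<in> underS r j" "\<forall>l\<in>underS r j. (l, k) \<in> r" by blast
      obtain A where A: "A \<in> underS s B" "F k \<in> underS s A"
        using l mem[OF k(1)] unfolding limit_elem_def by blast
      obtain m where m: "m \<in> underS r j" "A = F m" using below[OF A(1)] by blast
      have "A \<subseteq> F k" using k(2) m mono by blast
      moreover have "F k \<subset> A" using A(2) unfolding s_def underS_def by auto
      ultimately show False by blast
    qed
    ultimately have "limit_elem r j" using trich[OF j(1)] by blast
    then have "B = (\<Union>k\<in>underS r j. F k)" using lim j(2) by blast
    then show "id B = (\<Union>k\<in>underS s B. id k)" using eq by auto
  next
    show "(\<Union>i\<in>F ` Field r. id i) = carrier M" using un by auto
  next
    fix B assume B: "B \<in> F ` Field r" and e: "underS s B = {}"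
    obtain j where j: "j \<in> Field r" "F j = B" "\<forall>k\<in>underS r j. F k \<subset> B"
      using first[OF B] by blast
    have "underS r j = {}"
    proof (rule ccontr)
      assume "underS r j \<noteq> {}"
      then obtain k where k: "k \<in> underS r j" by blast
      then have "k \<in> Field r" unfolding underS_def Field_def by auto
      then show False using e uS[OF B] j(3) k by auto
    qed
    then show "id B = {\<zero>\<^bsub>M\<^esub>}" using zero[OF j(1)] j(2) by simp
  next
    fix A assume A: "A \<in> F ` Field r" and a: "AboveS s {A} \<noteq> {}"
    let ?B = "wo_rel.suc s {A}"
    have AF: "{A} \<subseteq> Field s" using A Fs by auto
    have BA: "?B \<in> AboveS s {A}" by (rule s.suc_AboveS[OF AF a])
    then have B: "?B \<in> F ` Field r" "A \<subset> ?B" using AS[OF A] by auto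
    have min: "?B \<subseteq> D" if "D \<in> F ` Field r" "A \<subset> D" for D
    proof -
      have "D \<in> AboveS s {A}" using that AS[OF A] by auto
      then have "(?B, D) \<in> s" using s.suc_least_AboveS by blast
      then show ?thesis unfolding s_def by auto
    qed
    obtain j where j: "j \<in> Field r" "F j = ?B" "\<forall>k\<in>underS r j. F k \<subset> ?B"
      using first[OF B(1)] by blast
    obtain i where i: "i \<in> Field r" "F i = A" using A by auto
    have ij: "i \<in> underS r j" using less[OF i(1) j(1)] i(2) j(2) B(2) unfolding underS_def by auto
    have small: "F k \<subseteq> A" if k: "k \<in> underS r j" for k
    proof -
      have kF: "k \<in> Field r" using k unfolding underS_def Field_def by auto
      have "\<not> A \<subset> F k" using min[of "F k"] kF j(3) k by blast
      then show ?thesis using tot[OF kF i(1)] mono i(2) by blast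
    qed
    have "\<not> limit_elem r j"
    proof
      assume "limit_elem r j"
      then have "?B \<subseteq> A" using lim[of j] j(2) small by blast
      then show False using B(2) by blast
    qed
    then obtain k where k: "k \<in> underS r j" "AboveS r {k} \<noteq> {}" "wo_rel.suc r {k} = j"
      "\<forall>l\<in>underS r j. (l, k) \<in> r"
      using trich[OF j(1)] ij by blast
    have "F k = A" using small[OF k(1)] k(4) ij mono i(2) by blast
    moreover have "k \<in> Field r" using k(1) unfolding underS_def Field_def by auto
    ultimately show "\<exists>N\<in>C. module_isomorphic R
        (quot_module (restrict_module M (id ?B)) (id A)) N"
      using step[of k] k(2,3) j(2) by auto
  qed
  then show ?thesis unfolding class_filtered_def by blast
qed

end

theory Submission
  imports Defs
begin

text \<open>
  Spoiler simulates the filtration game.  By the Hill lemma, \<open>P\<close> carries a closure operator \<open>G\<close> whose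
  values have size less than \<open>\<mu>\<close>, such that for \<open>G\<close>-closed sets \<open>Q \<subseteq> Q'\<close> the quotient of the submodules
  generated by \<open>Q'\<close> and \<open>Q\<close> is \<open>C\<close>-filtered.  In round \<open>i\<close> Spoiler first plays the elements of the set
  \<open>X i\<close> dictated by the strategy of Player 1, and then elements of \<open>P\<close> until those chosen so far form a
  \<open>G\<close>-closed set.  By regularity this takes fewer than \<open>\<mu>\<close> innings.  Then \<open>Z i\<close> is the set of all elements of \<open>M\<close>
  chosen so far: as long as Duplicator keeps a partial isomorphism, the quotients on the side of \<open>M\<close>
  are isomorphic to those on the side of \<open>P\<close>, so the \<open>Z i\<close> are legal moves of Player 2.  Since Player 1
  wins, Duplicator must fail at some inning.
\<close>

section \<open>Submodules, quotients and linear maps\<close>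

text \<open>The given filtration of \<open>P\<close> is too rigid: the elements of \<open>P\<close>
  chosen in a play are scattered along it and need not generate one of its members. What is needed
  is a family of submodules of \<open>P\<close> that catches every small set, is compatible with
  unions (in each round Player 2 is compared with the union of all her earlier moves), and has
  filtered relative quotients. Here the bound on relations enters: if \<open>V/U\<close> is
  presented by fewer than \<open>\<mu>\<close> generators and relations, then \<open>V\<close> is
  generated over \<open>U\<close> by a small set whose span meets \<open>U\<close> inside the span
  of another small set. That set is supported on few earlier steps, and closing under such supports
  stays below \<open>\<mu>\<close>: regularity handles each stage, uncountability the countably many
  stages together. The other obstacle is that Spoiler sees only the past, while the number of
  innings consumed by a round depends on the play. The simulated rounds are therefore computed from
  a whole run, and a locality lemma shows that what Spoiler consults at inning \<open>t\<close> is
  determined by the positions up to \<open>t\<close>.\<close>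

context left_module
begin

lemma smult_zero_right:
  assumes a: "a \<in> carrier R" shows "a \<odot>\<^bsub>M\<^esub> \<zero>\<^bsub>M\<^esub> = \<zero>\<^bsub>M\<^esub>"
  using lsmult_r_distr[OF a M.zero_closed M.zero_closed] lsmult_closed[OF a M.zero_closed]
    M.add.l_cancel_one by fastforce

lemma smult_zero_left:
  assumes x: "x \<in> carrier M" shows "\<zero>\<^bsub>R\<^esub> \<odot>\<^bsub>M\<^esub> x = \<zero>\<^bsub>M\<^esub>"
  using lsmult_l_distr[OF R.zero_closed R.zero_closed x] lsmult_closed[OF R.zero_closed x]
    M.add.l_cancel_one by fastforce

lemma smult_minus_one:
  assumes x: "x \<in> carrier M" shows "(\<ominus>\<^bsub>R\<^esub> \<one>\<^bsub>R\<^esub>) \<odot>\<^bsub>M\<^esub> x = \<ominus>\<^bsub>M\<^esub> x"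
proof -
  have c: "(\<ominus>\<^bsub>R\<^esub> \<one>\<^bsub>R\<^esub>) \<odot>\<^bsub>M\<^esub> x \<in> carrier M" using lsmult_closed x by simp
  have "(\<ominus>\<^bsub>R\<^esub> \<one>\<^bsub>R\<^esub>) \<odot>\<^bsub>M\<^esub> x \<oplus>\<^bsub>M\<^esub> x = \<zero>\<^bsub>M\<^esub>"
    using lsmult_l_distr[of "\<ominus>\<^bsub>R\<^esub> \<one>\<^bsub>R\<^esub>" "\<one>\<^bsub>R\<^esub>" x] x lsmult_one smult_zero_left R.l_neg[of "\<one>\<^bsub>R\<^esub>"] by simp
  then show ?thesis using c x M.minus_equality by simp
qed

lemma minus_zero_right: "x \<in> carrier M \<Longrightarrow> x \<ominus>\<^bsub>M\<^esub> \<zero>\<^bsub>M\<^esub> = x"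
  using M.minus_equality[of "\<zero>\<^bsub>M\<^esub>" "\<zero>\<^bsub>M\<^esub>"] by (simp add: a_minus_def)

lemma minus_eq_zero_iff:
  assumes x: "x \<in> carrier M" and y: "y \<in> carrier M"
  shows "x \<ominus>\<^bsub>M\<^esub> y = \<zero>\<^bsub>M\<^esub> \<longleftrightarrow> x = y"
proof
  assume "x \<ominus>\<^bsub>M\<^esub> y = \<zero>\<^bsub>M\<^esub>"
  then have "(x \<oplus>\<^bsub>M\<^esub> \<ominus>\<^bsub>M\<^esub> y) \<oplus>\<^bsub>M\<^esub> y = y" using y by (simp add: a_minus_def)
  then show "x = y" using x y by (simp add: M.a_assoc M.l_neg)
qed (use y in \<open>simp add: a_minus_def M.r_neg\<close>)

text \<open>Additive inverses come for free, since \<open>-x\<close> is the multiple of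
  \<open>x\<close> by \<open>-1\<close>. Later submodule checks go through this criterion.\<close>

lemma submodule_iff:
  "submodule H R M \<longleftrightarrow> H \<subseteq> carrier M \<and> \<zero>\<^bsub>M\<^esub> \<in> H \<and> (\<forall>x\<in>H. \<forall>y\<in>H. x \<oplus>\<^bsub>M\<^esub> y \<in> H) \<and>
     (\<forall>a\<in>carrier R. \<forall>x\<in>H. a \<odot>\<^bsub>M\<^esub> x \<in> H)" (is "_ \<longleftrightarrow> ?r")
proof
  assume "submodule H R M"
  then interpret submodule H R M .
  show ?r using subset one_closed m_closed smult_closed by auto
next
  assume r: ?r
  have "inv\<^bsub>add_monoid M\<^esub> x \<in> H" if "x \<in> H" for x
    using r that smult_minus_one[of x] R.a_inv_closed[OF R.one_closed]
    unfolding a_inv_def[of M] by (metis subsetD)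
  then show "submodule H R M"
    using r by (intro submodule.intro subgroup.intro submodule_axioms.intro) auto
qed

lemma submodule_carrier: "submodule (carrier M) R M"
  unfolding submodule_iff using lsmult_closed by auto

lemma submodule_zero: "submodule {\<zero>\<^bsub>M\<^esub>} R M"
  unfolding submodule_iff using smult_zero_right by auto

context
  fixes H assumes H: "submodule H R M"
begin

lemma submodule_subset: "H \<subseteq> carrier M"
  and submodule_zero_mem: "\<zero>\<^bsub>M\<^esub> \<in> H"
  and submodule_add: "x \<in> H \<Longrightarrow> y \<in> H \<Longrightarrow> x \<oplus>\<^bsub>M\<^esub> y \<in> H"
  and submodule_smult: "a \<in> carrier R \<Longrightarrow> x \<in> H \<Longrightarrow> a \<odot>\<^bsub>M\<^esub> x \<in> H"
  using H unfolding submodule_iff by auto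

lemma submodule_neg: "x \<in> H \<Longrightarrow> \<ominus>\<^bsub>M\<^esub> x \<in> H"
  using submodule_smult[of "\<ominus>\<^bsub>R\<^esub> \<one>\<^bsub>R\<^esub>" x] submodule_subset by (auto simp: smult_minus_one)

lemma submodule_add_cancel:
  assumes "x \<in> H" "y \<in> carrier M" "x \<oplus>\<^bsub>M\<^esub> y \<in> H" shows "y \<in> H"
proof -
  have x: "x \<in> carrier M" using assms(1) submodule_subset by auto
  have "\<ominus>\<^bsub>M\<^esub> x \<oplus>\<^bsub>M\<^esub> (x \<oplus>\<^bsub>M\<^esub> y) \<in> H" using assms submodule_add submodule_neg by auto
  then show ?thesis using x assms(2) M.r_neg1 by simp
qed

lemma restrict_left_module: "left_module R (restrict_module M H)"
proof -
  have c: "x \<in> carrier M" if "x \<in> H" for x using submodule_subset that by auto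
  have "abelian_group (restrict_module M H)"
  proof (rule abelian_groupI)
    fix x assume "x \<in> carrier (restrict_module M H)"
    then show "\<exists>y\<in>carrier (restrict_module M H). y \<oplus>\<^bsub>restrict_module M H\<^esub> x = \<zero>\<^bsub>restrict_module M H\<^esub>"
      using submodule_neg[of x] c[of x] by (intro bexI[of _ "\<ominus>\<^bsub>M\<^esub> x"]) (auto simp: M.l_neg)
  qed (use c in \<open>auto simp: submodule_zero_mem submodule_add M.a_ac\<close>)
  then show ?thesis
    by (intro left_module.intro left_module_axioms.intro R.ring_axioms)
       (use c in \<open>auto simp: submodule_smult lsmult_l_distr lsmult_r_distr lsmult_assoc lsmult_one\<close>)
qed

lemma submodule_restrict: "K \<subseteq> H \<Longrightarrow> submodule K R (restrict_module M H) \<longleftrightarrow> submodule K R M"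
  using left_module.submodule_iff[OF restrict_left_module] submodule_iff[of K] submodule_subset
  by auto

end

lemma submodule_gen:
  assumes "X \<subseteq> carrier M" shows "submodule (gen_submodule R M X) R M"
  using assms submodule_carrier unfolding submodule_iff[of "gen_submodule R M X"] gen_submodule_def hull_def
  by (auto simp: submodule_iff)

lemma gen_incl: "X \<subseteq> gen_submodule R M X"
  unfolding gen_submodule_def by (rule hull_subset)

lemma gen_minimal: "X \<subseteq> H \<Longrightarrow> submodule H R M \<Longrightarrow> gen_submodule R M X \<subseteq> H"
  unfolding gen_submodule_def by (rule hull_minimal)

lemma gen_mono: "X \<subseteq> Y \<Longrightarrow> gen_submodule R M X \<subseteq> gen_submodule R M Y"
  unfolding gen_submodule_def by (rule hull_mono)

lemma gen_subset: "X \<subseteq> carrier M \<Longrightarrow> gen_submodule R M X \<subseteq> carrier M"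
  using gen_minimal submodule_carrier by auto

text \<open>The elements generated by finite subsets of \<open>X\<close> already form a submodule
  containing \<open>X\<close>, because the supports of two summands can be united. This finitary
  character is behind both the continuity at limits and the finite supports in terms of
  indices.\<close>

lemma gen_finite_support:
  assumes X: "X \<subseteq> carrier M" and x: "x \<in> gen_submodule R M X"
  shows "\<exists>X0. finite X0 \<and> X0 \<subseteq> X \<and> x \<in> gen_submodule R M X0"
proof -
  let ?H = "{x. \<exists>X0. finite X0 \<and> X0 \<subseteq> X \<and> x \<in> gen_submodule R M X0}"
  have s: "submodule (gen_submodule R M X0) R M" if "X0 \<subseteq> X" for X0
    using submodule_gen that X by auto
  have "submodule ?H R M" unfolding submodule_iff
  proof (intro conjI ballI)
    show "?H \<subseteq> carrier M" using s submodule_subset by blast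
    show "\<zero>\<^bsub>M\<^esub> \<in> ?H" using submodule_zero_mem[OF s[of "{}"]] by blast
    fix x y assume "x \<in> ?H" "y \<in> ?H"
    then obtain A B where *: "finite A" "A \<subseteq> X" "x \<in> gen_submodule R M A"
      "finite B" "B \<subseteq> X" "y \<in> gen_submodule R M B" by blast
    then have "x \<oplus>\<^bsub>M\<^esub> y \<in> gen_submodule R M (A \<union> B)"
      using submodule_add[OF s[of "A \<union> B"]] gen_mono[of A "A \<union> B"] gen_mono[of B "A \<union> B"] by blast
    then show "x \<oplus>\<^bsub>M\<^esub> y \<in> ?H" using * by blast
  next
    fix a x assume "a \<in> carrier R" "x \<in> ?H"
    then show "a \<odot>\<^bsub>M\<^esub> x \<in> ?H" using submodule_smult s by blast
  qed
  moreover have "X \<subseteq> ?H"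
  proof
    fix x assume "x \<in> X"
    then show "x \<in> ?H" using gen_incl[of "{x}"] by (intro CollectI exI[of _ "{x}"]) auto
  qed
  ultimately show ?thesis using gen_minimal x by blast
qed

lemma gen_Un_submodule:
  assumes H: "submodule H R M" and K: "submodule K R M"
  shows "gen_submodule R M (H \<union> K) = {x \<oplus>\<^bsub>M\<^esub> y | x y. x \<in> H \<and> y \<in> K}" (is "_ = ?S")
proof
  note h = submodule_subset[OF H] submodule_zero_mem[OF H] submodule_add[OF H] submodule_smult[OF H]
  note k = submodule_subset[OF K] submodule_zero_mem[OF K] submodule_add[OF K] submodule_smult[OF K]
  have hc: "\<And>x. x \<in> H \<Longrightarrow> x \<in> carrier M" and kc: "\<And>x. x \<in> K \<Longrightarrow> x \<in> carrier M"
    using h k by auto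
  have "submodule ?S R M" unfolding submodule_iff
  proof (intro conjI ballI)
    show "?S \<subseteq> carrier M" using h k by auto
    have "\<zero>\<^bsub>M\<^esub> = \<zero>\<^bsub>M\<^esub> \<oplus>\<^bsub>M\<^esub> \<zero>\<^bsub>M\<^esub>" by simp
    then show "\<zero>\<^bsub>M\<^esub> \<in> ?S" using h(2) k(2) by blast
    fix x y assume "x \<in> ?S" "y \<in> ?S"
    then obtain a b c d where *: "x = a \<oplus>\<^bsub>M\<^esub> b" "y = c \<oplus>\<^bsub>M\<^esub> d" "a \<in> H" "c \<in> H" "b \<in> K" "d \<in> K" by blast
    have "a \<in> carrier M" "b \<in> carrier M" "c \<in> carrier M" "d \<in> carrier M" using * hc kc by auto
    then have "x \<oplus>\<^bsub>M\<^esub> y = (a \<oplus>\<^bsub>M\<^esub> c) \<oplus>\<^bsub>M\<^esub> (b \<oplus>\<^bsub>M\<^esub> d)"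
      unfolding *(1,2) by (simp add: M.a_ac)
    moreover have "a \<oplus>\<^bsub>M\<^esub> c \<in> H" "b \<oplus>\<^bsub>M\<^esub> d \<in> K" using * h(3) k(3) by auto
    ultimately show "x \<oplus>\<^bsub>M\<^esub> y \<in> ?S" by blast
  next
    fix a x assume a: "a \<in> carrier R" "x \<in> ?S"
    then obtain y z where yz: "x = y \<oplus>\<^bsub>M\<^esub> z" "y \<in> H" "z \<in> K" by blast
    then have "a \<odot>\<^bsub>M\<^esub> x = a \<odot>\<^bsub>M\<^esub> y \<oplus>\<^bsub>M\<^esub> a \<odot>\<^bsub>M\<^esub> z"
      using lsmult_r_distr[OF a(1) hc kc] by simp
    moreover have "a \<odot>\<^bsub>M\<^esub> y \<in> H" "a \<odot>\<^bsub>M\<^esub> z \<in> K" using yz h(4) k(4) a(1) by auto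
    ultimately show "a \<odot>\<^bsub>M\<^esub> x \<in> ?S" by blast
  qed
  moreover have "H \<subseteq> ?S"
  proof
    fix x assume x: "x \<in> H"
    then have "x = x \<oplus>\<^bsub>M\<^esub> \<zero>\<^bsub>M\<^esub>" using hc by simp
    then show "x \<in> ?S" using x k(2) by blast
  qed
  moreover have "K \<subseteq> ?S"
  proof
    fix x assume x: "x \<in> K"
    then have "x = \<zero>\<^bsub>M\<^esub> \<oplus>\<^bsub>M\<^esub> x" using kc by simp
    then show "x \<in> ?S" using x h(2) by blast
  qed
  ultimately show "gen_submodule R M (H \<union> K) \<subseteq> ?S" by (intro gen_minimal) auto
  have "submodule (gen_submodule R M (H \<union> K)) R M" using h k by (intro submodule_gen) auto
  then show "?S \<subseteq> gen_submodule R M (H \<union> K)"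
    using submodule_add gen_incl[of "H \<union> K"] by blast
qed

end

section \<open>Linear maps, images and preimages of submodules\<close>

definition module_hom :: "('r, 'x) ring_scheme \<Rightarrow> ('r, 'm) module \<Rightarrow> ('r, 'n) module \<Rightarrow> ('m \<Rightarrow> 'n) set" where
  "module_hom R M N = {f \<in> carrier M \<rightarrow> carrier N.
     (\<forall>x\<in>carrier M. \<forall>y\<in>carrier M. f (x \<oplus>\<^bsub>M\<^esub> y) = f x \<oplus>\<^bsub>N\<^esub> f y) \<and>
     (\<forall>a\<in>carrier R. \<forall>x\<in>carrier M. f (a \<odot>\<^bsub>M\<^esub> x) = a \<odot>\<^bsub>N\<^esub> f x)}"

lemma module_iso_iff:
  "f \<in> module_iso R M N \<longleftrightarrow> f \<in> module_hom R M N \<and> bij_betw f (carrier M) (carrier N)"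
  unfolding module_iso_def module_hom_def iso_def hom_def by auto

locale linear_map = M?: left_module R M + N?: left_module R N
  for R :: "('r, 'x) ring_scheme" (structure) and M :: "('r, 'm) module" (structure)
    and N :: "('r, 'n) module" (structure) +
  fixes f assumes hom: "f \<in> module_hom R M N"
begin

lemma map_closed: "x \<in> carrier M \<Longrightarrow> f x \<in> carrier N"
  and map_add: "x \<in> carrier M \<Longrightarrow> y \<in> carrier M \<Longrightarrow> f (x \<oplus>\<^bsub>M\<^esub> y) = f x \<oplus>\<^bsub>N\<^esub> f y"
  and map_smult: "a \<in> carrier R \<Longrightarrow> x \<in> carrier M \<Longrightarrow> f (a \<odot>\<^bsub>M\<^esub> x) = a \<odot>\<^bsub>N\<^esub> f x"
  using hom unfolding module_hom_def by auto

lemma map_zero: "f \<zero>\<^bsub>M\<^esub> = \<zero>\<^bsub>N\<^esub>"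
  using map_smult[of "\<zero>\<^bsub>R\<^esub>" "\<zero>\<^bsub>M\<^esub>"] M.smult_zero_left[of "\<zero>\<^bsub>M\<^esub>"] N.smult_zero_left[of "f \<zero>\<^bsub>M\<^esub>"]
    map_closed[of "\<zero>\<^bsub>M\<^esub>"] by simp

lemma map_neg: "x \<in> carrier M \<Longrightarrow> f (\<ominus>\<^bsub>M\<^esub> x) = \<ominus>\<^bsub>N\<^esub> f x"
  using map_smult[of "\<ominus>\<^bsub>R\<^esub> \<one>\<^bsub>R\<^esub>" x] M.smult_minus_one[of x] N.smult_minus_one[of "f x"] map_closed[of x]
  by simp

lemma map_minus: "x \<in> carrier M \<Longrightarrow> y \<in> carrier M \<Longrightarrow> f (x \<ominus>\<^bsub>M\<^esub> y) = f x \<ominus>\<^bsub>N\<^esub> f y"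
  unfolding a_minus_def by (simp add: map_add map_neg)

lemma submodule_image:
  assumes H: "submodule H R M" shows "submodule (f ` H) R N"
  unfolding N.submodule_iff
proof (intro conjI ballI)
  have c: "\<And>x. x \<in> H \<Longrightarrow> x \<in> carrier M" using M.submodule_subset[OF H] by auto
  show "f ` H \<subseteq> carrier N" using c map_closed by auto
  show "\<zero>\<^bsub>N\<^esub> \<in> f ` H" using map_zero M.submodule_zero_mem[OF H] by force
  show "x \<oplus>\<^bsub>N\<^esub> y \<in> f ` H" if xy: "x \<in> f ` H" "y \<in> f ` H" for x y
  proof -
    obtain u v where u: "u \<in> H" "x = f u" and v: "v \<in> H" "y = f v" using xy by auto
    then have "x \<oplus>\<^bsub>N\<^esub> y = f (u \<oplus>\<^bsub>M\<^esub> v)" using c map_add by auto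
    then show ?thesis using M.submodule_add[OF H u(1) v(1)] by auto
  qed
  show "a \<odot>\<^bsub>N\<^esub> x \<in> f ` H" if ax: "a \<in> carrier R" "x \<in> f ` H" for a x
  proof -
    obtain u where u: "u \<in> H" "x = f u" using ax by auto
    then have "a \<odot>\<^bsub>N\<^esub> x = f (a \<odot>\<^bsub>M\<^esub> u)" using c map_smult ax(1) by auto
    then show ?thesis using M.submodule_smult[OF H ax(1) u(1)] by auto
  qed
qed

lemma submodule_vimage:
  assumes K: "submodule K R N" shows "submodule {x \<in> carrier M. f x \<in> K} R M"
  unfolding M.submodule_iff
  using N.submodule_zero_mem[OF K] N.submodule_add[OF K] N.submodule_smult[OF K]
  by (auto simp: map_zero map_add map_smult M.lsmult_closed)

text \<open>Each inclusion is the minimality of a hull, applied once to a preimage and once to an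
  image of a submodule.\<close>

lemma image_gen:
  assumes X: "X \<subseteq> carrier M"
  shows "f ` gen_submodule R M X = gen_submodule R N (f ` X)"
proof
  have fX: "f ` X \<subseteq> carrier N" using X map_closed by auto
  have "X \<subseteq> {x \<in> carrier M. f x \<in> gen_submodule R N (f ` X)}" using X N.gen_incl[of "f ` X"] by auto
  then have "gen_submodule R M X \<subseteq> {x \<in> carrier M. f x \<in> gen_submodule R N (f ` X)}"
    using submodule_vimage[OF N.submodule_gen[OF fX]] M.gen_minimal by blast
  then show "f ` gen_submodule R M X \<subseteq> gen_submodule R N (f ` X)" by auto
  show "gen_submodule R N (f ` X) \<subseteq> f ` gen_submodule R M X"
    using M.gen_incl[of X] submodule_image[OF M.submodule_gen[OF X]] by (intro N.gen_minimal) auto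
qed

end

section \<open>Quotient modules and the first isomorphism theorem\<close>

context left_module
begin

context
  fixes U assumes U: "submodule U R M"
begin

lemma coset_mem: "x \<in> carrier M \<Longrightarrow> y \<in> U +>\<^bsub>M\<^esub> x \<longleftrightarrow> y \<in> carrier M \<and> y \<ominus>\<^bsub>M\<^esub> x \<in> U"
proof -
  assume x: "x \<in> carrier M"
  have "y \<in> U +>\<^bsub>M\<^esub> x \<longleftrightarrow> (\<exists>h\<in>U. y = h \<oplus>\<^bsub>M\<^esub> x)" by (auto simp: a_r_coset_def')
  also have "\<dots> \<longleftrightarrow> y \<in> carrier M \<and> y \<ominus>\<^bsub>M\<^esub> x \<in> U"
  proof
    assume "\<exists>h\<in>U. y = h \<oplus>\<^bsub>M\<^esub> x"
    then obtain h where h: "h \<in> U" "y = h \<oplus>\<^bsub>M\<^esub> x" by auto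
    then have hc: "h \<in> carrier M" using submodule_subset[OF U] by auto
    have "y \<ominus>\<^bsub>M\<^esub> x = h" using hc x h(2) by (simp add: a_minus_def M.a_assoc M.r_neg)
    then show "y \<in> carrier M \<and> y \<ominus>\<^bsub>M\<^esub> x \<in> U" using h hc x by auto
  next
    assume y: "y \<in> carrier M \<and> y \<ominus>\<^bsub>M\<^esub> x \<in> U"
    then have "y = (y \<ominus>\<^bsub>M\<^esub> x) \<oplus>\<^bsub>M\<^esub> x" using x by (simp add: a_minus_def M.a_assoc M.l_neg)
    then show "\<exists>h\<in>U. y = h \<oplus>\<^bsub>M\<^esub> x" using y by blast
  qed
  finally show ?thesis .
qed

lemma coset_eq_iff:
  assumes x: "x \<in> carrier M" and y: "y \<in> carrier M"
  shows "U +>\<^bsub>M\<^esub> x = U +>\<^bsub>M\<^esub> y \<longleftrightarrow> x \<ominus>\<^bsub>M\<^esub> y \<in> U"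
proof
  assume "U +>\<^bsub>M\<^esub> x = U +>\<^bsub>M\<^esub> y"
  moreover have "x \<in> U +>\<^bsub>M\<^esub> x"
    using x coset_mem[OF x, of x] submodule_zero_mem[OF U] by (simp add: M.minus_eq M.r_neg)
  ultimately show "x \<ominus>\<^bsub>M\<^esub> y \<in> U" using coset_mem[OF y] by auto
next
  assume xy: "x \<ominus>\<^bsub>M\<^esub> y \<in> U"
  have "z \<ominus>\<^bsub>M\<^esub> x \<in> U \<longleftrightarrow> z \<ominus>\<^bsub>M\<^esub> y \<in> U" if z: "z \<in> carrier M" for z
  proof -
    have "z \<ominus>\<^bsub>M\<^esub> y = (x \<ominus>\<^bsub>M\<^esub> y) \<oplus>\<^bsub>M\<^esub> (z \<ominus>\<^bsub>M\<^esub> x)"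
    proof -
      have "(x \<ominus>\<^bsub>M\<^esub> y) \<oplus>\<^bsub>M\<^esub> (z \<ominus>\<^bsub>M\<^esub> x) = (z \<ominus>\<^bsub>M\<^esub> y) \<oplus>\<^bsub>M\<^esub> (x \<oplus>\<^bsub>M\<^esub> \<ominus>\<^bsub>M\<^esub> x)"
        using x y z by (simp add: a_minus_def M.a_ac)
      then show ?thesis using x y z by (simp add: M.r_neg)
    qed
    then show ?thesis using submodule_add[OF U xy] submodule_add_cancel[OF U xy] x z by auto
  qed
  then show "U +>\<^bsub>M\<^esub> x = U +>\<^bsub>M\<^esub> y" using coset_mem[OF x] coset_mem[OF y] by auto
qed

lemma coset_zero: "U +>\<^bsub>M\<^esub> \<zero>\<^bsub>M\<^esub> = U"
  using submodule_subset[OF U] by (auto simp: coset_mem minus_zero_right)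

lemma coset_self: "x \<in> carrier M \<Longrightarrow> x \<in> U +>\<^bsub>M\<^esub> x"
  using coset_mem submodule_zero_mem[OF U] by (simp add: M.minus_eq M.r_neg)

lemma quot_add:
  assumes x: "x \<in> carrier M" and y: "y \<in> carrier M"
  shows "(U +>\<^bsub>M\<^esub> x) <+>\<^bsub>M\<^esub> (U +>\<^bsub>M\<^esub> y) = U +>\<^bsub>M\<^esub> (x \<oplus>\<^bsub>M\<^esub> y)"
proof -
  have "subgroup U (add_monoid M)" using U by (rule submodule.axioms)
  then have "abelian_subgroup U M"
    using M.abelian_group_axioms M.abelian_group_axioms abelian_subgroupI3 additive_subgroupI by blast
  then show ?thesis by (rule abelian_subgroup.a_rcos_sum[OF _ x y])
qed

text \<open>In \<open>quot_module\<close> a multiple is a union of cosets, one for each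
  representative of the argument. All these cosets are equal, so the union collapses.\<close>

lemma quot_smult:
  assumes a: "a \<in> carrier R" and x: "x \<in> carrier M"
  shows "(\<Union>y\<in>U +>\<^bsub>M\<^esub> x. U +>\<^bsub>M\<^esub> (a \<odot>\<^bsub>M\<^esub> y)) = U +>\<^bsub>M\<^esub> (a \<odot>\<^bsub>M\<^esub> x)"
proof -
  have "U +>\<^bsub>M\<^esub> (a \<odot>\<^bsub>M\<^esub> y) = U +>\<^bsub>M\<^esub> (a \<odot>\<^bsub>M\<^esub> x)" if "y \<in> U +>\<^bsub>M\<^esub> x" for y
  proof -
    have y: "y \<in> carrier M" "y \<ominus>\<^bsub>M\<^esub> x \<in> U" using that coset_mem[OF x] by auto
    have "a \<odot>\<^bsub>M\<^esub> x \<oplus>\<^bsub>M\<^esub> a \<odot>\<^bsub>M\<^esub> (y \<ominus>\<^bsub>M\<^esub> x) = a \<odot>\<^bsub>M\<^esub> (x \<oplus>\<^bsub>M\<^esub> (y \<ominus>\<^bsub>M\<^esub> x))"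
      using lsmult_r_distr[OF a x, of "y \<ominus>\<^bsub>M\<^esub> x"] x y by simp
    also have "x \<oplus>\<^bsub>M\<^esub> (y \<ominus>\<^bsub>M\<^esub> x) = y"
    proof -
      have "x \<oplus>\<^bsub>M\<^esub> (y \<ominus>\<^bsub>M\<^esub> x) = y \<oplus>\<^bsub>M\<^esub> (x \<oplus>\<^bsub>M\<^esub> \<ominus>\<^bsub>M\<^esub> x)"
        using x y(1) by (simp add: a_minus_def M.a_lcomm)
      then show ?thesis using x y(1) by (simp add: M.r_neg)
    qed
    finally have e: "a \<odot>\<^bsub>M\<^esub> y = a \<odot>\<^bsub>M\<^esub> x \<oplus>\<^bsub>M\<^esub> a \<odot>\<^bsub>M\<^esub> (y \<ominus>\<^bsub>M\<^esub> x)" by simp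
    have c: "a \<odot>\<^bsub>M\<^esub> x \<in> carrier M" "a \<odot>\<^bsub>M\<^esub> (y \<ominus>\<^bsub>M\<^esub> x) \<in> carrier M"
      using lsmult_closed a x y by auto
    have cancel: "(u \<oplus>\<^bsub>M\<^esub> v) \<ominus>\<^bsub>M\<^esub> u = v" if "u \<in> carrier M" "v \<in> carrier M" for u v
    proof -
      have "(u \<oplus>\<^bsub>M\<^esub> v) \<ominus>\<^bsub>M\<^esub> u = v \<oplus>\<^bsub>M\<^esub> (u \<oplus>\<^bsub>M\<^esub> \<ominus>\<^bsub>M\<^esub> u)"
        using that by (simp add: a_minus_def M.a_ac)
      then show ?thesis using that by (simp add: M.r_neg)
    qed
    have "a \<odot>\<^bsub>M\<^esub> y \<ominus>\<^bsub>M\<^esub> a \<odot>\<^bsub>M\<^esub> x = a \<odot>\<^bsub>M\<^esub> (y \<ominus>\<^bsub>M\<^esub> x)"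
      unfolding e by (rule cancel[OF c])
    then show ?thesis
      using coset_eq_iff[OF lsmult_closed[OF a y(1)] c(1)] submodule_smult[OF U a y(2)] by simp
  qed
  then show ?thesis using coset_self[OF x] by blast
qed

lemma carrier_quot: "carrier (quot_module M U) = (\<lambda>x. U +>\<^bsub>M\<^esub> x) ` carrier M"
  by (auto simp: quot_module_def A_RCOSETS_def')

lemma zero_quot: "\<zero>\<^bsub>quot_module M U\<^esub> = U"
  by (simp add: quot_module_def)

lemma add_quot:
  assumes "x \<in> carrier M" "y \<in> carrier M"
  shows "(U +>\<^bsub>M\<^esub> x) \<oplus>\<^bsub>quot_module M U\<^esub> (U +>\<^bsub>M\<^esub> y) = U +>\<^bsub>M\<^esub> (x \<oplus>\<^bsub>M\<^esub> y)"
  using quot_add[OF assms] by (simp add: quot_module_def)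

lemma smult_quot:
  assumes "a \<in> carrier R" "x \<in> carrier M"
  shows "a \<odot>\<^bsub>quot_module M U\<^esub> (U +>\<^bsub>M\<^esub> x) = U +>\<^bsub>M\<^esub> (a \<odot>\<^bsub>M\<^esub> x)"
  using quot_smult[OF assms] by (simp add: quot_module_def)

lemma quot_cases:
  assumes "X \<in> carrier (quot_module M U)"
  obtains x where "x \<in> carrier M" "X = U +>\<^bsub>M\<^esub> x"
  using assms unfolding carrier_quot by blast

lemma coset_in_quot: "x \<in> carrier M \<Longrightarrow> U +>\<^bsub>M\<^esub> x \<in> carrier (quot_module M U)"
  unfolding carrier_quot by blast

lemma quot_left_module: "left_module R (quot_module M U)"
proof -
  let ?Q = "quot_module M U"
  have ag: "abelian_group ?Q"
  proof (rule abelian_groupI)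
    fix x y assume "x \<in> carrier ?Q" "y \<in> carrier ?Q"
    then show "x \<oplus>\<^bsub>?Q\<^esub> y \<in> carrier ?Q"
      by (elim quot_cases) (simp add: add_quot coset_in_quot)
  next
    show "\<zero>\<^bsub>?Q\<^esub> \<in> carrier ?Q" using coset_in_quot[of "\<zero>\<^bsub>M\<^esub>"] by (simp add: zero_quot coset_zero)
  next
    fix x y z assume "x \<in> carrier ?Q" "y \<in> carrier ?Q" "z \<in> carrier ?Q"
    then show "x \<oplus>\<^bsub>?Q\<^esub> y \<oplus>\<^bsub>?Q\<^esub> z = x \<oplus>\<^bsub>?Q\<^esub> (y \<oplus>\<^bsub>?Q\<^esub> z)"
      by (elim quot_cases) (simp add: add_quot M.a_assoc)
  next
    fix x y assume "x \<in> carrier ?Q" "y \<in> carrier ?Q"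
    then show "x \<oplus>\<^bsub>?Q\<^esub> y = y \<oplus>\<^bsub>?Q\<^esub> x"
      by (elim quot_cases) (simp add: add_quot M.a_comm)
  next
    fix x assume "x \<in> carrier ?Q"
    then show "\<zero>\<^bsub>?Q\<^esub> \<oplus>\<^bsub>?Q\<^esub> x = x"
      using add_quot[of "\<zero>\<^bsub>M\<^esub>"] by (elim quot_cases) (simp add: zero_quot coset_zero)
  next
    fix x assume "x \<in> carrier ?Q"
    then obtain a where a: "a \<in> carrier M" "x = U +>\<^bsub>M\<^esub> a" by (rule quot_cases)
    then have "(U +>\<^bsub>M\<^esub> (\<ominus>\<^bsub>M\<^esub> a)) \<oplus>\<^bsub>?Q\<^esub> x = \<zero>\<^bsub>?Q\<^esub>"
      by (simp add: add_quot zero_quot M.l_neg coset_zero)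
    then show "\<exists>y\<in>carrier ?Q. y \<oplus>\<^bsub>?Q\<^esub> x = \<zero>\<^bsub>?Q\<^esub>" using a coset_in_quot by (meson M.a_inv_closed)
  qed
  show ?thesis
  proof (intro left_module.intro left_module_axioms.intro ag R.ring_axioms)
    fix a x assume "a \<in> carrier R" "x \<in> carrier ?Q"
    then show "a \<odot>\<^bsub>?Q\<^esub> x \<in> carrier ?Q"
      by (elim quot_cases) (simp add: smult_quot coset_in_quot lsmult_closed)
  next
    fix a b x assume "a \<in> carrier R" "b \<in> carrier R" "x \<in> carrier ?Q"
    then show "(a \<oplus>\<^bsub>R\<^esub> b) \<odot>\<^bsub>?Q\<^esub> x = a \<odot>\<^bsub>?Q\<^esub> x \<oplus>\<^bsub>?Q\<^esub> b \<odot>\<^bsub>?Q\<^esub> x"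
      by (elim quot_cases) (simp add: smult_quot add_quot lsmult_closed lsmult_l_distr)
  next
    fix a x y assume "a \<in> carrier R" "x \<in> carrier ?Q" "y \<in> carrier ?Q"
    then show "a \<odot>\<^bsub>?Q\<^esub> (x \<oplus>\<^bsub>?Q\<^esub> y) = a \<odot>\<^bsub>?Q\<^esub> x \<oplus>\<^bsub>?Q\<^esub> a \<odot>\<^bsub>?Q\<^esub> y"
      by (elim quot_cases) (simp add: smult_quot add_quot lsmult_closed lsmult_r_distr)
  next
    fix a b x assume "a \<in> carrier R" "b \<in> carrier R" "x \<in> carrier ?Q"
    then show "(a \<otimes>\<^bsub>R\<^esub> b) \<odot>\<^bsub>?Q\<^esub> x = a \<odot>\<^bsub>?Q\<^esub> (b \<odot>\<^bsub>?Q\<^esub> x)"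
      by (elim quot_cases) (simp add: smult_quot lsmult_closed lsmult_assoc)
  next
    fix x assume "x \<in> carrier ?Q"
    then show "\<one>\<^bsub>R\<^esub> \<odot>\<^bsub>?Q\<^esub> x = x" by (elim quot_cases) (simp add: smult_quot lsmult_one)
  qed
qed

lemma quot_map: "linear_map R M (quot_module M U) (\<lambda>x. U +>\<^bsub>M\<^esub> x)"
  by (intro linear_map.intro linear_map_axioms.intro left_module_axioms quot_left_module)
     (simp add: module_hom_def coset_in_quot add_quot smult_quot)

lemma quot_map_eq_zero: "x \<in> carrier M \<Longrightarrow> U +>\<^bsub>M\<^esub> x = \<zero>\<^bsub>quot_module M U\<^esub> \<longleftrightarrow> x \<in> U"
  using coset_eq_iff[of x "\<zero>\<^bsub>M\<^esub>"] coset_zero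
  by (simp add: zero_quot minus_zero_right)

end

end

lemma (in linear_map) first_isomorphism:
  assumes surj: "f ` carrier M = carrier N"
    and ker: "U = {x \<in> carrier M. f x = \<zero>\<^bsub>N\<^esub>}"
  shows "module_isomorphic R (quot_module M U) N"
proof -
  have U: "submodule U R M"
    using submodule_vimage[OF N.submodule_zero] unfolding ker by simp
  \<comment> \<open>\<open>f\<close> is constant on the cosets of its kernel, so the induced map may
    evaluate \<open>f\<close> at an arbitrarily chosen representative.\<close>
  let ?h = "\<lambda>X. f (SOME x. x \<in> X)"
  have h: "?h (U +>\<^bsub>M\<^esub> x) = f x" if x: "x \<in> carrier M" for x
  proof -
    have "(SOME y. y \<in> U +>\<^bsub>M\<^esub> x) \<in> U +>\<^bsub>M\<^esub> x" (is "?y \<in> _")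
      using M.coset_self[OF U x] by (rule someI)
    then have y: "?y \<in> carrier M" "?y \<ominus>\<^bsub>M\<^esub> x \<in> U" using M.coset_mem[OF U x] by auto
    then have "f ?y \<ominus>\<^bsub>N\<^esub> f x = \<zero>\<^bsub>N\<^esub>" using map_minus[OF y(1) x] ker by auto
    then show ?thesis using map_closed x y by (simp add: N.minus_eq_zero_iff)
  qed
  have "?h \<in> module_hom R (quot_module M U) N"
    unfolding module_hom_def
  proof (intro CollectI conjI ballI Pi_I)
    fix X assume "X \<in> carrier (quot_module M U)"
    then show "?h X \<in> carrier N" by (elim M.quot_cases[OF U]) (simp add: h map_closed)
  next
    fix X Y assume "X \<in> carrier (quot_module M U)" "Y \<in> carrier (quot_module M U)"
    then show "?h (X \<oplus>\<^bsub>quot_module M U\<^esub> Y) = ?h X \<oplus>\<^bsub>N\<^esub> ?h Y"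
      by (elim M.quot_cases[OF U]) (simp add: M.add_quot[OF U] h map_add)
  next
    fix a X assume "a \<in> carrier R" "X \<in> carrier (quot_module M U)"
    then show "?h (a \<odot>\<^bsub>quot_module M U\<^esub> X) = a \<odot>\<^bsub>N\<^esub> ?h X"
      by (elim M.quot_cases[OF U]) (simp add: M.smult_quot[OF U] h map_smult M.lsmult_closed)
  qed
  moreover have "inj_on ?h (carrier (quot_module M U))"
  proof (rule inj_onI)
    fix X Y assume *: "X \<in> carrier (quot_module M U)" "Y \<in> carrier (quot_module M U)" "?h X = ?h Y"
    then obtain x y where xy: "x \<in> carrier M" "X = U +>\<^bsub>M\<^esub> x" "y \<in> carrier M" "Y = U +>\<^bsub>M\<^esub> y"
      by (elim M.quot_cases[OF U])
    then have "f (x \<ominus>\<^bsub>M\<^esub> y) = \<zero>\<^bsub>N\<^esub>" using *(3) h map_minus map_closed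
      by (simp add: N.minus_eq_zero_iff)
    then have "x \<ominus>\<^bsub>M\<^esub> y \<in> U" using xy unfolding ker by simp
    then show "X = Y" using xy M.coset_eq_iff[OF U] by simp
  qed
  moreover have "?h ` carrier (quot_module M U) = carrier N"
    unfolding surj[symmetric] M.carrier_quot[OF U] image_image using h by (intro image_cong) auto
  ultimately show ?thesis
    unfolding module_isomorphic_def using module_iso_iff[of ?h R "quot_module M U" N]
    by (auto simp: bij_betw_def)
qed

lemma module_isomorphic_sym:
  assumes "left_module R M" "left_module R N" "module_isomorphic R M N"
  shows "module_isomorphic R N M"
proof -
  interpret M: left_module R M by (rule assms(1))
  interpret N: left_module R N by (rule assms(2))
  obtain f where f: "f \<in> module_hom R M N" "bij_betw f (carrier M) (carrier N)"
    using assms(3) unfolding module_isomorphic_def using module_iso_iff[of _ R M N] by auto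
  interpret f: linear_map R M N f by unfold_locales (rule f)
  define g where "g = inv_into (carrier M) f"
  have g: "bij_betw g (carrier N) (carrier M)" unfolding g_def using f(2) by (rule bij_betw_inv_into)
  have gf: "g (f x) = x" if "x \<in> carrier M" for x
    unfolding g_def using f(2) that by (simp add: bij_betw_inv_into_left)
  have s: "carrier N = f ` carrier M" using f(2) by (simp add: bij_betw_def)
  have "g \<in> module_hom R N M"
    unfolding module_hom_def using bij_betwE[OF g]
    by (auto simp: s gf f.map_add[symmetric] f.map_smult[symmetric] M.lsmult_closed)
  then show ?thesis
    unfolding module_isomorphic_def using module_iso_iff[of g R N M] g by auto
qed

lemma module_hom_comp:
  "f \<in> module_hom R M N \<Longrightarrow> g \<in> module_hom R N Q \<Longrightarrow> g \<circ> f \<in> module_hom R M Q"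
  unfolding module_hom_def by (auto simp: Pi_iff)

lemma module_isomorphic_trans:
  assumes "module_isomorphic R M N" "module_isomorphic R N Q"
  shows "module_isomorphic R M Q"
proof -
  obtain f where "f \<in> module_hom R M N" "bij_betw f (carrier M) (carrier N)"
    using assms(1) unfolding module_isomorphic_def ex_in_conv[symmetric] module_iso_iff by blast
  moreover obtain g where "g \<in> module_hom R N Q" "bij_betw g (carrier N) (carrier Q)"
    using assms(2) unfolding module_isomorphic_def ex_in_conv[symmetric] module_iso_iff by blast
  ultimately have "g \<circ> f \<in> module_hom R M Q \<and> bij_betw (g \<circ> f) (carrier M) (carrier Q)"
    using module_hom_comp bij_betw_trans by blast
  then show ?thesis unfolding module_isomorphic_def ex_in_conv[symmetric] module_iso_iff by blast
qed

lemma linear_map_comp: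
  assumes "linear_map R M N f" "linear_map R N Q g" shows "linear_map R M Q (g \<circ> f)"
proof -
  interpret f: linear_map R M N f by fact
  interpret g: linear_map R N Q g by fact
  show ?thesis
    by (intro linear_map.intro linear_map_axioms.intro f.M.left_module_axioms g.N.left_module_axioms
        module_hom_comp[OF f.hom g.hom])
qed

lemma (in linear_map) restrict_map:
  assumes H: "submodule H R M" and K: "submodule K R N" and HK: "f ` H \<subseteq> K"
  shows "linear_map R (restrict_module M H) (restrict_module N K) f"
proof (intro linear_map.intro linear_map_axioms.intro M.restrict_left_module[OF H] N.restrict_left_module[OF K])
  have "x \<in> carrier M" "f x \<in> K" if "x \<in> H" for x
    using HK M.submodule_subset[OF H] that by auto
  then show "f \<in> module_hom R (restrict_module M H) (restrict_module N K)"
    by (simp add: module_hom_def map_add map_smult)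
qed

section \<open>Images of filtrations and presentations\<close>

lemma (in left_module) gen_restrict:
  assumes H: "submodule H R M" and X: "X \<subseteq> H"
  shows "gen_submodule R (restrict_module M H) X = gen_submodule R M X"
proof -
  interpret H: left_module R "restrict_module M H" by (rule restrict_left_module[OF H])
  have XM: "X \<subseteq> carrier M" using X submodule_subset[OF H] by auto
  have "submodule (gen_submodule R M X) R (restrict_module M H)"
    using submodule_restrict[OF H] submodule_gen[OF XM] gen_minimal[OF X H] by blast
  moreover have "gen_submodule R (restrict_module M H) X \<subseteq> H"
    using H.gen_subset[of X] X by simp
  then have "submodule (gen_submodule R (restrict_module M H) X) R M"
    using submodule_restrict[OF H] H.submodule_gen[of X] X by simp
  ultimately show ?thesis
    using H.gen_minimal gen_minimal gen_incl[of X] H.gen_incl[of X] by blast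
qed

text \<open>Restrict \<open>f\<close> to \<open>V\<close> and project modulo the image of
  \<open>U\<close>. The kernel of the composite is \<open>U\<close> plus the kernel of
  \<open>f\<close>, hence \<open>U\<close> itself by \<open>ker\<close>.\<close>

lemma (in linear_map) quot_image_iso:
  assumes U: "submodule U R M" and V: "submodule V R M" and UV: "U \<subseteq> V"
    and ker: "\<And>x. x \<in> carrier M \<Longrightarrow> f x = \<zero>\<^bsub>N\<^esub> \<Longrightarrow> x \<in> U"
  shows "module_isomorphic R (quot_module (restrict_module M V) U)
           (quot_module (restrict_module N (f ` V)) (f ` U))"
proof -
  let ?NV = "restrict_module N (f ` V)"
  have fV: "submodule (f ` V) R N" by (rule submodule_image[OF V])
  interpret NV: left_module R ?NV by (rule N.restrict_left_module[OF fV])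
  have fU: "submodule (f ` U) R ?NV"
    using N.submodule_restrict[OF fV, of "f ` U"] UV submodule_image[OF U] by auto
  interpret g: linear_map R "restrict_module M V" "quot_module ?NV (f ` U)"
      "(\<lambda>x. f ` U +>\<^bsub>?NV\<^esub> x) \<circ> f"
    by (rule linear_map_comp[OF restrict_map[OF V fV order_refl] NV.quot_map[OF fU]])
  show ?thesis
  proof (rule g.first_isomorphism)
    show "((\<lambda>x. f ` U +>\<^bsub>?NV\<^esub> x) \<circ> f) ` carrier (restrict_module M V) = carrier (quot_module ?NV (f ` U))"
      unfolding NV.carrier_quot[OF fU] by (simp add: image_comp)
    have "f x \<in> f ` U \<longleftrightarrow> x \<in> U" if x: "x \<in> V" for x
    proof
      assume "f x \<in> f ` U"
      then obtain u where u: "u \<in> U" "f x = f u" by auto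
      have c: "x \<in> carrier M" "u \<in> carrier M" using M.submodule_subset[OF V] UV x u by auto
      then have "f (x \<ominus>\<^bsub>M\<^esub> u) = \<zero>\<^bsub>N\<^esub>" using u(2) map_minus N.minus_eq_zero_iff map_closed by auto
      then have d: "x \<ominus>\<^bsub>M\<^esub> u \<in> U" using ker c by simp
      have "u \<oplus>\<^bsub>M\<^esub> (x \<ominus>\<^bsub>M\<^esub> u) = x \<oplus>\<^bsub>M\<^esub> (u \<oplus>\<^bsub>M\<^esub> \<ominus>\<^bsub>M\<^esub> u)"
        using c by (simp add: a_minus_def M.M.a_lcomm)
      then have "u \<oplus>\<^bsub>M\<^esub> (x \<ominus>\<^bsub>M\<^esub> u) = x" using c by (simp add: M.M.r_neg)
      then show "x \<in> U" using M.submodule_add[OF U u(1) d] by simp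
    qed auto
    then show "U = {x \<in> carrier (restrict_module M V). ((\<lambda>x. f ` U +>\<^bsub>?NV\<^esub> x) \<circ> f) x = \<zero>\<^bsub>quot_module ?NV (f ` U)\<^esub>}"
      using NV.quot_map_eq_zero[OF fU] UV by auto
  qed
qed

text \<open>Correspondence theorem for filtrations. The filtration of \<open>M\<close> starts at the
  kernel instead of zero, so all its members contain the kernel and \<open>quot_image_iso\<close>
  preserves every factor. In this way filtrations of quotients are obtained from chains of
  submodules of the ambient module.\<close>

lemma (in linear_map) class_filtration_image:
  fixes r :: "'i rel"
  assumes surj: "f ` carrier M = carrier N" and fil: "filtration R M r F"
    and zero: "\<And>i. i \<in> Field r \<Longrightarrow> underS r i = {} \<Longrightarrow> F i = {x \<in> carrier M. f x = \<zero>\<^bsub>N\<^esub>}"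
    and step: "\<And>i. i \<in> Field r \<Longrightarrow> AboveS r {i} \<noteq> {} \<Longrightarrow>
      \<exists>L\<in>C. module_isomorphic R (quot_module (restrict_module M (F (wo_rel.suc r {i}))) (F i)) L"
  shows "class_filtration R C N r (\<lambda>i. f ` F i)"
proof -
  have wo: "Well_order r" and sub: "\<And>i. i \<in> Field r \<Longrightarrow> submodule (F i) R M"
    and mono: "\<And>i j. (i, j) \<in> r \<Longrightarrow> F i \<subseteq> F j"
    and lim: "\<And>i. limit_elem r i \<Longrightarrow> F i = (\<Union>k\<in>underS r i. F k)"
    and un: "(\<Union>i\<in>Field r. F i) = carrier M"
    using fil unfolding filtration_def by auto
  interpret r: wo_rel r using wo by (simp add: wo_rel_def)
  have ker: "x \<in> F i" if i: "i \<in> Field r" and x: "x \<in> carrier M" "f x = \<zero>\<^bsub>N\<^esub>" for i x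
  proof -
    let ?z = "r.minim (Field r)"
    have ne: "Field r \<noteq> {}" using i by auto
    have z: "?z \<in> Field r" by (rule r.minim_in[OF order_refl ne])
    have "underS r ?z = {}"
    proof (rule ccontr)
      assume "underS r ?z \<noteq> {}"
      then obtain k where k: "k \<noteq> ?z" "(k, ?z) \<in> r" unfolding underS_def by auto
      then have "(?z, k) \<in> r" using r.minim_least[OF order_refl, of k] by (auto simp: Field_def)
      then show False using k r.ANTISYM by (auto simp: antisym_def)
    qed
    then have "x \<in> F ?z" using zero[OF z] x by auto
    then show ?thesis using mono[OF r.minim_least[OF order_refl i]] by auto
  qed
  show ?thesis
    unfolding class_filtration_def filtration_def
  proof (intro conjI ballI allI impI wo)
    fix i assume "i \<in> Field r" then show "submodule (f ` F i) R N" using submodule_image sub by auto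
  next
    fix i j assume "(i, j) \<in> r" then show "f ` F i \<subseteq> f ` F j" using mono by auto
  next
    fix i assume "limit_elem r i"
    then show "f ` F i = (\<Union>k\<in>underS r i. f ` F k)" using lim by auto
  next
    show "(\<Union>i\<in>Field r. f ` F i) = carrier N" unfolding surj[symmetric] un[symmetric] by auto
  next
    fix i assume i: "i \<in> Field r" "underS r i = {}"
    show "f ` F i = {\<zero>\<^bsub>N\<^esub>}" unfolding zero[OF i] using map_zero by force
  next
    fix i assume i: "i \<in> Field r" "AboveS r {i} \<noteq> {}"
    let ?j = "wo_rel.suc r {i}"
    have ij: "(i, ?j) \<in> r" "?j \<in> Field r" using r.suc_greater[of "{i}" i] r.suc_inField[of "{i}"] i by auto
    obtain L where L: "L \<in> C" "module_isomorphic R (quot_module (restrict_module M (F ?j)) (F i)) L"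
      using step[OF i] by auto
    have FF: "F i \<subseteq> F ?j" by (rule mono[OF ij(1)])
    have iso: "module_isomorphic R (quot_module (restrict_module M (F ?j)) (F i))
        (quot_module (restrict_module N (f ` F ?j)) (f ` F i))"
      by (rule quot_image_iso[OF sub[OF i(1)] sub[OF ij(2)] FF]) (use ker i(1) in auto)
    have "left_module R (quot_module (restrict_module M (F ?j)) (F i))"
      using left_module.quot_left_module[OF M.restrict_left_module[OF sub[OF ij(2)]]]
        M.submodule_restrict[OF sub[OF ij(2)] FF] sub[OF i(1)] by auto
    moreover have "left_module R (quot_module (restrict_module N (f ` F ?j)) (f ` F i))"
      using left_module.quot_left_module[OF N.restrict_left_module[OF submodule_image[OF sub[OF ij(2)]]]]
        N.submodule_restrict[OF submodule_image[OF sub[OF ij(2)]], of "f ` F i"] FF submodule_image[OF sub[OF i(1)]] by auto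
    ultimately show "\<exists>L\<in>C. module_isomorphic R (quot_module (restrict_module N (f ` F ?j)) (f ` F i)) L"
      using module_isomorphic_sym[OF _ _ iso] module_isomorphic_trans L by blast
  qed
qed

lemma module_isomorphic_map:
  assumes "left_module R M" "left_module R N" "module_isomorphic R M N"
  obtains f where "linear_map R M N f" "bij_betw f (carrier M) (carrier N)"
  using assms unfolding module_isomorphic_def ex_in_conv[symmetric] module_iso_iff
  by (metis linear_map.intro linear_map_axioms.intro)

text \<open>The transported filtration is still indexed by sets of elements of \<open>M\<close>;
  \<open>class_filtered_if_class_filtration\<close> moves it to the index type required for
  \<open>N\<close>.\<close>

lemma class_filtered_iso:
  fixes M :: "('r, 'm) module"
  assumes M: "left_module R M" and N: "left_module R N" and iso: "module_isomorphic R M N"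
    and cf: "class_filtered R C M"
  shows "class_filtered R C N"
proof -
  obtain f where f: "linear_map R M N f" "bij_betw f (carrier M) (carrier N)"
    by (rule module_isomorphic_map[OF M N iso])
  interpret f: linear_map R M N f by (rule f)
  obtain r :: "'m set rel" and F where F: "class_filtration R C M r F"
    using cf unfolding class_filtered_def by blast
  have inj: "inj_on f (carrier M)" using f(2) by (simp add: bij_betw_def)
  have ker: "{x \<in> carrier M. f x = \<zero>\<^bsub>N\<^esub>} = {\<zero>\<^bsub>M\<^esub>}"
    using inj_onD[OF inj _ _ f.M.M.zero_closed] f.map_zero f.M.M.zero_closed by fastforce
  have "class_filtration R C N r (\<lambda>i. f ` F i)"
  proof (rule f.class_filtration_image)
    show "f ` carrier M = carrier N" using f(2) by (simp add: bij_betw_def)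
  qed (use F ker in \<open>auto simp: class_filtration_def\<close>)
  then show ?thesis by (rule class_filtered_if_class_filtration)
qed

section \<open>Free modules and presentations\<close>

definition unit_vector :: "('r, 'x) ring_scheme \<Rightarrow> 'k \<Rightarrow> 'k \<Rightarrow> 'r" where
  "unit_vector R j = (\<lambda>i. if i = j then \<one>\<^bsub>R\<^esub> else \<zero>\<^bsub>R\<^esub>)"

context ring
begin

lemma free_module_simps:
  "f \<in> carrier (free_module R I) \<longleftrightarrow> (\<forall>i. f i \<in> carrier R) \<and> (\<forall>i. i \<notin> I \<longrightarrow> f i = \<zero>) \<and> finite {i. f i \<noteq> \<zero>}"
  "zero (free_module R I) = (\<lambda>_. \<zero>)"
  "add (free_module R I) = (\<lambda>f g i. f i \<oplus> g i)"
  "smult (free_module R I) = (\<lambda>a f i. a \<otimes> f i)"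
  by (auto simp: free_module_def)

lemma free_left_module: "left_module R (free_module R I)"
proof -
  have fa: "finite {i. f i \<oplus> g i \<noteq> \<zero>}" if "finite {i. f i \<noteq> \<zero>}" "finite {i. g i \<noteq> \<zero>}" for f g :: "'k \<Rightarrow> 'a"
    by (rule finite_subset[OF _ finite_UnI[OF that]]) auto
  have fm: "finite {i. a \<otimes> f i \<noteq> \<zero>}" if "finite {i. f i \<noteq> \<zero>}" "a \<in> carrier R" for f :: "'k \<Rightarrow> 'a" and a
    by (rule finite_subset[OF _ that(1)]) (use that(2) in auto)
  have "abelian_group (free_module R I)"
  proof (rule abelian_groupI)
    fix f assume f: "f \<in> carrier (free_module R I)"
    have "finite {i. \<ominus> f i \<noteq> \<zero>}"
      by (rule finite_subset[of _ "{i. f i \<noteq> \<zero>}"]) (use f in \<open>auto simp: free_module_simps\<close>)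
    then show "\<exists>g\<in>carrier (free_module R I). g \<oplus>\<^bsub>free_module R I\<^esub> f = \<zero>\<^bsub>free_module R I\<^esub>"
      using f by (intro bexI[of _ "\<lambda>i. \<ominus> f i"]) (auto simp: free_module_simps l_neg)
  qed (auto simp: free_module_simps fa a_ac)
  then show ?thesis
    by (intro left_module.intro left_module_axioms.intro ring_axioms)
       (auto simp: free_module_simps fm l_distr r_distr m_assoc)
qed

lemma unit_vector_closed: "j \<in> I \<Longrightarrow> unit_vector R j \<in> carrier (free_module R I)"
  by (auto simp: free_module_simps unit_vector_def)

lemma free_module_gen: "gen_submodule R (free_module R I) (unit_vector R ` I) = carrier (free_module R I)"
proof
  interpret F: left_module R "free_module R I" by (rule free_left_module)
  let ?E = "unit_vector R ` I"
  have E: "?E \<subseteq> carrier (free_module R I)" using unit_vector_closed by auto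
  show "gen_submodule R (free_module R I) ?E \<subseteq> carrier (free_module R I)" by (rule F.gen_subset[OF E])
  note S = F.submodule_gen[OF E]
  \<comment> \<open>Induction on the support: clearing one coordinate \<open>j\<close> splits off a
    multiple of the unit vector at \<open>j\<close>.\<close>
  have "f \<in> gen_submodule R (free_module R I) ?E"
    if "finite A" "f \<in> carrier (free_module R I)" "{i. f i \<noteq> \<zero>} = A" for A f
    using that
  proof (induction A arbitrary: f rule: finite_induct)
    case empty
    then have "f = \<zero>\<^bsub>free_module R I\<^esub>" by (auto simp: free_module_simps)
    then show ?case using F.submodule_zero_mem[OF S] by simp
  next
    case (insert j A)
    have fj: "\<And>i. f i \<in> carrier R" "j \<in> I" using insert.prems by (auto simp: free_module_simps)
    let ?g = "f(j := \<zero>)"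
    have A: "{i. ?g i \<noteq> \<zero>} = A" using insert.prems(2) insert.hyps(2) by auto
    have g: "?g \<in> carrier (free_module R I)"
      using insert.prems insert.hyps(1) A by (auto simp: free_module_simps)
    have "f = ?g \<oplus>\<^bsub>free_module R I\<^esub> (f j \<odot>\<^bsub>free_module R I\<^esub> unit_vector R j)"
      using fj by (auto simp: free_module_simps unit_vector_def)
    moreover have "unit_vector R j \<in> gen_submodule R (free_module R I) ?E" using F.gen_incl[of ?E] fj(2) by auto
    ultimately show ?case
      using insert.IH[OF g A] F.submodule_add[OF S] F.submodule_smult[OF S fj(1)] by metis
  qed
  then show "carrier (free_module R I) \<subseteq> gen_submodule R (free_module R I) ?E"
    by (auto simp: free_module_simps)
qed

end

text \<open>The elements on which two linear maps agree form a submodule.\<close>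

lemma linear_map_eq_on_gen:
  assumes f: "linear_map R M N f" and g: "linear_map R M N g" and X: "X \<subseteq> carrier M"
    and eq: "\<And>x. x \<in> X \<Longrightarrow> f x = g x" and x: "x \<in> gen_submodule R M X"
  shows "f x = g x"
proof -
  interpret f: linear_map R M N f by (rule f)
  interpret g: linear_map R M N g by (rule g)
  have s: "submodule {x \<in> carrier M. f x = g x} R M"
    unfolding f.M.submodule_iff
    by (auto simp: f.map_add g.map_add f.map_smult g.map_smult f.map_zero g.map_zero f.M.lsmult_closed)
  have "gen_submodule R M X \<subseteq> {x \<in> carrier M. f x = g x}"
    by (rule f.M.gen_minimal[OF _ s]) (use X eq in auto)
  then show ?thesis using x by auto
qed

lemma (in left_module) free_module_extension:
  assumes a: "\<And>j. j \<in> I \<Longrightarrow> a j \<in> carrier M"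
  obtains \<phi> where "linear_map R (free_module R I) M \<phi>" "\<And>j. j \<in> I \<Longrightarrow> \<phi> (unit_vector R j) = a j"
proof
  define \<phi> where "\<phi> f = finsum M (\<lambda>j. f j \<odot>\<^bsub>M\<^esub> a j) {j. f j \<noteq> \<zero>\<^bsub>R\<^esub>}" for f
  interpret F: left_module R "free_module R I" by (rule R.free_left_module)
  have t: "f j \<odot>\<^bsub>M\<^esub> a j \<in> carrier M" if "f \<in> carrier (free_module R I)" "j \<in> I" for f j
    using that a lsmult_closed by (auto simp: R.free_module_simps)
  \<comment> \<open>The supports of \<open>f\<close>, \<open>g\<close> and their sum differ. Letting
    the sum range over any finite \<open>A\<close> between the support and \<open>I\<close> gives
    them a common range.\<close>
  have \<phi>: "\<phi> f = finsum M (\<lambda>j. f j \<odot>\<^bsub>M\<^esub> a j) A"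
    if f: "f \<in> carrier (free_module R I)" and A: "finite A" "A \<subseteq> I" "{j. f j \<noteq> \<zero>\<^bsub>R\<^esub>} \<subseteq> A" for f A
    unfolding \<phi>_def
    by (rule M.add.finprod_mono_neutral_cong_left[OF A(1,3)])
       (use A t[OF f] smult_zero_left a in auto)
  have supp: "finite {j. f j \<noteq> \<zero>\<^bsub>R\<^esub>}" "{j. f j \<noteq> \<zero>\<^bsub>R\<^esub>} \<subseteq> I" if "f \<in> carrier (free_module R I)" for f
    using that by (auto simp: R.free_module_simps)
  have "\<phi> \<in> module_hom R (free_module R I) M"
    unfolding module_hom_def
  proof (intro CollectI conjI ballI Pi_I)
    fix f assume f: "f \<in> carrier (free_module R I)"
    show "\<phi> f \<in> carrier M" unfolding \<phi>_def by (rule M.finsum_closed) (use t[OF f] supp[OF f] in auto)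
    fix g assume g: "g \<in> carrier (free_module R I)"
    let ?A = "{j. f j \<noteq> \<zero>\<^bsub>R\<^esub>} \<union> {j. g j \<noteq> \<zero>\<^bsub>R\<^esub>}"
    have A: "finite ?A" "?A \<subseteq> I" using supp[OF f] supp[OF g] by auto
    have fg: "f \<oplus>\<^bsub>free_module R I\<^esub> g \<in> carrier (free_module R I)" using f g by simp
    have sA: "{j. (f \<oplus>\<^bsub>free_module R I\<^esub> g) j \<noteq> \<zero>\<^bsub>R\<^esub>} \<subseteq> ?A" by (auto simp: R.free_module_simps)
    have "finsum M (\<lambda>j. (f \<oplus>\<^bsub>free_module R I\<^esub> g) j \<odot>\<^bsub>M\<^esub> a j) ?A
        = finsum M (\<lambda>j. f j \<odot>\<^bsub>M\<^esub> a j \<oplus>\<^bsub>M\<^esub> g j \<odot>\<^bsub>M\<^esub> a j) ?A"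
    proof (rule M.finsum_cong'[OF refl])
      fix j assume "j \<in> ?A"
      then have j: "j \<in> I" using A(2) by blast
      show "(f \<oplus>\<^bsub>free_module R I\<^esub> g) j \<odot>\<^bsub>M\<^esub> a j = f j \<odot>\<^bsub>M\<^esub> a j \<oplus>\<^bsub>M\<^esub> g j \<odot>\<^bsub>M\<^esub> a j"
        using f g a[OF j] lsmult_l_distr by (simp add: R.free_module_simps)
    qed (use t[OF f] t[OF g] A in auto)
    also have "\<dots> = finsum M (\<lambda>j. f j \<odot>\<^bsub>M\<^esub> a j) ?A \<oplus>\<^bsub>M\<^esub> finsum M (\<lambda>j. g j \<odot>\<^bsub>M\<^esub> a j) ?A"
      by (rule M.finsum_addf) (use t[OF f] t[OF g] A in auto)
    finally show "\<phi> (f \<oplus>\<^bsub>free_module R I\<^esub> g) = \<phi> f \<oplus>\<^bsub>M\<^esub> \<phi> g"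
      using \<phi>[OF fg A sA] \<phi>[OF f A] \<phi>[OF g A] by simp
  next
    fix c f assume c: "c \<in> carrier R" and f: "f \<in> carrier (free_module R I)"
    have cf: "c \<odot>\<^bsub>free_module R I\<^esub> f \<in> carrier (free_module R I)" using F.lsmult_closed c f by simp
    let ?A = "{j. f j \<noteq> \<zero>\<^bsub>R\<^esub>}"
    have sA: "{j. (c \<odot>\<^bsub>free_module R I\<^esub> f) j \<noteq> \<zero>\<^bsub>R\<^esub>} \<subseteq> ?A" using c by (auto simp: R.free_module_simps)
    have "c \<odot>\<^bsub>M\<^esub> finsum M (\<lambda>j. f j \<odot>\<^bsub>M\<^esub> a j) B = finsum M (\<lambda>j. c \<odot>\<^bsub>M\<^esub> (f j \<odot>\<^bsub>M\<^esub> a j)) B"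
      if "finite B" "B \<subseteq> I" for B
      using that
    proof (induction B rule: finite_induct)
      case empty then show ?case using smult_zero_right c by simp
    next
      case (insert j B)
      have m: "\<And>j. j \<in> I \<Longrightarrow> c \<odot>\<^bsub>M\<^esub> (f j \<odot>\<^bsub>M\<^esub> a j) \<in> carrier M" using t[OF f] lsmult_closed c by auto
      have s: "finsum M (\<lambda>j. f j \<odot>\<^bsub>M\<^esub> a j) B \<in> carrier M"
        by (rule M.finsum_closed) (use t[OF f] insert.prems in auto)
      have "c \<odot>\<^bsub>M\<^esub> finsum M (\<lambda>j. f j \<odot>\<^bsub>M\<^esub> a j) (insert j B)
          = c \<odot>\<^bsub>M\<^esub> (f j \<odot>\<^bsub>M\<^esub> a j) \<oplus>\<^bsub>M\<^esub> c \<odot>\<^bsub>M\<^esub> finsum M (\<lambda>j. f j \<odot>\<^bsub>M\<^esub> a j) B"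
        using insert t[OF f] s lsmult_r_distr c by (subst M.finsum_insert) (auto simp: Pi_iff subset_iff)
      also have "\<dots> = finsum M (\<lambda>j. c \<odot>\<^bsub>M\<^esub> (f j \<odot>\<^bsub>M\<^esub> a j)) (insert j B)"
        using insert m by (subst M.finsum_insert) (auto simp: Pi_iff subset_iff)
      finally show ?case .
    qed
    from this[OF supp[OF f]] have "c \<odot>\<^bsub>M\<^esub> \<phi> f = finsum M (\<lambda>j. c \<odot>\<^bsub>M\<^esub> (f j \<odot>\<^bsub>M\<^esub> a j)) ?A"
      by (simp add: \<phi>_def)
    also have "\<dots> = finsum M (\<lambda>j. (c \<odot>\<^bsub>free_module R I\<^esub> f) j \<odot>\<^bsub>M\<^esub> a j) ?A"
    proof (rule M.finsum_cong'[OF refl])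
      fix j assume "j \<in> ?A"
      then have "j \<in> I" using supp(2)[OF f] by auto
      then show "c \<odot>\<^bsub>M\<^esub> (f j \<odot>\<^bsub>M\<^esub> a j) = (c \<odot>\<^bsub>free_module R I\<^esub> f) j \<odot>\<^bsub>M\<^esub> a j"
        using c f a lsmult_assoc by (simp add: R.free_module_simps)
    qed (use t[OF cf] supp(2)[OF f] in auto)
    finally show "\<phi> (c \<odot>\<^bsub>free_module R I\<^esub> f) = c \<odot>\<^bsub>M\<^esub> \<phi> f" using \<phi>[OF cf supp[OF f] sA] by simp
  qed
  then show "linear_map R (free_module R I) M \<phi>"
    by (intro linear_map.intro linear_map_axioms.intro F.left_module_axioms left_module_axioms)
  fix j assume j: "j \<in> I"
  have "\<phi> (unit_vector R j) = finsum M (\<lambda>i. unit_vector R j i \<odot>\<^bsub>M\<^esub> a i) {j}"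
    by (rule \<phi>[OF R.unit_vector_closed[OF j]]) (use j in \<open>auto simp: unit_vector_def\<close>)
  also have "\<dots> = finsum M a {j}"
    using a[OF j] by (intro M.finsum_cong') (auto simp: unit_vector_def lsmult_one)
  also have "\<dots> = a j" using a[OF j] by (simp add: M.finsum_insert[of "{}" j])
  finally show "\<phi> (unit_vector R j) = a j" .
qed

text \<open>Freeness lifts the presentation of \<open>M/U\<close> to a map \<open>\<phi>\<close>
  into \<open>M\<close>. The set \<open>B\<close> consists of the images of the basis,
  \<open>T\<close> of the images of the relations. An element of \<open>U\<close> in the span of
  \<open>B\<close> is some \<open>\<phi> f\<close> where \<open>f\<close> is killed by the
  presentation; then \<open>f\<close> is generated by the relations and \<open>\<phi> f\<close> by
  \<open>T\<close>.\<close>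

lemma (in left_module) less_presented_quot_generators:
  fixes \<mu> :: "'k rel"
  assumes U: "submodule U R M" and N: "left_module R N" and pres: "less_presented R \<mu> N"
    and iso: "module_isomorphic R (quot_module M U) N"
  obtains B T where "B \<subseteq> carrier M" "|B| <o \<mu>" "T \<subseteq> U" "|T| <o \<mu>"
    "carrier M = gen_submodule R M (U \<union> B)" "gen_submodule R M B \<inter> U \<subseteq> gen_submodule R M T"
proof -
  obtain I :: "'k set" and K where I: "|I| <o \<mu>" and K: "K \<subseteq> carrier (free_module R I)" "|K| <o \<mu>"
    and iso2: "module_isomorphic R (quot_module (free_module R I) (gen_submodule R (free_module R I) K)) N"
    using pres unfolding less_presented_def by blast
  let ?F = "free_module R I" and ?Q = "quot_module M U"
  interpret F: left_module R ?F by (rule R.free_left_module)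
  note GK = F.submodule_gen[OF K(1)]
  have Q: "left_module R ?Q" by (rule quot_left_module[OF U])
  have FQ: "left_module R (quot_module ?F (gen_submodule R ?F K))" by (rule F.quot_left_module[OF GK])
  obtain g where g: "linear_map R (quot_module ?F (gen_submodule R ?F K)) ?Q g"
      "bij_betw g (carrier (quot_module ?F (gen_submodule R ?F K))) (carrier ?Q)"
    by (rule module_isomorphic_map[OF FQ Q module_isomorphic_trans[OF iso2 module_isomorphic_sym[OF Q N iso]]])
  interpret g: linear_map R "quot_module ?F (gen_submodule R ?F K)" ?Q g by (rule g)
  \<comment> \<open>\<open>\<theta>\<close> presents \<open>M/U\<close> itself: projection modulo
    the relations, followed by the isomorphism obtained through \<open>N\<close>.\<close>
  define \<theta> where "\<theta> = g \<circ> (\<lambda>x. gen_submodule R ?F K +>\<^bsub>?F\<^esub> x)"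
  interpret \<theta>: linear_map R ?F ?Q \<theta>
    unfolding \<theta>_def by (rule linear_map_comp[OF F.quot_map[OF GK] g(1)])
  have \<theta>_surj: "\<theta> ` carrier ?F = carrier ?Q"
    using g(2) unfolding \<theta>_def F.carrier_quot[OF GK] bij_betw_def by (simp add: image_comp)
  have \<theta>_ker: "f \<in> gen_submodule R ?F K \<longleftrightarrow> \<theta> f = \<zero>\<^bsub>?Q\<^esub>" if f: "f \<in> carrier ?F" for f
  proof -
    have "\<theta> f = \<zero>\<^bsub>?Q\<^esub> \<longleftrightarrow> gen_submodule R ?F K +>\<^bsub>?F\<^esub> f = \<zero>\<^bsub>quot_module ?F (gen_submodule R ?F K)\<^esub>"
      using g(2) F.coset_in_quot[OF GK f] g.map_zero g.M.M.zero_closed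
      unfolding \<theta>_def bij_betw_def inj_on_def by (metis comp_apply)
    then show ?thesis using F.quot_map_eq_zero[OF GK f] by simp
  qed
  let ?\<pi> = "\<lambda>x. U +>\<^bsub>M\<^esub> x"
  interpret \<pi>: linear_map R M ?Q ?\<pi> by (rule quot_map[OF U])
  \<comment> \<open>Representatives are chosen only for the images of the basis; by freeness this
    suffices to lift all of \<open>\<theta>\<close>.\<close>
  have "\<exists>x. x \<in> carrier M \<and> ?\<pi> x = \<theta> (unit_vector R j)" if "j \<in> I" for j
    using \<theta>.map_closed[OF R.unit_vector_closed[OF that]] unfolding carrier_quot[OF U] by auto
  then obtain a where a: "\<And>j. j \<in> I \<Longrightarrow> a j \<in> carrier M" "\<And>j. j \<in> I \<Longrightarrow> ?\<pi> (a j) = \<theta> (unit_vector R j)"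
    by metis
  obtain \<phi> where \<phi>: "linear_map R ?F M \<phi>" "\<And>j. j \<in> I \<Longrightarrow> \<phi> (unit_vector R j) = a j"
    using free_module_extension[of I a, OF a(1)] by blast
  interpret \<phi>: linear_map R ?F M \<phi> by (rule \<phi>)
  have E: "unit_vector R ` I \<subseteq> carrier ?F" using R.unit_vector_closed by auto
  have lift: "?\<pi> (\<phi> f) = \<theta> f" if f: "f \<in> carrier ?F" for f
  proof -
    have "(?\<pi> \<circ> \<phi>) f = \<theta> f"
      by (rule linear_map_eq_on_gen[OF linear_map_comp[OF \<phi>(1) \<pi>.linear_map_axioms] \<theta>.linear_map_axioms E])
         (use a \<phi>(2) f in \<open>auto simp: R.free_module_gen\<close>)
    then show ?thesis by simp
  qed
  have range: "\<phi> ` carrier ?F = gen_submodule R M (a ` I)"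
  proof -
    have "\<phi> ` unit_vector R ` I = a ` I" using \<phi>(2) by (auto simp: image_image)
    then show ?thesis using \<phi>.image_gen[OF E] by (simp add: R.free_module_gen)
  qed
  have aI: "a ` I \<subseteq> carrier M" using a(1) by auto
  have UaI: "U \<union> a ` I \<subseteq> carrier M" using aI submodule_subset[OF U] by auto
  show ?thesis
  proof (rule that)
    show "a ` I \<subseteq> carrier M" by (rule aI)
    show "|a ` I| <o \<mu>" by (rule ordLeq_ordLess_trans[OF card_of_image I])
    show "|\<phi> ` K| <o \<mu>" by (rule ordLeq_ordLess_trans[OF card_of_image K(2)])
    show "\<phi> ` K \<subseteq> U"
    proof
      fix x assume "x \<in> \<phi> ` K"
      then obtain k where k: "k \<in> K" "x = \<phi> k" by auto
      have kc: "k \<in> carrier ?F" using k K(1) by auto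
      have "?\<pi> x = \<zero>\<^bsub>?Q\<^esub>" using lift[OF kc] \<theta>_ker[OF kc] F.gen_incl[of K] k by auto
      then show "x \<in> U" using quot_map_eq_zero[OF U] \<phi>.map_closed[OF kc] k(2) by simp
    qed
    show "carrier M = gen_submodule R M (U \<union> a ` I)"
    proof
      show "gen_submodule R M (U \<union> a ` I) \<subseteq> carrier M" by (rule gen_subset[OF UaI])
      show "carrier M \<subseteq> gen_submodule R M (U \<union> a ` I)"
      proof
        fix x assume x: "x \<in> carrier M"
        then have "?\<pi> x \<in> \<theta> ` carrier ?F" unfolding \<theta>_surj carrier_quot[OF U] by auto
        then obtain f where f: "f \<in> carrier ?F" "?\<pi> x = ?\<pi> (\<phi> f)" using lift by auto
        have fM: "\<phi> f \<in> carrier M" by (rule \<phi>.map_closed[OF f(1)])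
        have "x \<ominus>\<^bsub>M\<^esub> \<phi> f \<in> U" using f(2) coset_eq_iff[OF U x fM] by simp
        then have 1: "x \<ominus>\<^bsub>M\<^esub> \<phi> f \<in> gen_submodule R M (U \<union> a ` I)" using gen_incl[of "U \<union> a ` I"] by auto
        have "\<phi> f \<in> gen_submodule R M (a ` I)" using range f(1) by auto
        then have 2: "\<phi> f \<in> gen_submodule R M (U \<union> a ` I)" using gen_mono[of "a ` I" "U \<union> a ` I"] by auto
        have "(x \<ominus>\<^bsub>M\<^esub> \<phi> f) \<oplus>\<^bsub>M\<^esub> \<phi> f = x" using x fM by (simp add: a_minus_def M.a_assoc M.l_neg)
        then show "x \<in> gen_submodule R M (U \<union> a ` I)" using submodule_add[OF submodule_gen[OF UaI] 1 2] by simp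
      qed
    qed
    show "gen_submodule R M (a ` I) \<inter> U \<subseteq> gen_submodule R M (\<phi> ` K)"
    proof
      fix x assume "x \<in> gen_submodule R M (a ` I) \<inter> U"
      then have "x \<in> \<phi> ` carrier ?F" and xU: "x \<in> U" unfolding range by auto
      then obtain f where f: "f \<in> carrier ?F" "x = \<phi> f" by blast
      have "\<theta> f = \<zero>\<^bsub>?Q\<^esub>"
        using lift[OF f(1)] quot_map_eq_zero[OF U \<phi>.map_closed[OF f(1)]] xU f(2) by simp
      then have "f \<in> gen_submodule R ?F K" using \<theta>_ker[OF f(1)] by simp
      then show "x \<in> gen_submodule R M (\<phi> ` K)" using \<phi>.image_gen[OF K(1)] f(2) by auto
    qed
  qed
qed

section \<open>Closed index sets in a filtration\<close>

lemma (in wo_rel) under_eq_insert: "i \<in> Field r \<Longrightarrow> under i = insert i (underS i)"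
  using REFL by (auto simp: under_def underS_def refl_on_def)

lemma (in wo_rel) underS_suc:
  assumes i: "i \<in> Field r" and a: "AboveS {i} \<noteq> {}"
  shows "underS (suc {i}) = under i"
proof -
  have s: "suc {i} \<noteq> i" "(i, suc {i}) \<in> r" using suc_greater[of "{i}" i] i a by auto
  have "(x, i) \<in> r" if x: "(x, suc {i}) \<in> r" "x \<noteq> suc {i}" for x
  proof (rule ccontr)
    assume n: "(x, i) \<notin> r"
    have xF: "x \<in> Field r" using x(1) by (auto simp: Field_def)
    then have ix: "(i, x) \<in> r" "i \<noteq> x" using n TOTALS i REFL by (auto simp: refl_on_def)
    then have "x \<in> AboveS {i}" using xF by (auto simp: AboveS_def)
    then have "(suc {i}, x) \<in> r" by (rule suc_least_AboveS)
    then show False using x ANTISYM by (auto simp: antisym_def)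
  qed
  moreover have "(x, suc {i}) \<in> r \<and> x \<noteq> suc {i}" if "(x, i) \<in> r" for x
    using that s TRANS ANTISYM by (auto simp: trans_def antisym_def)
  ultimately show ?thesis by (auto simp: under_def underS_def)
qed

lemma (in wo_rel) zero_limit_succ:
  assumes i: "i \<in> Field r"
  obtains "underS i = {}" | "limit_elem r i" | k where "k \<in> Field r" "AboveS {k} \<noteq> {}" "suc {k} = i"
proof (cases "underS i = {} \<or> limit_elem r i")
  case False
  \<comment> \<open>A nonzero index that is not a limit has some \<open>k\<close> below it with
    nothing strictly between; this \<open>k\<close> is its predecessor.\<close>
  then obtain k where k: "k \<in> underS i" "\<forall>l\<in>underS i. k \<notin> underS l"
    unfolding limit_elem_def using i by auto
  have kF: "k \<in> Field r" using k(1) by (auto simp: underS_def Field_def)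
  have a: "i \<in> AboveS {k}" using k(1) i by (auto simp: underS_def AboveS_def)
  have ne: "AboveS {k} \<noteq> {}" using a by blast
  have eq: "suc {k} = i"
  proof (rule ccontr)
    assume n: "suc {k} \<noteq> i"
    then have "suc {k} \<in> underS i" using suc_least_AboveS[OF a] by (auto simp: underS_def)
    moreover have "k \<in> underS (suc {k})" using suc_greater[OF _ ne, of k] kF by (auto simp: underS_def)
    ultimately show False using k(2) by blast
  qed
  show ?thesis by (rule that(3)[OF kF ne eq])
next
  case True then show ?thesis using that(1,2) by blast
qed

context left_module
begin

lemma gen_idem_Un:
  assumes "X \<subseteq> carrier M" "Y \<subseteq> carrier M"
  shows "gen_submodule R M (gen_submodule R M X \<union> gen_submodule R M Y) = gen_submodule R M (X \<union> Y)"
  unfolding gen_submodule_def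
  using hull_Un_left[of "\<lambda>H. submodule H R M" X Y] hull_Un_right[of "\<lambda>H. submodule H R M" _ Y] by simp

text \<open>A finite support inside the union of a nonempty chain lies in one member of the chain.
  This supplies continuity at limits.\<close>

lemma gen_UN_chain:
  assumes I: "I \<noteq> {}" and X: "\<And>i. i \<in> I \<Longrightarrow> X i \<subseteq> carrier M"
    and chain: "\<And>i j. i \<in> I \<Longrightarrow> j \<in> I \<Longrightarrow> X i \<subseteq> X j \<or> X j \<subseteq> X i"
  shows "gen_submodule R M (\<Union>i\<in>I. X i) = (\<Union>i\<in>I. gen_submodule R M (X i))"
proof
  show "gen_submodule R M (\<Union>i\<in>I. X i) \<subseteq> (\<Union>i\<in>I. gen_submodule R M (X i))"
  proof
    fix x assume x: "x \<in> gen_submodule R M (\<Union>i\<in>I. X i)"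
    have UX: "(\<Union>i\<in>I. X i) \<subseteq> carrier M" using X by (rule UN_least)
    obtain E where E: "finite E" "E \<subseteq> (\<Union>i\<in>I. X i)" "x \<in> gen_submodule R M E"
      using gen_finite_support[OF UX x] by blast
    have ch: "subset.chain UNIV (X ` I)" unfolding subset_chain_def using chain by auto
    obtain i where i: "i \<in> I" "E \<subseteq> X i"
      using finite_subset_Union_chain[OF E(1,2) _ ch] I by auto
    then show "x \<in> (\<Union>i\<in>I. gen_submodule R M (X i))" using E(3) gen_mono[OF i(2)] by auto
  qed
  show "(\<Union>i\<in>I. gen_submodule R M (X i)) \<subseteq> gen_submodule R M (\<Union>i\<in>I. X i)"
    by (intro UN_least gen_mono) auto
qed

lemma gen_UN_finite_support:
  assumes B: "\<And>i. B i \<subseteq> carrier M" and x: "x \<in> gen_submodule R M (\<Union>(B ` S))"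
  shows "\<exists>E. finite E \<and> E \<subseteq> S \<and> x \<in> gen_submodule R M (\<Union>(B ` E))"
proof -
  have "\<Union>(B ` S) \<subseteq> carrier M" using B by (rule UN_least)
  then obtain X where X: "finite X" "X \<subseteq> \<Union>(B ` S)" "x \<in> gen_submodule R M X"
    using gen_finite_support[OF _ x] by blast
  then obtain \<F> where "finite \<F>" "\<F> \<subseteq> B ` S" "X \<subseteq> \<Union>\<F>"
    using finite_subset_Union[OF X(1), of "B ` S"] by blast
  then obtain E where E: "finite E" "E \<subseteq> S" "X \<subseteq> \<Union>(B ` E)"
    using finite_subset_image[of \<F> B S] by auto
  then show ?thesis using X(3) gen_mono[OF E(3)] by auto
qed

text \<open>The inclusion of \<open>G\<close> followed by the projection modulo \<open>L\<close> has
  kernel \<open>G \<inter> L\<close>. It is onto because every element of \<open>L + G\<close> is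
  congruent modulo \<open>L\<close> to an element of \<open>G\<close>.\<close>

lemma second_isomorphism:
  assumes G: "submodule G R M" and L: "submodule L R M"
  shows "module_isomorphic R (quot_module (restrict_module M G) (G \<inter> L))
           (quot_module (restrict_module M (gen_submodule R M (L \<union> G))) L)"
proof -
  let ?H = "gen_submodule R M (L \<union> G)"
  have LG: "L \<union> G \<subseteq> carrier M" using submodule_subset G L by auto
  have H: "submodule ?H R M" by (rule submodule_gen[OF LG])
  have LH: "L \<subseteq> ?H" "G \<subseteq> ?H" using gen_incl[of "L \<union> G"] by auto
  interpret H: left_module R "restrict_module M ?H" by (rule restrict_left_module[OF H])
  have L': "submodule L R (restrict_module M ?H)" using submodule_restrict[OF H LH(1)] L by simp
  have incl: "linear_map R (restrict_module M G) (restrict_module M ?H) (\<lambda>x. x)"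
    by (intro linear_map.intro linear_map_axioms.intro restrict_left_module G H)
       (use LH(2) in \<open>auto simp: module_hom_def\<close>)
  interpret g: linear_map R "restrict_module M G" "quot_module (restrict_module M ?H) L"
    "(\<lambda>x. L +>\<^bsub>restrict_module M ?H\<^esub> x) \<circ> (\<lambda>x. x)"
    by (rule linear_map_comp[OF incl H.quot_map[OF L']])
  show ?thesis
  proof (rule g.first_isomorphism)
    show "((\<lambda>x. L +>\<^bsub>restrict_module M ?H\<^esub> x) \<circ> (\<lambda>x. x)) ` carrier (restrict_module M G) =
        carrier (quot_module (restrict_module M ?H) L)"
      unfolding H.carrier_quot[OF L']
    proof (intro equalityI subsetI)
      fix X assume "X \<in> (\<lambda>x. L +>\<^bsub>restrict_module M ?H\<^esub> x) ` carrier (restrict_module M ?H)"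
      then obtain h where h: "h \<in> ?H" "X = L +>\<^bsub>restrict_module M ?H\<^esub> h" by auto
      then obtain l g where lg: "l \<in> L" "g \<in> G" "h = l \<oplus>\<^bsub>M\<^esub> g"
        unfolding gen_Un_submodule[OF L G] by auto
      have "h \<ominus>\<^bsub>restrict_module M ?H\<^esub> g = l"
      proof -
        have "g \<in> carrier (restrict_module M ?H)" "l \<in> carrier (restrict_module M ?H)" using lg LH by auto
        moreover have "h = l \<oplus>\<^bsub>restrict_module M ?H\<^esub> g" using lg by simp
        ultimately show ?thesis by (simp only: a_minus_def H.M.a_assoc H.M.r_neg H.M.a_inv_closed H.M.r_zero)
      qed
      then have "L +>\<^bsub>restrict_module M ?H\<^esub> h = L +>\<^bsub>restrict_module M ?H\<^esub> g"
        using H.coset_eq_iff[OF L', of h g] h(1) lg LH by auto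
      then show "X \<in> ((\<lambda>x. L +>\<^bsub>restrict_module M ?H\<^esub> x) \<circ> (\<lambda>x. x)) ` carrier (restrict_module M G)"
        using h(2) lg(2) by auto
    qed (use LH in auto)
    show "G \<inter> L = {x \<in> carrier (restrict_module M G).
        ((\<lambda>x. L +>\<^bsub>restrict_module M ?H\<^esub> x) \<circ> (\<lambda>x. x)) x = \<zero>\<^bsub>quot_module (restrict_module M ?H) L\<^esub>}"
      using H.quot_map_eq_zero[OF L'] LH by auto
  qed
qed

text \<open>Since the members of \<open>Field r\<close> index only the successor steps, a top index \<open>None\<close> is needed for
  the last submodule.\<close>

lemma class_filtered_quot_if_steps:
  fixes r :: "'i rel"
  assumes wo: "Well_order r" and A: "A \<subseteq> carrier M" and B: "\<And>i. B i \<subseteq> carrier M"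
    and step: "\<And>i. i \<in> Field r \<Longrightarrow> \<exists>L\<in>C. module_isomorphic R
       (quot_module (restrict_module M (gen_submodule R M (A \<union> (\<Union>k\<in>under r i. B k))))
         (gen_submodule R M (A \<union> (\<Union>k\<in>underS r i. B k)))) L"
  shows "class_filtered R C (quot_module (restrict_module M (gen_submodule R M (A \<union> (\<Union>k\<in>Field r. B k))))
         (gen_submodule R M A))"
proof -
  interpret r: wo_rel r using wo by (simp add: wo_rel_def)
  define N where "N D = gen_submodule R M (A \<union> (\<Union>k\<in>D. B k))" for D
  define s where "s = {(Some a, Some b) | a b. (a, b) \<in> r} \<union> {(x, None) | x. x \<in> Some ` Field r \<union> {None}}"
  have s_iff: "(Some a, Some b) \<in> s \<longleftrightarrow> (a, b) \<in> r" "(Some a, None) \<in> s \<longleftrightarrow> a \<in> Field r"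
     "(None, Some b) \<notin> s" "(None, None) \<in> s" for a b
    unfolding s_def by auto
  have Fs: "Field s = insert None (Some ` Field r)"
  proof (intro equalityI subsetI)
    fix x assume "x \<in> Field s"
    then show "x \<in> insert None (Some ` Field r)" unfolding s_def by (auto simp: Field_def)
  next
    fix x assume "x \<in> insert None (Some ` Field r)"
    then have "(x, None) \<in> s" unfolding s_def by auto
    then show "x \<in> Field s" by (rule FieldI1)
  qed
  have "refl_on (Field s) s" using r.REFL unfolding Fs by (auto simp: refl_on_def s_iff)
  moreover have "trans s"
  proof (rule transI)
    fix x y z assume xy: "(x, y) \<in> s" and yz: "(y, z) \<in> s"
    show "(x, z) \<in> s"
    proof (cases z)
      case None
      then show ?thesis using FieldI1[OF xy] Fs s_iff by auto
    next
      case (Some c)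
      then obtain b where b: "y = Some b" "(b, c) \<in> r" using yz s_iff by (cases y) auto
      then obtain a where "x = Some a" "(a, b) \<in> r" using xy s_iff by (cases x) auto
      then show ?thesis using b(2) Some r.TRANS s_iff unfolding trans_def by blast
    qed
  qed
  moreover have "antisym s"
  proof (rule antisymI)
    fix x y assume "(x, y) \<in> s" "(y, x) \<in> s"
    then show "x = y" using r.ANTISYM by (cases x; cases y) (auto simp: s_iff antisym_def)
  qed
  moreover have "total_on (Field s) s"
    using r.TOTALS unfolding Fs total_on_def by (auto simp: s_iff)
  moreover have "s \<subseteq> Field s \<times> Field s" by (auto simp: Field_def)
  moreover have "wf (s - Id)"
  proof (rule wfI_min)
    fix x and Q :: "'i option set" assume xQ: "x \<in> Q"
    show "\<exists>z\<in>Q. \<forall>y. (y, z) \<in> s - Id \<longrightarrow> y \<notin> Q"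
    proof (cases "\<exists>a. Some a \<in> Q")
      case True
      then obtain a where a: "Some a \<in> Q" "\<And>b. (b, a) \<in> r - Id \<Longrightarrow> Some b \<notin> Q"
        using wfE_min[OF r.WF, of _ "{a. Some a \<in> Q}"] by auto
      have "y \<notin> Q" if y: "(y, Some a) \<in> s - Id" for y
        using y a(2) s_iff by (cases y) auto
      then show ?thesis using a(1) by blast
    next
      case False
      then have "Q \<subseteq> {None}" by (metis insertI1 option.exhaust subsetI)
      then show ?thesis using xQ by blast
    qed
  qed
  ultimately have woS: "Well_order s"
    unfolding well_order_on_def linear_order_on_def partial_order_on_def preorder_on_def by blast
  interpret s: wo_rel s using woS by (simp add: wo_rel_def)
  \<comment> \<open>\<open>P a\<close> lists the steps strictly before \<open>a\<close>. Thus
    \<open>N (P a)\<close> is the submodule in front of step \<open>a\<close>, passing to the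
    successor adds exactly one block, and the top index receives all blocks.\<close>
  define P where "P a = {k. Some k \<in> underS s a}" for a
  have P_Some: "P (Some i) = underS r i" for i unfolding P_def underS_def by (auto simp: s_iff)
  have P_None: "P None = Field r" unfolding P_def underS_def by (auto simp: s_iff)
  have P_F: "P a \<subseteq> Field r" for a
    unfolding P_def underS_def by (cases a) (auto simp: s_iff Field_def)
  have P_mono: "P a \<subseteq> P b" if "(a, b) \<in> s" for a b
    using that s.TRANS s.ANTISYM unfolding P_def underS_def trans_def antisym_def by blast
  have P_lim: "P a = (\<Union>k\<in>underS s a. P k)" if "limit_elem s a" for a
  proof
    show "P a \<subseteq> (\<Union>k\<in>underS s a. P k)" using that unfolding limit_elem_def P_def by blast
    show "(\<Union>k\<in>underS s a. P k) \<subseteq> P a" using P_mono by (auto simp: underS_def)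
  qed
  have AB: "A \<union> (\<Union>k\<in>D. B k) \<subseteq> carrier M" for D using A B by auto
  have N_sub: "submodule (N D) R M" for D unfolding N_def by (rule submodule_gen[OF AB])
  have N_mono: "N D \<subseteq> N D'" if "D \<subseteq> D'" for D D' unfolding N_def using that by (intro gen_mono) auto
  let ?W = "restrict_module M (N (Field r))"
  interpret W: left_module R ?W by (rule restrict_left_module[OF N_sub])
  have N_W: "submodule (N D) R ?W" if "D \<subseteq> Field r" for D
    using submodule_restrict[OF N_sub N_mono[OF that]] N_sub by simp
  have N0: "submodule (N {}) R ?W" by (rule N_W) simp
  interpret q: linear_map R ?W "quot_module ?W (N {})" "\<lambda>x. N {} +>\<^bsub>?W\<^esub> x"
    by (rule W.quot_map[OF N0])
  \<comment> \<open>The chain begins at \<open>N {}\<close>, the kernel of the projection, rather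
    than at zero; this is the situation of \<open>class_filtration_image\<close>.\<close>
  have "class_filtration R C (quot_module ?W (N {})) s (\<lambda>a. (\<lambda>x. N {} +>\<^bsub>?W\<^esub> x) ` N (P a))"
  proof (rule q.class_filtration_image)
    show "(\<lambda>x. N {} +>\<^bsub>?W\<^esub> x) ` carrier ?W = carrier (quot_module ?W (N {}))"
      by (simp add: W.carrier_quot[OF N0])
    show "filtration R ?W s (\<lambda>a. N (P a))"
      unfolding filtration_def
    proof (intro conjI ballI allI impI woS)
      show "submodule (N (P a)) R ?W" for a by (rule N_W[OF P_F])
      show "N (P a) \<subseteq> N (P b)" if "(a, b) \<in> s" for a b by (rule N_mono[OF P_mono[OF that]])
      show "N (P a) = (\<Union>k\<in>underS s a. N (P k))" if l: "limit_elem s a" for a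
      proof -
        have ne: "underS s a \<noteq> {}" using l by (simp add: limit_elem_def)
        \<comment> \<open>There is an index below a limit, so \<open>A\<close> does not get lost in
          the union.\<close>
        have "A \<union> (\<Union>k\<in>P a. B k) = (\<Union>l\<in>underS s a. A \<union> (\<Union>k\<in>P l. B k))"
          using ne unfolding P_lim[OF l] by auto
        moreover have "P k \<subseteq> P l \<or> P l \<subseteq> P k" if "k \<in> underS s a" "l \<in> underS s a" for k l
          using that s.TOTALS P_mono[of k l] P_mono[of l k] unfolding underS_def Field_def by blast
        then have "gen_submodule R M (\<Union>l\<in>underS s a. A \<union> (\<Union>k\<in>P l. B k))
            = (\<Union>l\<in>underS s a. gen_submodule R M (A \<union> (\<Union>k\<in>P l. B k)))"
          by (intro gen_UN_chain[OF ne AB]) blast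
        ultimately show ?thesis unfolding N_def by simp
      qed
      have "N (P None) = carrier ?W" unfolding P_None by simp
      moreover have "N (P a) \<subseteq> carrier ?W" for a using N_mono[OF P_F] by simp
      ultimately show "(\<Union>a\<in>Field s. N (P a)) = carrier ?W" unfolding Fs by blast
    qed
  next
    fix a assume "a \<in> Field s" "underS s a = {}"
    then have "P a = {}" by (simp add: P_def)
    then show "N (P a) = {x \<in> carrier ?W. N {} +>\<^bsub>?W\<^esub> x = \<zero>\<^bsub>quot_module ?W (N {})\<^esub>}"
      using W.quot_map_eq_zero[OF N0] N_mono[of "{}" "Field r"] by auto
  next
    fix a assume a: "a \<in> Field s" "AboveS s {a} \<noteq> {}"
    have "a \<noteq> None"
    proof
      assume "a = None"
      then obtain b where "(None, b) \<in> s" "b \<noteq> None" using a(2) by (auto simp: AboveS_def)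
      then show False by (cases b) (auto simp: s_iff)
    qed
    then obtain i where i: "a = Some i" "i \<in> Field r" using a(1) Fs by auto
    have "P (s.suc {a}) = under r i"
      unfolding P_def s.underS_suc[OF a] unfolding i(1) by (auto simp: under_def s_iff)
    then show "\<exists>L\<in>C. module_isomorphic R (quot_module (restrict_module ?W (N (P (s.suc {a})))) (N (P a))) L"
      using step[OF i(2)] unfolding i(1) P_Some N_def by simp
  qed
  then show ?thesis
    using class_filtered_if_class_filtration unfolding N_def by fastforce
qed

end

text \<open>The algebra of the Hill lemma, separated from cardinalities. \<open>B i\<close> is the
  block added at step \<open>i\<close>, and \<open>meet\<close> confines its relations with
  everything below to the blocks in \<open>D i\<close>. Index sets closed under \<open>D\<close>
  then share with initial segments the property that the factors between them are those of the
  tower.\<close>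

locale tower = left_module R M + wo_rel r
  for R :: "('r, 'x) ring_scheme" (structure) and M :: "('r, 'm) module" (structure) and r :: "'i rel" +
  fixes B :: "'i \<Rightarrow> 'm set" and D :: "'i \<Rightarrow> 'i set"
  assumes B_carrier: "B i \<subseteq> carrier M"
    and D_underS: "i \<in> Field r \<Longrightarrow> D i \<subseteq> underS i"
    and meet: "i \<in> Field r \<Longrightarrow>
      gen_submodule R M (B i) \<inter> gen_submodule R M (\<Union>(B ` underS i)) \<subseteq> gen_submodule R M (\<Union>(B ` D i))"
begin

definition part :: "'i set \<Rightarrow> 'm set" where "part S = gen_submodule R M (\<Union>(B ` S))"

definition closed_set :: "'i set \<Rightarrow> bool" where
  "closed_set S \<longleftrightarrow> S \<subseteq> Field r \<and> (\<forall>i\<in>S. D i \<subseteq> S)"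

lemma UN_B_carrier: "\<Union>(B ` S) \<subseteq> carrier M"
  using B_carrier by auto

lemma submodule_part: "submodule (part S) R M"
  unfolding part_def by (rule submodule_gen[OF UN_B_carrier])

lemma part_mono: "S \<subseteq> S' \<Longrightarrow> part S \<subseteq> part S'"
  unfolding part_def by (intro gen_mono) auto

lemma part_insert: "part (insert i S) = gen_submodule R M (part S \<union> gen_submodule R M (B i))"
  unfolding part_def gen_idem_Un[OF UN_B_carrier B_carrier] by (simp add: Un_commute)

lemma finite_has_max:
  assumes "finite E" "E \<noteq> {}" "E \<subseteq> Field r" shows "\<exists>k\<in>E. E \<subseteq> under k"
  using assms
proof (induction rule: finite_ne_induct)
  case (singleton x) then show ?case using REFL by (auto simp: under_def refl_on_def)
next
  case (insert x E)
  then obtain k where k: "k \<in> E" "E \<subseteq> under k" by auto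
  have "(x, k) \<in> r \<or> (k, x) \<in> r" "(x, x) \<in> r" using TOTALS REFL insert.prems k(1) by (auto simp: refl_on_def)
  then show ?case using k TRANS unfolding under_def trans_def by blast
qed

text \<open>The largest index of a finite support serves as \<open>k\<close>. Excluding
  \<open>part {}\<close> makes sure that the support is not empty.\<close>

lemma part_top:
  assumes S: "S \<subseteq> Field r" and x: "x \<in> part S" "x \<notin> part {}"
  shows "\<exists>k\<in>S. x \<in> part (S \<inter> under k)"
proof -
  have "\<exists>E. finite E \<and> E \<subseteq> S \<and> x \<in> part E"
    using x(1) unfolding part_def by (rule gen_UN_finite_support[OF B_carrier])
  then obtain E where E: "finite E" "E \<subseteq> S" "x \<in> part E" by blast
  have "E \<noteq> {}" using x(2) E(3) by auto
  then obtain k where "k \<in> E" "E \<subseteq> under k" using finite_has_max[of E] E S by blast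
  then show ?thesis using E part_mono[of E "S \<inter> under k"] by blast
qed

text \<open>Descent on the largest index of a support. Let \<open>k\<close> be the least possible
  top of a support of \<open>x\<close> inside \<open>S\<close>. If \<open>k\<close> is outside
  \<open>J\<close>, then \<open>J\<close> lies below \<open>k\<close>, so in
  \<open>x = y + b\<close>, with \<open>b\<close> from block \<open>k\<close>, also \<open>b\<close>
  is generated below \<open>k\<close>. By \<open>meet\<close> it is supported on \<open>D k\<close>,
  hence inside the closed set \<open>S\<close>, and \<open>x\<close> gets a support in
  \<open>S\<close> with a smaller top.\<close>

lemma part_Int:
  assumes S: "closed_set S" and J: "J \<subseteq> Field r" "\<And>j. j \<in> J \<Longrightarrow> under j \<subseteq> J"
    and x: "x \<in> part S" "x \<in> part J"
  shows "x \<in> part (S \<inter> J)"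
proof (rule ccontr)
  assume n: "x \<notin> part (S \<inter> J)"
  then have n0: "x \<notin> part {}" using part_mono[of "{}"] by auto
  have SF: "S \<subseteq> Field r" using S by (simp add: closed_set_def)
  let ?K = "{k \<in> S. x \<in> part (S \<inter> under k)}"
  have K: "?K \<subseteq> Field r" "?K \<noteq> {}" using part_top[OF SF x(1) n0] SF by auto
  define k where "k = minim ?K"
  have k: "k \<in> S" "x \<in> part (S \<inter> under k)" using minim_in[OF K] unfolding k_def by auto
  have kF: "k \<in> Field r" using k(1) SF by auto
  have "k \<notin> J" using k(2) n J(2) part_mono[of "S \<inter> under k" "S \<inter> J"] by blast
  then have Jk: "J \<subseteq> underS k"
    using J TOTALS kF by (fastforce simp: under_def underS_def)
  have "S \<inter> under k = insert k (S \<inter> underS k)" using k(1) under_eq_insert[OF kF] by auto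
  then obtain y b where yb: "y \<in> part (S \<inter> underS k)" "b \<in> gen_submodule R M (B k)" "x = y \<oplus>\<^bsub>M\<^esub> b"
    using k(2) unfolding part_insert gen_Un_submodule[OF submodule_part submodule_gen[OF B_carrier]]
    by (auto simp: part_insert gen_Un_submodule[OF submodule_part submodule_gen[OF B_carrier]])
  have bc: "b \<in> carrier M" using yb(2) gen_subset[OF B_carrier] by auto
  have "y \<in> part (underS k)" using yb(1) part_mono[of "S \<inter> underS k" "underS k"] by auto
  moreover have "x \<in> part (underS k)" using x(2) part_mono[OF Jk] by auto
  ultimately have "b \<in> part (underS k)"
    using submodule_add_cancel[OF submodule_part _ bc] yb(3) by blast
  then have "b \<in> part (D k)" using meet[OF kF] yb(2) unfolding part_def by auto
  then have "b \<in> part (S \<inter> underS k)"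
    using part_mono[of "D k" "S \<inter> underS k"] D_underS[OF kF] S k(1) by (auto simp: closed_set_def)
  then have "x \<in> part (S \<inter> underS k)" using yb(1,3) submodule_add[OF submodule_part] by auto
  then obtain l where l: "l \<in> S \<inter> underS k" "x \<in> part (S \<inter> underS k \<inter> under l)"
    using part_top[of "S \<inter> underS k"] SF n0 by blast
  then have "l \<in> ?K" using part_mono[of "S \<inter> underS k \<inter> under l" "S \<inter> under l"] by blast
  then have "(k, l) \<in> r" unfolding k_def by (rule minim_least[OF K(1)])
  then show False using l(1) ANTISYM by (auto simp: underS_def antisym_def)
qed

text \<open>The blocks of \<open>S' - S\<close> are added one at a time in the inherited order. By
  the second isomorphism theorem the factor at \<open>i\<close> depends only on the trace that the
  earlier part leaves on the span of \<open>B i\<close>. This trace is the same as in the whole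
  tower, and so is the factor.\<close>

lemma closed_quot_class_filtered:
  assumes S: "closed_set S" and S': "closed_set S'" and SS': "S \<subseteq> S'"
    and step: "\<And>i. i \<in> Field r \<Longrightarrow> \<exists>L\<in>C. module_isomorphic R
      (quot_module (restrict_module M (part (under i))) (part (underS i))) L"
  shows "class_filtered R C (quot_module (restrict_module M (part S')) (part S))"
proof -
  let ?V = "S' - S" and ?r = "Restr r (S' - S)"
  have VF: "?V \<subseteq> Field r" using S' by (auto simp: closed_set_def)
  have wo: "Well_order ?r" using Well_order_Restr WELL by blast
  have Fr: "Field ?r = ?V" using VF REFL by (auto simp: Field_def refl_on_def)
  have un: "\<Union>(B ` S) \<union> (\<Union>k\<in>X. B k) = \<Union>(B ` (S \<union> X))" for X by auto
  have "class_filtered R C (quot_module (restrict_module M (gen_submodule R M (\<Union>(B ` S) \<union> (\<Union>k\<in>Field ?r. B k))))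
         (gen_submodule R M (\<Union>(B ` S))))"
  proof (rule class_filtered_quot_if_steps[OF wo UN_B_carrier B_carrier])
    fix i assume "i \<in> Field ?r"
    then have i: "i \<in> S'" "i \<notin> S" "i \<in> Field r" using Fr VF by auto
    have u: "Order_Relation.under ?r i = ?V \<inter> under i" "Order_Relation.underS ?r i = ?V \<inter> underS i"
      using i by (auto simp: under_def underS_def)
    let ?X = "S \<union> (?V \<inter> underS i)" and ?G = "gen_submodule R M (B i)"
    have ins: "S \<union> (?V \<inter> under i) = insert i ?X" using under_eq_insert[OF i(3)] i by auto
    have G: "submodule ?G R M" by (rule submodule_gen[OF B_carrier])
    \<comment> \<open>Relations with lower blocks are supported on \<open>D i\<close>, which is
      contained in \<open>?X\<close>. Conversely, \<open>part_Int\<close> removes the blocks of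
      \<open>S\<close> that lie above \<open>i\<close>.\<close>
    have "?G \<inter> part ?X = ?G \<inter> part (underS i)"
    proof (intro equalityI subsetI)
      fix x assume x: "x \<in> ?G \<inter> part (underS i)"
      then have "x \<in> part (D i)" using meet[OF i(3)] unfolding part_def by auto
      moreover have "D i \<subseteq> ?X" using D_underS[OF i(3)] S' i(1) by (auto simp: closed_set_def)
      ultimately show "x \<in> ?G \<inter> part ?X" using x part_mono by blast
    next
      fix x assume x: "x \<in> ?G \<inter> part ?X"
      \<comment> \<open>Adding the whole segment below \<open>i\<close> to \<open>S\<close> keeps
        the set closed. Cutting at \<open>i\<close> leaves only that segment, because
        \<open>i\<close> is not in \<open>S\<close>.\<close>
      let ?Y = "S \<union> underS i"
      have Y: "closed_set ?Y"
        unfolding closed_set_def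
      proof (intro conjI ballI)
        show "?Y \<subseteq> Field r" using S underS_Field by (auto simp: closed_set_def)
        fix j assume j: "j \<in> ?Y"
        have "D j \<subseteq> underS i" if ji: "j \<in> underS i"
        proof -
          have "j \<in> Field r" using ji by (auto simp: underS_def Field_def)
          then have "D j \<subseteq> underS j" by (rule D_underS)
          also have "\<dots> \<subseteq> underS i"
            using ji TRANS ANTISYM unfolding underS_def trans_def antisym_def by blast
          finally show ?thesis .
        qed
        then show "D j \<subseteq> ?Y" using j S unfolding closed_set_def by blast
      qed
      have "x \<in> part ?Y" using x part_mono[of ?X ?Y] by blast
      moreover have "x \<in> part (under i)"
        using x gen_mono[of "B i" "\<Union>(B ` under i)"] under_eq_insert[OF i(3)] unfolding part_def by auto
      moreover have "under i \<subseteq> Field r" by (auto simp: under_def Field_def)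
      moreover have "under j \<subseteq> under i" if "j \<in> under i" for j
        using that TRANS by (auto simp: under_def trans_def)
      ultimately have "x \<in> part (?Y \<inter> under i)" by (intro part_Int[OF Y])
      moreover have "?Y \<inter> under i = underS i" using under_eq_insert[OF i(3)] i(2) by (auto simp: underS_def)
      ultimately show "x \<in> ?G \<inter> part (underS i)" using x by simp
    qed
    then have "module_isomorphic R (quot_module (restrict_module M ?G) (?G \<inter> part (underS i)))
        (quot_module (restrict_module M (part (insert i ?X))) (part ?X))"
      using second_isomorphism[OF G submodule_part[of ?X]] unfolding part_insert by simp
    moreover have "left_module R (quot_module (restrict_module M ?G) (?G \<inter> part (underS i)))"
    proof (rule left_module.quot_left_module[OF restrict_left_module[OF G]])
      have "submodule (?G \<inter> part (underS i)) R M"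
        using G submodule_part[of "underS i"] unfolding submodule_iff by auto
      then show "submodule (?G \<inter> part (underS i)) R (restrict_module M ?G)"
        using submodule_restrict[OF G] by auto
    qed
    moreover have "left_module R (quot_module (restrict_module M (part (insert i ?X))) (part ?X))"
      using left_module.quot_left_module[OF restrict_left_module[OF submodule_part]]
        submodule_restrict[OF submodule_part part_mono] submodule_part by blast
    ultimately have 1: "module_isomorphic R (quot_module (restrict_module M (part (insert i ?X))) (part ?X))
        (quot_module (restrict_module M ?G) (?G \<inter> part (underS i)))"
      using module_isomorphic_sym by blast
    have 2: "module_isomorphic R (quot_module (restrict_module M ?G) (?G \<inter> part (underS i)))
        (quot_module (restrict_module M (part (under i))) (part (underS i)))"
      using second_isomorphism[OF G submodule_part[of "underS i"]]
      unfolding under_eq_insert[OF i(3)] part_insert .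
    show "\<exists>L\<in>C. module_isomorphic R
         (quot_module (restrict_module M (gen_submodule R M (\<Union>(B ` S) \<union> (\<Union>k\<in>Order_Relation.under ?r i. B k))))
           (gen_submodule R M (\<Union>(B ` S) \<union> (\<Union>k\<in>Order_Relation.underS ?r i. B k)))) L"
      using step[OF i(3)] module_isomorphic_trans[OF module_isomorphic_trans[OF 1 2]]
      unfolding u un ins part_def by blast
  qed
  moreover have "S \<union> ?V = S'" using SS' by auto
  ultimately show ?thesis unfolding Fr un part_def by (simp only:)
qed

end

section \<open>The Hill lemma\<close>

locale regular_uncountable =
  fixes \<mu> :: "'k rel"
  assumes card: "Card_order \<mu>" and unc: "natLeq <o \<mu>" and reg: "regularCard \<mu>"
begin

lemma infinite_Field: "\<not> finite (Field \<mu>)"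
proof
  assume "finite (Field \<mu>)"
  then have "\<mu> <o natLeq"
    using finite_ordLess_infinite[of \<mu> natLeq] card natLeq_Well_order Field_natLeq
    by (auto simp: card_order_on_def)
  then show False using unc ordLess_transitive ordLess_irreflexive by blast
qed

lemma stable: "stable \<mu>"
  by (rule regularCard_stable[OF card infinite_Field reg])

lemma small_finite:
  assumes "finite A" shows "|A| <o \<mu>"
proof -
  have "|A| <o natLeq"
    using finite_ordLess_infinite[of "|A|" natLeq] assms natLeq_Well_order Field_natLeq card_of_Well_order
    by (auto simp: Field_card_of)
  then show ?thesis using unc by (rule ordLess_transitive)
qed

lemma small_UN: "|A| <o \<mu> \<Longrightarrow> (\<And>a. a \<in> A \<Longrightarrow> |F a| <o \<mu>) \<Longrightarrow> |\<Union>a\<in>A. F a| <o \<mu>"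
  by (rule stable_UNION[OF stable])

lemma small_image: "|A| <o \<mu> \<Longrightarrow> |f ` A| <o \<mu>"
  using card_of_image ordLeq_ordLess_trans by blast

lemma small_Un: "|A| <o \<mu> \<Longrightarrow> |B| <o \<mu> \<Longrightarrow> |A \<union> B| <o \<mu>"
  using card_of_Un_ordLess_infinite_Field[OF infinite_Field card] by blast

text \<open>Apply \<open>G\<close> countably often and unite the stages. Regularity keeps every
  stage small; for the union of all stages uncountability is needed as well.\<close>

lemma small_closure:
  assumes X: "X \<subseteq> U" "|X| <o \<mu>" and G: "\<And>x. x \<in> U \<Longrightarrow> G x \<subseteq> U" "\<And>x. x \<in> U \<Longrightarrow> |G x| <o \<mu>"
  obtains Y where "X \<subseteq> Y" "Y \<subseteq> U" "|Y| <o \<mu>" "\<And>x. x \<in> Y \<Longrightarrow> G x \<subseteq> Y"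
proof -
  define S where "S n = ((\<lambda>Z. Z \<union> (\<Union>z\<in>Z. G z)) ^^ n) X" for n
  have S: "S n \<subseteq> U \<and> |S n| <o \<mu>" for n
  proof (induction n)
    case 0 then show ?case using X by (simp add: S_def)
  next
    case (Suc n)
    have "|\<Union>z\<in>S n. G z| <o \<mu>" using Suc G(2) by (intro small_UN) auto
    then show ?case using Suc G(1) small_Un unfolding S_def by auto
  qed
  have suc: "S (Suc n) = S n \<union> (\<Union>z\<in>S n. G z)" for n by (simp add: S_def)
  show ?thesis
  proof (rule that)
    show "X \<subseteq> (\<Union>n. S n)" using S_def[of 0] by auto
    show "(\<Union>n. S n) \<subseteq> U" using S by auto
    have "|UNIV :: nat set| <o \<mu>" by (rule ordIso_ordLess_trans[OF card_of_nat unc])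
    then show "|\<Union>n. S n| <o \<mu>" using S by (intro small_UN) auto
    fix x assume "x \<in> (\<Union>n. S n)"
    then obtain n where "x \<in> S n" by auto
    then show "G x \<subseteq> (\<Union>n. S n)" using suc[of n] by blast
  qed
qed

end

text \<open>A family as in the Hill lemma, represented by a closure operator: all submodules generated by
  \<open>G\<close>-closed sets belong to it.\<close>

lemma (in regular_uncountable) hill_closure:
  fixes P :: "('r, 'p) module" and R :: "('r, 'x) ring_scheme"
  assumes P: "left_module R P" and cf: "class_filtered R C P"
    and pres: "\<And>N. N \<in> C \<Longrightarrow> left_module R N \<and> less_presented R \<mu> N"
  obtains G where "\<And>p. p \<in> carrier P \<Longrightarrow> G p \<subseteq> carrier P" "\<And>p. p \<in> carrier P \<Longrightarrow> |G p| <o \<mu>"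
    "\<And>Q Q'. Q \<subseteq> Q' \<Longrightarrow> Q' \<subseteq> carrier P \<Longrightarrow> \<forall>q\<in>Q. G q \<subseteq> Q \<Longrightarrow> \<forall>q\<in>Q'. G q \<subseteq> Q' \<Longrightarrow>
       class_filtered R C (quot_module (restrict_module P (gen_submodule R P Q')) (gen_submodule R P Q))"
proof -
  interpret P: left_module R P by (rule P)
  obtain r :: "'p set rel" and F where F: "class_filtration R C P r F"
    using cf unfolding class_filtered_def by blast
  then have fil: "filtration R P r F"
    and zero: "\<And>i. i \<in> Field r \<Longrightarrow> underS r i = {} \<Longrightarrow> F i = {\<zero>\<^bsub>P\<^esub>}"
    and step: "\<And>i. i \<in> Field r \<Longrightarrow> AboveS r {i} \<noteq> {} \<Longrightarrow>
       \<exists>N\<in>C. module_isomorphic R (quot_module (restrict_module P (F (wo_rel.suc r {i}))) (F i)) N"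
    unfolding class_filtration_def by auto
  have wo: "Well_order r"
    and sub: "\<And>i. i \<in> Field r \<Longrightarrow> submodule (F i) R P"
    and mono: "\<And>i j. (i, j) \<in> r \<Longrightarrow> F i \<subseteq> F j"
    and lim: "\<And>i. limit_elem r i \<Longrightarrow> F i = (\<Union>k\<in>underS r i. F k)"
    and un: "(\<Union>i\<in>Field r. F i) = carrier P"
    using fil unfolding filtration_def by auto
  interpret r: wo_rel r using wo by (simp add: wo_rel_def)
  \<comment> \<open>The indices at which the filtration has a next member: a maximal index
    contributes no factor and gets no block.\<close>
  define W where "W = {i \<in> Field r. AboveS r {i} \<noteq> {}}"
  have WF: "W \<subseteq> Field r" by (auto simp: W_def)
  have suc: "(i, r.suc {i}) \<in> r" "r.suc {i} \<in> Field r" if "i \<in> W" for i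
    using r.suc_greater[of "{i}" i] r.suc_inField[of "{i}"] that by (auto simp: W_def)
  \<comment> \<open>\<open>B\<close> generates the next member over \<open>F i\<close>; the small
    set \<open>T\<close> controls the relations between the span of \<open>B\<close> and
    \<open>F i\<close>.\<close>
  define ok where "ok i B T \<longleftrightarrow> B \<subseteq> F (r.suc {i}) \<and> |B| <o \<mu> \<and> T \<subseteq> F i \<and> |T| <o \<mu> \<and>
      F (r.suc {i}) = gen_submodule R P (F i \<union> B) \<and> gen_submodule R P B \<inter> F i \<subseteq> gen_submodule R P T" for i B T
  have "\<exists>B T. ok i B T" if i: "i \<in> W" for i
  proof -
    let ?V = "F (r.suc {i})"
    have V: "submodule ?V R P" and Fi: "F i \<subseteq> ?V" using suc[OF i] sub mono by auto
    have U: "submodule (F i) R (restrict_module P ?V)"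
      using P.submodule_restrict[OF V Fi] sub i WF by auto
    obtain N where N: "N \<in> C" "module_isomorphic R (quot_module (restrict_module P ?V) (F i)) N"
      using step[of i] i by (auto simp: W_def)
    have NN: "left_module R N" "less_presented R \<mu> N" using pres[OF N(1)] by auto
    show ?thesis
    proof (rule left_module.less_presented_quot_generators[OF P.restrict_left_module[OF V] U NN N(2)])
      fix B T
      assume BT: "B \<subseteq> carrier (restrict_module P ?V)" "|B| <o \<mu>" "T \<subseteq> F i" "|T| <o \<mu>"
        "carrier (restrict_module P ?V) = gen_submodule R (restrict_module P ?V) (F i \<union> B)"
        "gen_submodule R (restrict_module P ?V) B \<inter> F i \<subseteq> gen_submodule R (restrict_module P ?V) T"
      have BV: "B \<subseteq> ?V" "T \<subseteq> ?V" "F i \<union> B \<subseteq> ?V" using BT Fi by auto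
      show ?thesis
        using BT unfolding P.gen_restrict[OF V BV(1)] P.gen_restrict[OF V BV(2)] P.gen_restrict[OF V BV(3)]
        by - (rule exI[of _ B], rule exI[of _ T], simp add: ok_def)
    qed
  qed
  then obtain B0 T where ok: "\<And>i. i \<in> W \<Longrightarrow> ok i (B0 i) (T i)" by metis
  then have T: "\<And>i. i \<in> W \<Longrightarrow> T i \<subseteq> F i" "\<And>i. i \<in> W \<Longrightarrow> |T i| <o \<mu>"
    unfolding ok_def by auto
  \<comment> \<open>The value outside \<open>W\<close> is a default: a tower asks every block to lie
    in the carrier.\<close>
  define B where "B i = (if i \<in> W then B0 i else {})" for i
  have B_suc: "B i \<subseteq> F (r.suc {i})" and B_small: "|B i| <o \<mu>"
    and gen_suc: "F (r.suc {i}) = gen_submodule R P (F i \<union> B i)"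
    and rel: "gen_submodule R P (B i) \<inter> F i \<subseteq> gen_submodule R P (T i)" if "i \<in> W" for i
    using ok[OF that] that unfolding ok_def B_def by auto
  have BP: "B i \<subseteq> carrier P" for i
    using ok[of i] P.submodule_subset[OF sub[OF suc(2)], of i] unfolding ok_def B_def by (cases "i \<in> W") auto
  have BP': "\<Union>(B ` S) \<subseteq> carrier P" for S using BP by auto
  define N where "N S = gen_submodule R P (\<Union>(B ` S))" for S
  have N_sub: "submodule (N S) R P" for S unfolding N_def by (rule P.submodule_gen[OF BP'])
  have N_mono: "S \<subseteq> S' \<Longrightarrow> N S \<subseteq> N S'" for S S' unfolding N_def by (intro P.gen_mono) auto
  \<comment> \<open>Each member is generated by the blocks of the steps before it: none at zero,
    those collected so far at a limit, one more at a successor.\<close>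
  have F_N: "i \<in> Field r \<Longrightarrow> F i = N (W \<inter> underS r i)" for i
  proof (induction i rule: r.well_order_induct)
    case (1 i)
    have "F i \<subseteq> N (W \<inter> underS r i)"
    proof (rule r.zero_limit_succ[OF \<open>i \<in> Field r\<close>])
      assume "underS r i = {}"
      then show ?thesis using zero[OF 1(2)] P.submodule_zero_mem[OF N_sub] by auto
    next
      assume l: "limit_elem r i"
      have "F k \<subseteq> N (W \<inter> underS r i)" if k: "k \<in> underS r i" for k
      proof -
        have "k \<noteq> i" "(k, i) \<in> r" "k \<in> Field r" using k by (auto simp: underS_def Field_def)
        then have "F k = N (W \<inter> underS r k)" using 1 by blast
        moreover have "underS r k \<subseteq> underS r i"
          using k r.TRANS r.ANTISYM unfolding underS_def trans_def antisym_def by blast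
        ultimately show ?thesis using N_mono[of "W \<inter> underS r k" "W \<inter> underS r i"] by auto
      qed
      then show ?thesis using lim[OF l] by auto
    next
      fix k assume k: "k \<in> Field r" "AboveS r {k} \<noteq> {}" "r.suc {k} = i"
      have kW: "k \<in> W" using k by (simp add: W_def)
      have uS: "underS r i = under r k" using r.underS_suc[OF k(1,2)] k(3) by simp
      have ki: "(k, i) \<in> r" "k \<noteq> i" using r.suc_greater[of "{k}" k] k by auto
      have "F k = N (W \<inter> underS r k)" using 1 ki k(1) by blast
      moreover have "underS r k \<subseteq> under r k" by (auto simp: under_def underS_def)
      ultimately have "F k \<subseteq> N (W \<inter> underS r i)" unfolding uS
        using N_mono[of "W \<inter> underS r k" "W \<inter> under r k"] by auto
      moreover have "B k \<subseteq> N (W \<inter> underS r i)"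
        using P.gen_incl[of "\<Union>(B ` (W \<inter> underS r i))"] kW r.under_eq_insert[OF k(1)] unfolding N_def uS by auto
      ultimately show ?thesis
        using gen_suc[OF kW] unfolding k(3) using P.gen_minimal[OF _ N_sub] by simp
    qed
    moreover have "B j \<subseteq> F i" if j: "j \<in> W \<inter> underS r i" for j
    proof -
      have "i \<in> AboveS r {j}" using j 1(2) by (auto simp: underS_def AboveS_def)
      then have "(r.suc {j}, i) \<in> r" by (rule r.suc_least_AboveS)
      then show ?thesis using B_suc[of j] mono j by blast
    qed
    then have "N (W \<inter> underS r i) \<subseteq> F i" unfolding N_def by (intro P.gen_minimal sub[OF 1(2)]) auto
    ultimately show ?case by auto
  qed
  \<comment> \<open>After restriction to \<open>W\<close>, the indices strictly below
    \<open>i\<close> describe \<open>F i\<close>, and together with \<open>i\<close> itself they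
    describe the next member. The factors of the tower are thus exactly those of the
    filtration.\<close>
  define s where "s = Restr r W"
  have sF: "Field s = W" using WF r.REFL unfolding s_def by (auto simp: Field_def refl_on_def)
  have s_uS: "underS s i = W \<inter> underS r i" "under s i = W \<inter> under r i" if "i \<in> W" for i
    using that unfolding s_def by (auto simp: underS_def under_def)
  have woS: "wo_rel s" using Well_order_Restr[OF wo, of W] unfolding s_def wo_rel_def by simp
  have F_uS: "F i = N (underS s i)" if "i \<in> W" for i using F_N[of i] s_uS[OF that] that WF by auto
  have F_u: "F (r.suc {i}) = N (under s i)" if i: "i \<in> W" for i
    using F_N[OF suc(2)[OF i]] s_uS[OF i] r.underS_suc[of i] i by (simp add: W_def)
  have fin: "\<exists>E. finite E \<and> E \<subseteq> S \<and> x \<in> N E" if "x \<in> N S" for x S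
    using P.gen_UN_finite_support[OF BP] that unfolding N_def .
  obtain E where E: "\<And>x S. x \<in> N S \<Longrightarrow> finite (E x S)" "\<And>x S. x \<in> N S \<Longrightarrow> E x S \<subseteq> S"
      "\<And>x S. x \<in> N S \<Longrightarrow> x \<in> N (E x S)"
    using fin by metis
  \<comment> \<open>Each of the few elements of \<open>T i\<close> has a finite support below
    \<open>i\<close>; together these supports are still small.\<close>
  define D where "D i = (\<Union>t\<in>T i. E t (underS s i))" for i
  have TN: "T i \<subseteq> N (underS s i)" if "i \<in> W" for i using T(1)[OF that] F_uS[OF that] by simp
  have D_uS: "D i \<subseteq> underS s i" if "i \<in> W" for i
    using E(2) TN[OF that] unfolding D_def by blast
  have D_small: "|D i| <o \<mu>" if "i \<in> W" for i
    unfolding D_def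
  proof (rule small_UN[OF T(2)[OF that]])
    fix t assume "t \<in> T i"
    then have "t \<in> N (underS s i)" using TN[OF that] by auto
    then show "|E t (underS s i)| <o \<mu>" by (intro small_finite E(1))
  qed
  have "gen_submodule R P (T i) \<subseteq> N (D i)" if i: "i \<in> W" for i
  proof (rule P.gen_minimal[OF _ N_sub])
    show "T i \<subseteq> N (D i)"
    proof
      fix t assume t: "t \<in> T i"
      then have "t \<in> N (E t (underS s i))" using E(3) TN[OF i] by auto
      then show "t \<in> N (D i)" using N_mono[of "E t (underS s i)" "D i"] t unfolding D_def by auto
    qed
  qed
  then have meet: "gen_submodule R P (B i) \<inter> N (underS s i) \<subseteq> N (D i)" if "i \<in> W" for i
    using rel[OF that] F_uS[OF that] that by blast
  interpret t: tower R P s B D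
    by (intro tower.intro tower_axioms.intro P woS)
       (use BP D_uS meet sF in \<open>auto simp: N_def\<close>)
  have part: "t.part S = N S" for S unfolding t.part_def N_def ..
  have top: "carrier P = N W"
  proof
    show "carrier P \<subseteq> N W" using F_N N_mono[of "W \<inter> underS r _" W] unfolding un[symmetric] by blast
  qed (use P.submodule_subset[OF N_sub] in auto)
  have "\<exists>H. E p W \<subseteq> H \<and> H \<subseteq> W \<and> |H| <o \<mu> \<and> (\<forall>i\<in>H. D i \<subseteq> H)" if p: "p \<in> carrier P" for p
  proof -
    have "D i \<subseteq> W" if "i \<in> W" for i using D_uS[OF that] s_uS[OF that] by auto
    then obtain H where "E p W \<subseteq> H" "H \<subseteq> W" "|H| <o \<mu>" "\<And>i. i \<in> H \<Longrightarrow> D i \<subseteq> H"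
      using small_closure[of "E p W" W D] E(1,2)[of p W] p top D_small small_finite by metis
    then show ?thesis by blast
  qed
  then obtain H where H: "\<And>p. p \<in> carrier P \<Longrightarrow> E p W \<subseteq> H p" "\<And>p. p \<in> carrier P \<Longrightarrow> H p \<subseteq> W"
     "\<And>p. p \<in> carrier P \<Longrightarrow> |H p| <o \<mu>" "\<And>p i. p \<in> carrier P \<Longrightarrow> i \<in> H p \<Longrightarrow> D i \<subseteq> H p"
    by metis
  have p_N: "p \<in> N (H p)" if p: "p \<in> carrier P" for p
    using E(3)[of p W] N_mono[OF H(1)[OF p]] p top by auto
  show ?thesis
  \<comment> \<open>\<open>G p\<close> consists of all generators from a small closed set of blocks
    whose span contains \<open>p\<close>.\<close>
  proof (rule that[of "\<lambda>p. \<Union>(B ` H p)"])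
    show "\<Union>(B ` H p) \<subseteq> carrier P" if "p \<in> carrier P" for p by (rule BP')
    show "|\<Union>(B ` H p)| <o \<mu>" if "p \<in> carrier P" for p
      using H(2,3)[OF that] B_small by (intro small_UN) auto
    fix Q Q' assume QQ: "Q \<subseteq> Q'" "Q' \<subseteq> carrier P"
      and Q: "\<forall>q\<in>Q. \<Union>(B ` H q) \<subseteq> Q" and Q': "\<forall>q\<in>Q'. \<Union>(B ` H q) \<subseteq> Q'"
    \<comment> \<open>A \<open>G\<close>-closed set spans the same submodule as its blocks: each
      element lies in the span of its own blocks, and the closed set contains them.\<close>
    have gen: "gen_submodule R P X = N (\<Union>(H ` X))"
      if X: "X \<subseteq> carrier P" and cl: "\<And>q. q \<in> X \<Longrightarrow> \<Union>(B ` H q) \<subseteq> X" for X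
    proof
      have "p \<in> N (\<Union>(H ` X))" if "p \<in> X" for p
        using p_N[of p] X that N_mono[of "H p" "\<Union>(H ` X)"] by auto
      then show "gen_submodule R P X \<subseteq> N (\<Union>(H ` X))" by (intro P.gen_minimal N_sub) auto
      show "N (\<Union>(H ` X)) \<subseteq> gen_submodule R P X" unfolding N_def using cl by (intro P.gen_mono) blast
    qed
    have closed: "t.closed_set (\<Union>(H ` X))" if "X \<subseteq> carrier P" for X
      unfolding t.closed_set_def sF using H(2,4) that by blast
    have "class_filtered R C (quot_module (restrict_module P (t.part (\<Union>(H ` Q')))) (t.part (\<Union>(H ` Q))))"
    proof (rule t.closed_quot_class_filtered)
      show "t.closed_set (\<Union>(H ` Q))" "t.closed_set (\<Union>(H ` Q'))" using closed QQ by auto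
      show "\<Union>(H ` Q) \<subseteq> \<Union>(H ` Q')" using QQ(1) by auto
      fix i assume "i \<in> Field s"
      then have i: "i \<in> W" using sF by simp
      show "\<exists>L\<in>C. module_isomorphic R (quot_module (restrict_module P (t.part (under s i))) (t.part (underS s i))) L"
        using step[of i] i F_u[OF i] F_uS[OF i] unfolding part by (simp add: W_def)
    qed
    then show "class_filtered R C (quot_module (restrict_module P (gen_submodule R P Q')) (gen_submodule R P Q))"
      using gen[of Q] gen[of Q'] QQ Q Q' unfolding part by auto
  qed
qed

section \<open>Simulating the filtration game\<close>

text \<open>The isomorphism for the whole set \<open>S\<close> maps the span of the left-hand
  elements of any smaller set of pairs onto the span of its right-hand elements. Its kernel is
  trivial, so \<open>quot_image_iso\<close> applies.\<close>

lemma partial_isomorphism_quot: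
  assumes M: "left_module R M" and P: "left_module R P"
    and pi: "partial_isomorphism R M P S" and S: "S \<subseteq> carrier M \<times> carrier P"
    and S01: "S0 \<subseteq> S1" "S1 \<subseteq> S"
  shows "module_isomorphic R
    (quot_module (restrict_module M (gen_submodule R M (fst ` S1))) (gen_submodule R M (fst ` S0)))
    (quot_module (restrict_module P (gen_submodule R P (snd ` S1))) (gen_submodule R P (snd ` S0)))"
proof -
  interpret M: left_module R M by (rule M)
  interpret P: left_module R P by (rule P)
  let ?A = "gen_submodule R M (fst ` S)" and ?B = "gen_submodule R P (snd ` S)"
  have sub: "submodule ?A R M" "submodule ?B R P"
    using S by (auto intro!: M.submodule_gen P.submodule_gen)
  obtain h where h: "h \<in> module_iso R (restrict_module M ?A) (restrict_module P ?B)"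
    and hS: "\<And>x. x \<in> S \<Longrightarrow> h (fst x) = snd x"
    using pi unfolding partial_isomorphism_def by fastforce
  interpret h: linear_map R "restrict_module M ?A" "restrict_module P ?B" h
    using h unfolding module_iso_iff
    by (intro linear_map.intro linear_map_axioms.intro M.restrict_left_module P.restrict_left_module sub) auto
  have inj: "inj_on h ?A" using h unfolding module_iso_iff bij_betw_def by simp
  have sA: "fst ` T \<subseteq> ?A" "snd ` T \<subseteq> ?B" if "T \<subseteq> S" for T
    using that M.gen_incl[of "fst ` S"] P.gen_incl[of "snd ` S"] by blast+
  have gA: "gen_submodule R M (fst ` T) \<subseteq> ?A" if "T \<subseteq> S" for T
    using that by (intro M.gen_mono) auto
  have img: "h ` gen_submodule R M (fst ` T) = gen_submodule R P (snd ` T)" if T: "T \<subseteq> S" for T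
  proof -
    have "h ` fst ` T = snd ` T" using hS T unfolding image_image by (intro image_cong) auto
    then show ?thesis
      using h.image_gen[of "fst ` T"] sA[OF T]
      by (simp add: M.gen_restrict[OF sub(1)] P.gen_restrict[OF sub(2)])
  qed
  have subT: "submodule (gen_submodule R M (fst ` T)) R (restrict_module M ?A)" if T: "T \<subseteq> S" for T
  proof -
    have "fst ` T \<subseteq> carrier M" using S T by fastforce
    then show ?thesis using M.submodule_restrict[OF sub(1) gA[OF T]] M.submodule_gen by auto
  qed
  have S0: "S0 \<subseteq> S" using S01 by auto
  have "module_isomorphic R
    (quot_module (restrict_module (restrict_module M ?A) (gen_submodule R M (fst ` S1))) (gen_submodule R M (fst ` S0)))
    (quot_module (restrict_module (restrict_module P ?B) (h ` gen_submodule R M (fst ` S1))) (h ` gen_submodule R M (fst ` S0)))"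
  proof (rule h.quot_image_iso[OF subT[OF S0] subT[OF S01(2)]])
    show "gen_submodule R M (fst ` S0) \<subseteq> gen_submodule R M (fst ` S1)" using S01 by (intro M.gen_mono) auto
    fix x assume x: "x \<in> carrier (restrict_module M ?A)" "h x = \<zero>\<^bsub>restrict_module P ?B\<^esub>"
    have "x = \<zero>\<^bsub>M\<^esub>"
      by (rule inj_onD[OF inj]) (use x h.map_zero M.submodule_zero_mem[OF sub(1)] in auto)
    then show "x \<in> gen_submodule R M (fst ` S0)"
      using h.M.submodule_zero_mem[OF subT[OF S0]] by simp
  qed
  then show ?thesis using img[OF S0] img[OF S01(2)] by simp
qed

text \<open>
  The run of the filtration game simulated along positions \<open>S u\<close> of the other game, where \<open>S u\<close> is
  the set of pairs chosen before inning \<open>u\<close>.  Round \<open>i\<close> is represented by the move of Player 1 and the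
  set of innings at which the round may be regarded as finished; Player 2 answers with the
  left-hand elements that are present at the first such inning.
\<close>

definition simulation ::
    "'k rel \<Rightarrow> ('k \<Rightarrow> ('k \<Rightarrow> 'm set \<times> 'm set) \<Rightarrow> 'm set) \<Rightarrow> ('p \<Rightarrow> 'p set) \<Rightarrow> ('k \<Rightarrow> ('m \<times> 'p) set) \<Rightarrow>
     'k \<Rightarrow> 'm set \<times> 'k set" where
  "simulation \<mu> \<sigma> G S = wfrec (\<mu> - Id) (\<lambda>V i.
     let X = \<sigma> i (restrict (\<lambda>k. (fst (V k), \<Inter>u\<in>snd (V k). fst ` S u)) (underS \<mu> i))
     in (X, {u \<in> Field \<mu>. (\<forall>k\<in>underS \<mu> i. \<exists>v\<in>snd (V k). (v, u) \<in> \<mu>) \<and> X \<subseteq> fst ` S u \<and>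
              (\<forall>q\<in>snd ` S u. G q \<subseteq> snd ` S u)}))"

definition demand where "demand \<mu> \<sigma> G S i = fst (simulation \<mu> \<sigma> G S i)"
definition finish_times where "finish_times \<mu> \<sigma> G S i = snd (simulation \<mu> \<sigma> G S i)"
text \<open>Positions increase, so the intersection is the value at the first finish time; in this
  form later times can be discarded without naming a first one. If there is no finish time the value
  is \<open>UNIV\<close>, a case that \<open>fin_nonempty\<close> rules out for the rounds that
  matter.\<close>

definition answer where "answer \<mu> \<sigma> G S i = (\<Inter>u\<in>finish_times \<mu> \<sigma> G S i. fst ` S u)"

text \<open>A round consults only strictly earlier rounds, and there the \<open>cut\<close>
  introduced by \<open>wfrec\<close> changes nothing.\<close>

lemma simulation_rec:
  assumes "Well_order \<mu>"
  shows "demand \<mu> \<sigma> G S i = \<sigma> i (restrict (\<lambda>k. (demand \<mu> \<sigma> G S k, answer \<mu> \<sigma> G S k)) (underS \<mu> i))" (is ?A)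
    and "finish_times \<mu> \<sigma> G S i = {u \<in> Field \<mu>.
      (\<forall>k\<in>underS \<mu> i. \<exists>v\<in>finish_times \<mu> \<sigma> G S k. (v, u) \<in> \<mu>) \<and>
      demand \<mu> \<sigma> G S i \<subseteq> fst ` S u \<and> (\<forall>q\<in>snd ` S u. G q \<subseteq> snd ` S u)}" (is ?B)
proof -
  let ?V = "simulation \<mu> \<sigma> G S"
  have wf: "wf (\<mu> - Id)" using assms by (simp add: well_order_on_def)
  have c: "cut ?V (\<mu> - Id) i k = ?V k" if "k \<in> underS \<mu> i" for k
    using that by (auto simp: underS_def cut_apply)
  have r: "restrict (\<lambda>k. (fst (cut ?V (\<mu> - Id) i k), \<Inter>u\<in>snd (cut ?V (\<mu> - Id) i k). fst ` S u)) (underS \<mu> i)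
      = restrict (\<lambda>k. (demand \<mu> \<sigma> G S k, answer \<mu> \<sigma> G S k)) (underS \<mu> i)"
    by (intro restrict_ext) (simp add: c demand_def answer_def finish_times_def)
  have e: "?V i = (let X = \<sigma> i (restrict (\<lambda>k. (demand \<mu> \<sigma> G S k, answer \<mu> \<sigma> G S k)) (underS \<mu> i))
     in (X, {u \<in> Field \<mu>. (\<forall>k\<in>underS \<mu> i. \<exists>v\<in>snd (cut ?V (\<mu> - Id) i k). (v, u) \<in> \<mu>) \<and> X \<subseteq> fst ` S u \<and>
              (\<forall>q\<in>snd ` S u. G q \<subseteq> snd ` S u)}))"
    unfolding r[symmetric] by (rule def_wfrec[OF eq_reflection[OF simulation_def] wf])
  show ?A unfolding demand_def[of _ _ _ _ i] e by (simp add: Let_def)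
  then show ?B
    unfolding finish_times_def[of _ _ _ _ i] e by (simp add: Let_def c finish_times_def)
qed

section \<open>Locality of the simulated run, and counting innings\<close>

locale simulation_setup = regular_uncountable \<mu> + wo_rel \<mu>
  for \<mu> :: "'k rel" +
  fixes \<sigma> :: "'k \<Rightarrow> ('k \<Rightarrow> 'm set \<times> 'm set) \<Rightarrow> 'm set" and G :: "'p \<Rightarrow> 'p set"
begin

abbreviation "dem \<equiv> demand \<mu> \<sigma> G"
abbreviation "fin \<equiv> finish_times \<mu> \<sigma> G"
abbreviation "ans \<equiv> answer \<mu> \<sigma> G"

lemma dem_rec: "dem S i = \<sigma> i (restrict (\<lambda>k. (dem S k, ans S k)) (underS i))"
  and fin_rec: "fin S i = {u \<in> Field \<mu>. (\<forall>k\<in>underS i. \<exists>v\<in>fin S k. (v, u) \<in> \<mu>) \<and>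
      dem S i \<subseteq> fst ` S u \<and> (\<forall>q\<in>snd ` S u. G q \<subseteq> snd ` S u)}"
  by (rule simulation_rec[OF WELL])+

lemma fin_Field: "fin S i \<subseteq> Field \<mu>"
  unfolding fin_rec[of S i] by auto

definition monotone_positions :: "('k \<Rightarrow> ('m \<times> 'p) set) \<Rightarrow> bool" where
  "monotone_positions S \<longleftrightarrow> (\<forall>u v. (u, v) \<in> \<mu> \<longrightarrow> S u \<subseteq> S v)"

text \<open>The bound is not strict. In the application \<open>S t\<close> contains only pairs from
  innings before \<open>t\<close>, so a round that finishes at \<open>t\<close> is over when Spoiler
  moves at \<open>t\<close>; several rounds may even finish at the same inning.\<close>

definition done_by :: "('k \<Rightarrow> ('m \<times> 'p) set) \<Rightarrow> 'k \<Rightarrow> 'k \<Rightarrow> bool" where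
  "done_by S t i \<longleftrightarrow> (\<exists>u\<in>fin S i. (u, t) \<in> \<mu>)"

text \<open>Once some finish time is at most \<open>t\<close>, the times after \<open>t\<close> have
  larger positions and do not affect the intersection.\<close>

lemma ans_eq:
  assumes S: "monotone_positions S" and d: "done_by S t k"
  shows "ans S k = (\<Inter>u\<in>{u \<in> fin S k. (u, t) \<in> \<mu>}. fst ` S u)"
proof (intro equalityI subsetI)
  fix x assume x: "x \<in> (\<Inter>u\<in>{u \<in> fin S k. (u, t) \<in> \<mu>}. fst ` S u)"
  obtain v where v: "v \<in> fin S k" "(v, t) \<in> \<mu>" using d by (auto simp: done_by_def)
  have "x \<in> fst ` S u" if u: "u \<in> fin S k" for u
  proof (cases "(u, t) \<in> \<mu>")
    case False
    have "u \<in> Field \<mu>" "t \<in> Field \<mu>" using u fin_Field v(2) by (auto simp: Field_def)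
    then have "(t, u) \<in> \<mu>" using False TOTALS by auto
    then have "(v, u) \<in> \<mu>" using v(2) TRANS unfolding trans_def by blast
    then have "S v \<subseteq> S u" using S by (auto simp: monotone_positions_def)
    moreover have "x \<in> fst ` S v" using x v by auto
    ultimately show ?thesis by blast
  qed (use x u in auto)
  then show "x \<in> ans S k" by (auto simp: answer_def)
qed (auto simp: answer_def)

context
  fixes S S' t
  assumes S: "monotone_positions S" "monotone_positions S'"
    and eq: "\<And>u. (u, t) \<in> \<mu> \<Longrightarrow> S u = S' u"
begin

text \<open>A demand depends on the earlier answers, and these are settled by time \<open>t\<close>
  only if their rounds are done by then; hence the premise in the second part. The first part needs
  no premise: if an earlier round has no finish time up to \<open>u\<close>, then \<open>u\<close>
  is a finish time of round \<open>i\<close> in neither run, whatever the demands are.\<close>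

lemma simulation_local:
  "{u \<in> fin S i. (u, t) \<in> \<mu>} = {u \<in> fin S' i. (u, t) \<in> \<mu>} \<and>
   ((\<forall>k\<in>underS i. done_by S t k) \<longrightarrow> dem S i = dem S' i)"
proof (induction i rule: well_order_induct)
  case (1 i)
  then have IH: "{u \<in> fin S k. (u, t) \<in> \<mu>} = {u \<in> fin S' k. (u, t) \<in> \<mu>}" if "k \<in> underS i" for k
    using that by (auto simp: underS_def)
  have IH1: "dem S k = dem S' k" if k: "k \<in> underS i" and d: "\<forall>k\<in>underS i. done_by S t k" for k
  proof -
    have "underS k \<subseteq> underS i" using k TRANS ANTISYM unfolding underS_def trans_def antisym_def by blast
    then have "\<forall>l\<in>underS k. done_by S t l" using d by blast
    moreover have c: "k \<noteq> i \<and> (k, i) \<in> \<mu>" using k by (auto simp: underS_def)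
    ultimately show ?thesis using 1[THEN spec, THEN mp, OF c] by blast
  qed
  have done_eq: "done_by S t k \<longleftrightarrow> done_by S' t k" if "k \<in> underS i" for k
    using IH[OF that] unfolding done_by_def by blast
  have dem: "dem S i = dem S' i" if d: "\<forall>k\<in>underS i. done_by S t k"
  proof -
    have "ans S k = ans S' k" if k: "k \<in> underS i" for k
      using ans_eq[OF S(1), of t k] ans_eq[OF S(2), of t k] IH[OF k] eq d k done_eq[OF k] by auto
    then have "restrict (\<lambda>k. (dem S k, ans S k)) (underS i) = restrict (\<lambda>k. (dem S' k, ans S' k)) (underS i)"
      using IH1[OF _ d] by (intro restrict_ext) auto
    then show ?thesis unfolding dem_rec[of S i] dem_rec[of S' i] by simp
  qed
  have "u \<in> fin S i \<longleftrightarrow> u \<in> fin S' i" if u: "(u, t) \<in> \<mu>" for u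
  proof -
    have e: "(\<exists>v\<in>fin S k. (v, u) \<in> \<mu>) \<longleftrightarrow> (\<exists>v\<in>fin S' k. (v, u) \<in> \<mu>)" if k: "k \<in> underS i" for k
      using IH[OF k] u TRANS unfolding trans_def by blast
    show ?thesis
    proof (cases "\<forall>k\<in>underS i. \<exists>v\<in>fin S k. (v, u) \<in> \<mu>")
      case True
      then have "\<forall>k\<in>underS i. done_by S t k" using u TRANS unfolding done_by_def trans_def by blast
      then show ?thesis unfolding fin_rec[of S i] fin_rec[of S' i] using e eq[OF u] dem by simp
    next
      case False
      then show ?thesis unfolding fin_rec[of S i] fin_rec[of S' i] using e by auto
    qed
  qed
  then show ?case using dem by blast
qed

lemma done_by_local: "done_by S t i \<longleftrightarrow> done_by S' t i"
  using simulation_local[of i] unfolding done_by_def by blast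

lemma dem_local: "(\<And>k. k \<in> underS i \<Longrightarrow> done_by S t k) \<Longrightarrow> dem S i = dem S' i"
  using simulation_local[of i] by blast

end

lemma minim_undone:
  assumes "i \<in> Field \<mu>" "\<not> done_by S t i" "\<And>k. k \<in> underS i \<Longrightarrow> done_by S t k"
  shows "minim {i \<in> Field \<mu>. \<not> done_by S t i} = i"
proof -
  let ?K = "{i \<in> Field \<mu>. \<not> done_by S t i}"
  have K: "?K \<subseteq> Field \<mu>" "i \<in> ?K" using assms by auto
  have "(minim ?K, i) \<in> \<mu>" by (rule minim_least[OF K])
  moreover have "minim ?K \<in> ?K" using minim_in[OF K(1)] K(2) by blast
  ultimately show ?thesis using assms(3)[of "minim ?K"] by (auto simp: underS_def)
qed

text \<open>By regularity a set of fewer than \<open>\<mu>\<close> indices is not cofinal; an index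
  witnessing this is a bound.\<close>

lemma bounded_small:
  assumes "|K| <o \<mu>" "K \<subseteq> Field \<mu>"
  obtains b where "b \<in> Field \<mu>" "\<And>k. k \<in> K \<Longrightarrow> (k, b) \<in> \<mu>"
proof -
  have "\<not> cofinal K \<mu>"
    using reg assms not_ordLess_ordIso unfolding regularCard_def by blast
  then obtain b where b: "b \<in> Field \<mu>" "\<forall>k\<in>K. b = k \<or> (b, k) \<notin> \<mu>"
    unfolding cofinal_def by blast
  have "(k, b) \<in> \<mu>" if "k \<in> K" for k
  proof (cases "b = k")
    case True then show ?thesis using b(1) REFL by (auto simp: refl_on_def)
  next
    case False then show ?thesis using b that assms(2) TOTALS by blast
  qed
  then show ?thesis using that b(1) by blast
qed

text \<open>There are few innings below \<open>t0\<close>, so the innings from \<open>t0\<close> on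
  are \<open>\<mu>\<close> many. Hence Spoiler cannot keep picking new elements of a small set until
  the game ends.\<close>

lemma no_injection_from_tail:
  assumes t0: "t0 \<in> Field \<mu>" and Y: "|Y| <o \<mu>"
    and f: "\<And>t. (t0, t) \<in> \<mu> \<Longrightarrow> f t \<in> Y"
    and ne: "\<And>t t'. (t0, t) \<in> \<mu> \<Longrightarrow> t \<in> underS t' \<Longrightarrow> f t \<noteq> f t'"
  shows False
proof -
  let ?A = "{t. (t0, t) \<in> \<mu>}"
  have "inj_on f ?A"
  proof (rule inj_onI)
    fix t t' assume *: "t \<in> ?A" "t' \<in> ?A" "f t = f t'"
    then have "t \<in> Field \<mu>" "t' \<in> Field \<mu>" by (auto simp: Field_def)
    then have "t = t' \<or> t \<in> underS t' \<or> t' \<in> underS t" using TOTALS by (auto simp: underS_def)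
    then show "t = t'" using * ne[of t t'] ne[of t' t] by auto
  qed
  then have "|?A| \<le>o |Y|" using f by (intro card_of_ordLeqI) auto
  then have A: "|?A| <o \<mu>" using Y by (rule ordLeq_ordLess_trans)
  have "|?A \<union> underS t0| <o \<mu>" by (rule small_Un[OF A card_of_underS[OF card t0]])
  moreover have "?A \<union> underS t0 = Field \<mu>"
    using t0 TOTALS REFL by (auto simp: underS_def Field_def refl_on_def)
  ultimately have "|Field \<mu>| <o \<mu>" by simp
  then show False using card_of_Field_ordIso[OF card] not_ordLess_ordIso by blast
qed

end

section \<open>Spoiler's strategy and the end of each round\<close>

definition position :: "'k rel \<Rightarrow> ('k \<Rightarrow> 'm + 'p) \<Rightarrow> ('k \<Rightarrow> 'm + 'p) \<Rightarrow> 'k \<Rightarrow> ('m \<times> 'p) set" where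
  "position \<mu> s d t = (\<Union>k\<in>underS \<mu> t. ef_pairs (s k) (d k))"

text \<open>Demanded elements of \<open>M\<close> take precedence, since Duplicator's answers to
  them are new elements of \<open>P\<close> under which the closure must still be taken. The
  intersections with the carriers keep the move legal for every \<open>X\<close>; zero is a filler
  when nothing admissible is missing.\<close>

definition spoiler_move ::
    "('p \<Rightarrow> 'p set) \<Rightarrow> ('r, 'm) module \<Rightarrow> ('r, 'p) module \<Rightarrow> 'm set \<Rightarrow> ('m \<times> 'p) set \<Rightarrow> 'm + 'p" where
  "spoiler_move G M P X T =
    (let U = (X - fst ` T) \<inter> carrier M; V = ((\<Union>q\<in>snd ` T. G q) - snd ` T) \<inter> carrier P
     in if U \<noteq> {} then Inl (SOME m. m \<in> U) else if V \<noteq> {} then Inr (SOME p. p \<in> V) else Inl \<zero>\<^bsub>M\<^esub>)"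

lemma spoiler_move_Inl:
  assumes "X \<subseteq> carrier M" "\<not> X \<subseteq> fst ` T"
  shows "\<exists>m \<in> X - fst ` T. spoiler_move G M P X T = Inl m"
proof -
  let ?U = "(X - fst ` T) \<inter> carrier M"
  have U: "?U \<noteq> {}" using assms by blast
  then have "(SOME m. m \<in> ?U) \<in> ?U" by (rule some_in_eq[THEN iffD2])
  then show ?thesis using U by (auto simp: spoiler_move_def Let_def)
qed

lemma spoiler_move_Inr:
  assumes "X \<subseteq> fst ` T" "\<And>q. q \<in> snd ` T \<Longrightarrow> G q \<subseteq> carrier P" "\<not> (\<forall>q\<in>snd ` T. G q \<subseteq> snd ` T)"
  shows "\<exists>p \<in> (\<Union>q\<in>snd ` T. G q) - snd ` T. spoiler_move G M P X T = Inr p"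
proof -
  let ?V = "((\<Union>q\<in>snd ` T. G q) - snd ` T) \<inter> carrier P"
  have V: "?V \<noteq> {}" using assms(2,3) by blast
  then have "(SOME p. p \<in> ?V) \<in> ?V" by (rule some_in_eq[THEN iffD2])
  moreover have "(X - fst ` T) \<inter> carrier M = {}" using assms(1) by blast
  ultimately show ?thesis using V unfolding spoiler_move_def Let_def by auto
qed

lemma spoiler_move_closed:
  assumes "\<zero>\<^bsub>M\<^esub> \<in> carrier M" shows "spoiler_move G M P X T \<in> carrier M <+> carrier P"
proof -
  let ?U = "(X - fst ` T) \<inter> carrier M" and ?V = "((\<Union>q\<in>snd ` T. G q) - snd ` T) \<inter> carrier P"
  have "(SOME m. m \<in> ?U) \<in> ?U" if "?U \<noteq> {}" using that by (rule some_in_eq[THEN iffD2])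
  then have U: "Inl (SOME m. m \<in> ?U) \<in> carrier M <+> carrier P" if "?U \<noteq> {}" using that by blast
  have "(SOME p. p \<in> ?V) \<in> ?V" if "?V \<noteq> {}" using that by (rule some_in_eq[THEN iffD2])
  then have V: "Inr (SOME p. p \<in> ?V) \<in> carrier M <+> carrier P" if "?V \<noteq> {}" using that by blast
  show ?thesis
    unfolding spoiler_move_def Let_def by (split if_split)+ (use U V assms in blast)
qed

context simulation_setup
begin

text \<open>The current round is the least one not yet done. A history contains no real moves from
  inning \<open>t\<close> on, so the positions computed after \<open>t\<close> are meaningless; by
  locality neither the current round nor its demand depends on them.\<close>

definition spoiler_strategy :: "('r, 'm) module \<Rightarrow> ('r, 'p) module \<Rightarrow> 'k \<Rightarrow> ('k \<Rightarrow> ('m + 'p) \<times> ('m + 'p)) \<Rightarrow> 'm + 'p" where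
  "spoiler_strategy M P t h =
    (let S = position \<mu> (fst \<circ> h) (snd \<circ> h)
     in spoiler_move G M P (dem S (minim {i \<in> Field \<mu>. \<not> done_by S t i})) (S t))"

lemma underS_mono: "(u, v) \<in> \<mu> \<Longrightarrow> underS u \<subseteq> underS v"
  using TRANS ANTISYM unfolding underS_def trans_def antisym_def by blast

lemma underS_in_Field: "k \<in> underS t \<Longrightarrow> k \<in> Field \<mu>"
  by (auto simp: underS_def Field_def)

lemma monotone_position: "monotone_positions (position \<mu> s d)"
  unfolding monotone_positions_def position_def using underS_mono by blast

lemma strategy_move:
  assumes fs: "follows_strategy \<mu> (spoiler_strategy M P) s d" and t: "t \<in> Field \<mu>"
    and i: "i \<in> Field \<mu>" "\<not> done_by (position \<mu> s d) t i" "\<And>k. k \<in> underS i \<Longrightarrow> done_by (position \<mu> s d) t k"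
  shows "s t = spoiler_move G M P (dem (position \<mu> s d) i) (position \<mu> s d t)"
proof -
  let ?S = "position \<mu> s d"
  define h where "h = restrict (\<lambda>k. (s k, d k)) (underS t)"
  define S' where "S' = position \<mu> (fst \<circ> h) (snd \<circ> h)"
  \<comment> \<open>Positions use strictly earlier innings only, so the truncated history gives the
    true position at \<open>t\<close> as well.\<close>
  have eq: "?S u = S' u" if "(u, t) \<in> \<mu>" for u
  proof -
    have "ef_pairs (s k) (d k) = ef_pairs ((fst \<circ> h) k) ((snd \<circ> h) k)" if "k \<in> underS u" for k
      using that underS_mono[OF \<open>(u, t) \<in> \<mu>\<close>] by (auto simp: h_def)
    then show ?thesis unfolding S'_def position_def by simp
  qed
  have mon: "monotone_positions ?S" "monotone_positions S'"
    unfolding S'_def by (rule monotone_position)+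
  have d_eq: "done_by ?S t k \<longleftrightarrow> done_by S' t k" for k by (rule done_by_local[OF mon eq])
  have "minim {i \<in> Field \<mu>. \<not> done_by S' t i} = i"
    using minim_undone[OF i] by (simp add: d_eq)
  moreover have "dem ?S i = dem S' i" by (rule dem_local[OF mon eq i(3)])
  moreover have "(t, t) \<in> \<mu>" using t REFL by (auto simp: refl_on_def)
  ultimately have "spoiler_strategy M P t h = spoiler_move G M P (dem ?S i) (?S t)"
    unfolding spoiler_strategy_def S'_def[symmetric] Let_def using eq by simp
  then show ?thesis using fs t unfolding follows_strategy_def h_def by auto
qed

text \<open>If round \<open>i\<close> never ended, then from some inning on Spoiler would work on
  this round alone and play a new element each time: first from the small demand, afterwards from a
  small \<open>G\<close>-closed set. Either possibility embeds a tail of the innings in a small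
  set.\<close>

lemma fin_nonempty:
  fixes R :: "('r, 'x) ring_scheme" and M :: "('r, 'm) module" and P :: "('r, 'p) module"
  assumes G: "\<And>p. p \<in> carrier P \<Longrightarrow> G p \<subseteq> carrier P" "\<And>p. p \<in> carrier P \<Longrightarrow> |G p| <o \<mu>"
    and fs: "follows_strategy \<mu> (spoiler_strategy M P) s d"
    and pairs: "\<And>t. t \<in> Field \<mu> \<Longrightarrow> ef_pairs (s t) (d t) \<subseteq> carrier M \<times> carrier P \<and> ef_pairs (s t) (d t) \<noteq> {}"
    and dem: "\<And>k. k \<in> under i \<Longrightarrow> dem (position \<mu> s d) k \<subseteq> carrier M \<and> |dem (position \<mu> s d) k| <o \<mu>"
    and i: "i \<in> Field \<mu>"
  shows "fin (position \<mu> s d) i \<noteq> {}"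
  using dem i
proof (induction i rule: well_order_induct)
  case (1 i)
  let ?S = "position \<mu> s d"
  have iF: "i \<in> Field \<mu>" by fact
  have X: "dem ?S i \<subseteq> carrier M" "|dem ?S i| <o \<mu>"
    using 1(2)[of i] under_eq_insert[OF iF] by auto
  have IH: "fin ?S k \<noteq> {}" if k: "k \<in> underS i" for k
  proof -
    have c: "k \<noteq> i" "(k, i) \<in> \<mu>" "k \<in> Field \<mu>" using k by (auto simp: underS_def Field_def)
    have "under k \<subseteq> under i" using c(2) TRANS unfolding under_def trans_def by blast
    then show ?thesis using 1(1)[THEN spec, THEN mp, OF conjI[OF c(1,2)]] 1(2) c(3) by blast
  qed
  have S_carrier: "?S t \<subseteq> carrier M \<times> carrier P" for t
    unfolding position_def
  proof (rule UN_least)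
    fix k assume "k \<in> underS t"
    then have "k \<in> Field \<mu>" by (rule underS_in_Field)
    then show "ef_pairs (s k) (d k) \<subseteq> carrier M \<times> carrier P" using pairs by blast
  qed
  have S_mono: "?S u \<subseteq> ?S v" if "(u, v) \<in> \<mu>" for u v
    using monotone_position[of s d] that by (auto simp: monotone_positions_def)
  have played: "ef_pairs (s t) (d t) \<subseteq> ?S t'" if "t \<in> underS t'" for t t'
    using that unfolding position_def by blast
  have ef_finite: "finite (ef_pairs x y)" for x y :: "'m + 'p"
    by (cases x; cases y) auto
  have S_small: "|?S t| <o \<mu>" if "t \<in> Field \<mu>" for t
    unfolding position_def using card_of_underS[OF card that] small_finite[OF ef_finite] by (rule small_UN)
  have ex: "\<exists>v. v \<in> fin ?S k" if "k \<in> underS i" for k using IH[OF that] by blast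
  then obtain v where v: "\<And>k. k \<in> underS i \<Longrightarrow> v k \<in> fin ?S k" by metis
  have vF: "v ` underS i \<subseteq> Field \<mu>" using v fin_Field by blast
  \<comment> \<open>There are fewer than \<open>\<mu>\<close> earlier rounds, so one finish time
    from each of them can be bounded by a single inning.\<close>
  obtain b where b: "b \<in> Field \<mu>" "\<And>k. k \<in> v ` underS i \<Longrightarrow> (k, b) \<in> \<mu>"
    using bounded_small[OF small_image[OF card_of_underS[OF card iF]] vF] by metis
  have past: "done_by ?S t k" if "k \<in> underS i" "(b, t) \<in> \<mu>" for k t
    using v[OF that(1)] b(2)[of "v k"] that TRANS unfolding done_by_def trans_def by blast
  show ?case
  proof
    assume empty: "fin ?S i = {}"
    have nd: "\<not> done_by ?S t i" for t using empty by (auto simp: done_by_def)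
    have move: "s t = spoiler_move G M P (dem ?S i) (?S t)" if t: "(b, t) \<in> \<mu>" for t
    proof (rule strategy_move[OF fs _ iF nd])
      show "t \<in> Field \<mu>" using t by (auto simp: Field_def)
    qed (use past t in blast)
    have Inl_mem: "m \<in> fst ` ?S t'" if st: "s t = Inl m" and tt': "t \<in> underS t'" for t t' m
    proof -
      have "t \<in> Field \<mu>" using tt' by (rule underS_in_Field)
      then obtain p where "ef_pairs (s t) (d t) = {(m, p)}" using pairs[of t] st by (cases "d t") auto
      then show ?thesis using played[OF tt'] by force
    qed
    have Inr_pairs: "\<exists>m. ef_pairs (s t) (d t) = {(m, p)}" if "s t = Inr p" "t \<in> Field \<mu>" for t p
      using pairs[OF that(2)] that(1) by (cases "d t") auto
    \<comment> \<open>While the demand is not met, Spoiler plays a demanded element that is absent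
      so far. Duplicator's answer completes a pair, so it is never played again.\<close>
    have "\<exists>u. (b, u) \<in> \<mu> \<and> dem ?S i \<subseteq> fst ` ?S u"
    proof (rule ccontr)
      assume n: "\<not> ?thesis"
      have m: "\<exists>m \<in> dem ?S i - fst ` ?S t. s t = Inl m" if t: "(b, t) \<in> \<mu>" for t
        unfolding move[OF t] by (rule spoiler_move_Inl[OF X(1)]) (use n t in blast)
      show False
      proof (rule no_injection_from_tail[OF b(1) X(2), of "\<lambda>t. projl (s t)"])
        show "projl (s t) \<in> dem ?S i" if "(b, t) \<in> \<mu>" for t using m[OF that] by auto
        fix t t' assume t: "(b, t) \<in> \<mu>" "t \<in> underS t'"
        then have bt': "(b, t') \<in> \<mu>" using TRANS unfolding underS_def trans_def by blast
        obtain m1 m2 where "s t = Inl m1" "s t' = Inl m2" "m2 \<notin> fst ` ?S t'"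
          using m[OF t(1)] m[OF bt'] by blast
        then show "projl (s t) \<noteq> projl (s t')" using Inl_mem[of t m1 t'] t(2) by auto
      qed
    qed
    then obtain u where u: "(b, u) \<in> \<mu>" "dem ?S i \<subseteq> fst ` ?S u" by blast
    have uF: "u \<in> Field \<mu>" using u(1) by (auto simp: Field_def)
    have p: "\<exists>p \<in> (\<Union>q\<in>snd ` ?S t. G q) - snd ` ?S t. s t = Inr p" if t: "(u, t) \<in> \<mu>" for t
    proof -
      have bt: "(b, t) \<in> \<mu>" using u(1) t TRANS unfolding trans_def by blast
      have tF: "t \<in> Field \<mu>" using t by (auto simp: Field_def)
      have d: "dem ?S i \<subseteq> fst ` ?S t" using u(2) S_mono[OF t] by blast
      have "\<forall>k\<in>underS i. \<exists>v\<in>fin ?S k. (v, t) \<in> \<mu>" using past bt unfolding done_by_def by blast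
      then have "\<not> (\<forall>q\<in>snd ` ?S t. G q \<subseteq> snd ` ?S t)" using empty d tF unfolding fin_rec[of _ i] by blast
      moreover have "G q \<subseteq> carrier P" if "q \<in> snd ` ?S t" for q
        using that S_carrier[of t] by (intro G(1)) auto
      ultimately show ?thesis unfolding move[OF bt] using spoiler_move_Inr[OF d] by blast
    qed
    \<comment> \<open>From \<open>u\<close> on Spoiler plays in \<open>P\<close> and Duplicator
      answers in \<open>M\<close>, so she adds no elements of \<open>P\<close> of her own. All
      right-hand elements therefore stay inside one small closed set \<open>Y\<close>.\<close>
    have "snd ` ?S u \<subseteq> carrier P" using S_carrier[of u] by auto
    then obtain Y where Y: "snd ` ?S u \<subseteq> Y" "Y \<subseteq> carrier P" "|Y| <o \<mu>" "\<And>q. q \<in> Y \<Longrightarrow> G q \<subseteq> Y"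
      using small_closure[OF _ small_image[OF S_small[OF uF]], of snd "carrier P" G] G by metis
    have SY: "(u, t) \<in> \<mu> \<Longrightarrow> snd ` ?S t \<subseteq> Y" for t
    proof (induction t rule: well_order_induct)
      case (1 t)
      show ?case
      proof
        fix x assume "x \<in> snd ` ?S t"
        then obtain k m where k: "k \<in> underS t" "(m, x) \<in> ef_pairs (s k) (d k)"
          unfolding position_def by auto
        have kF: "k \<in> Field \<mu>" using k(1) by (rule underS_in_Field)
        show "x \<in> Y"
        proof (cases "k \<in> underS u")
          case True
          then have "(m, x) \<in> ?S u" using k(2) played by blast
          then show ?thesis using Y(1) by force
        next
          case False
          then have uk: "(u, k) \<in> \<mu>" using uF kF TOTALS REFL unfolding underS_def refl_on_def by blast
          obtain q p where p: "q \<in> snd ` ?S k" "p \<in> G q" "s k = Inr p" using p[OF uk] by blast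
          have "x = p" using Inr_pairs[OF p(3) kF] k(2) by auto
          moreover have "snd ` ?S k \<subseteq> Y" using 1(1) uk k(1) unfolding underS_def by blast
          ultimately show ?thesis using p Y(4) by blast
        qed
      qed
    qed
    show False
    proof (rule no_injection_from_tail[OF uF Y(3), of "\<lambda>t. projr (s t)"])
      show "projr (s t) \<in> Y" if t: "(u, t) \<in> \<mu>" for t using p[OF t] SY[OF t] Y(4) by fastforce
      fix t t' assume t: "(u, t) \<in> \<mu>" "t \<in> underS t'"
      then have ut': "(u, t') \<in> \<mu>" using TRANS unfolding underS_def trans_def by blast
      obtain p1 p2 where pp: "s t = Inr p1" "s t' = Inr p2" "p2 \<notin> snd ` ?S t'"
        using p[OF t(1)] p[OF ut'] by blast
      have "t \<in> Field \<mu>" using t(2) by (rule underS_in_Field)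
      then have "p1 \<in> snd ` ?S t'" using Inr_pairs[OF pp(1)] played[OF t(2)] by force
      then show "projr (s t) \<noteq> projr (s t')" using pp by auto
    qed
  qed
qed

end

theorem theorem4p15:
  fixes \<mu> :: "'k rel"
    and R :: "('r, 'x) ring_scheme"
    and M :: "('r, 'm) module"
    and C :: "('r, 'c) module set"
    and P :: "('r, 'p) module"
  assumes "Card_order \<mu>" and "natLeq <o \<mu>" and "regularCard \<mu>"
    and "ring R"
    and "left_module R M"
    and "\<And>N. N \<in> C \<Longrightarrow> left_module R N \<and> less_presented R \<mu> N"
    and "player1_wins_filt_game R C \<mu> M"
    and "left_module R P" and "class_filtered R C P"
  shows "spoiler_wins_ef_game R \<mu> M P"
proof -
  interpret M: left_module R M by fact
  interpret P: left_module R P by fact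
  interpret regular_uncountable \<mu> by unfold_locales fact+
  obtain \<sigma> where \<sigma>: "\<And>X Z. follows_strategy \<mu> \<sigma> X Z \<Longrightarrow>
      first_player_wins_run \<mu> (filt_game_legal1 \<mu> M) (filt_game_legal2 R C \<mu> M) X Z"
    using assms(7) unfolding player1_wins_filt_game_def first_player_has_winning_strategy_def by blast
  obtain G where G: "\<And>p. p \<in> carrier P \<Longrightarrow> G p \<subseteq> carrier P" "\<And>p. p \<in> carrier P \<Longrightarrow> |G p| <o \<mu>"
    and hill: "\<And>Q Q'. Q \<subseteq> Q' \<Longrightarrow> Q' \<subseteq> carrier P \<Longrightarrow> \<forall>q\<in>Q. G q \<subseteq> Q \<Longrightarrow> \<forall>q\<in>Q'. G q \<subseteq> Q' \<Longrightarrow>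
       class_filtered R C (quot_module (restrict_module P (gen_submodule R P Q')) (gen_submodule R P Q))"
    by (rule hill_closure[OF assms(8,9,6)]) (assumption | rule that)+
  interpret wo: wo_rel \<mu> using card by (simp add: wo_rel_def card_order_on_def)
  interpret simulation_setup \<mu> \<sigma> G ..
  have "first_player_wins_run \<mu> (ef_legal_spoiler M P) (ef_legal_duplicator R \<mu> M P) s d"
    if fs: "follows_strategy \<mu> (spoiler_strategy M P) s d" for s d
  proof (rule ccontr)
    assume nw: "\<not> ?thesis"
    let ?S = "position \<mu> s d"
    have s_legal: "s t \<in> carrier M <+> carrier P" if "t \<in> Field \<mu>" for t
    proof -
      have "s t = spoiler_strategy M P t (restrict (\<lambda>k. (s k, d k)) (underS \<mu> t))"
        using fs that by (simp add: follows_strategy_def)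
      then show ?thesis
        using spoiler_move_closed[OF M.M.zero_closed] by (simp add: spoiler_strategy_def Let_def)
    qed
    \<comment> \<open>Spoiler's moves are always legal, so a run that he does not win contains no
      illegal answer at all.\<close>
    have legal: "ef_legal_duplicator R \<mu> M P t s d" if t: "t \<in> Field \<mu>" for t
    proof -
      have "ef_legal_spoiler M P k s d" if "k \<in> under \<mu> t" for k
        using that s_legal by (auto simp: ef_legal_spoiler_def under_def Field_def)
      then show ?thesis using nw t unfolding first_player_wins_run_def by blast
    qed
    have pairs: "ef_pairs (s t) (d t) \<subseteq> carrier M \<times> carrier P \<and> ef_pairs (s t) (d t) \<noteq> {}"
      if "t \<in> Field \<mu>" for t
      using s_legal[OF that] legal[OF that] unfolding ef_legal_duplicator_def
      by (cases "s t"; cases "d t") auto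
    have S_mono: "?S u \<subseteq> ?S v" if "(u, v) \<in> \<mu>" for u v
      using monotone_position[of s d] that by (auto simp: monotone_positions_def)
    \<comment> \<open>The simulated run obeys \<open>\<sigma>\<close>, so Player 2 must break a rule
      in some round \<open>i\<close>. The rest of the proof shows that her move in this round is
      legal.\<close>
    have "follows_strategy \<mu> \<sigma> (dem ?S) (ans ?S)"
      unfolding follows_strategy_def using dem_rec by blast
    then obtain i where i: "i \<in> Field \<mu>" "\<not> filt_game_legal2 R C \<mu> M i (dem ?S) (ans ?S)"
      and legal1: "\<And>k. k \<in> under \<mu> i \<Longrightarrow> filt_game_legal1 \<mu> M k (dem ?S) (ans ?S)"
      using \<sigma> unfolding first_player_wins_run_def by blast
    \<comment> \<open>Player 1 has moved legally up to round \<open>i\<close>; the resulting bounds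
      on the demands are what makes these rounds finish.\<close>
    have ne: "fin ?S k \<noteq> {}" if k: "k \<in> under \<mu> i" for k
    proof (rule fin_nonempty[OF G fs pairs])
      show "k \<in> Field \<mu>" using k by (auto simp: under_def Field_def)
      fix l assume "l \<in> under \<mu> k"
      then have "l \<in> under \<mu> i" using k wo.TRANS unfolding under_def trans_def by blast
      then show "dem ?S l \<subseteq> carrier M \<and> |dem ?S l| <o \<mu>"
        using legal1 unfolding filt_game_legal1_def by blast
    qed
    define \<beta> where "\<beta> k = wo.minim (fin ?S k)" for k
    have \<beta>: "\<beta> k \<in> fin ?S k" if "k \<in> under \<mu> i" for k
      unfolding \<beta>_def by (rule wo.minim_in[OF fin_Field ne[OF that]])
    have \<beta>_least: "(\<beta> k, u) \<in> \<mu>" if "u \<in> fin ?S k" for k u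
      unfolding \<beta>_def by (rule wo.minim_least[OF fin_Field that])
    have ans: "ans ?S k = fst ` ?S (\<beta> k)" if "k \<in> under \<mu> i" for k
      unfolding answer_def using \<beta>[OF that] S_mono[OF \<beta>_least] by blast
    have ii: "i \<in> under \<mu> i" and uS: "underS \<mu> i \<subseteq> under \<mu> i"
      using wo.under_eq_insert[OF i(1)] by auto
    define u where "u = \<beta> i"
    \<comment> \<open>The pairs behind all earlier answers. The right-hand side of \<open>T\<close>
      is a union of \<open>G\<close>-closed sets and hence \<open>G\<close>-closed, whether
      \<open>i\<close> is zero, a successor or a limit.\<close>
    define T where "T = (\<Union>k\<in>underS \<mu> i. ?S (\<beta> k))"
    have u: "u \<in> Field \<mu>" "dem ?S i \<subseteq> fst ` ?S u" "\<And>q. q \<in> snd ` ?S u \<Longrightarrow> G q \<subseteq> snd ` ?S u"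
      and before: "\<And>k. k \<in> underS \<mu> i \<Longrightarrow> \<exists>v\<in>fin ?S k. (v, u) \<in> \<mu>"
      using \<beta>[OF ii] unfolding u_def[symmetric] fin_rec[of ?S i] by auto
    have Tu: "T \<subseteq> ?S u"
      unfolding T_def
    proof (rule UN_least)
      fix k assume "k \<in> underS \<mu> i"
      then obtain v where "v \<in> fin ?S k" "(v, u) \<in> \<mu>" using before by blast
      then show "?S (\<beta> k) \<subseteq> ?S u" using S_mono[OF \<beta>_least, of v k] S_mono[of v u] by blast
    qed
    have T_closed: "G q \<subseteq> snd ` T" if q: "q \<in> snd ` T" for q
    proof -
      obtain k where k: "k \<in> underS \<mu> i" "q \<in> snd ` ?S (\<beta> k)" using q unfolding T_def by auto
      have "\<beta> k \<in> fin ?S k" using \<beta> k(1) uS by auto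
      then have "G q \<subseteq> snd ` ?S (\<beta> k)" using k(2) unfolding fin_rec[of ?S k] by blast
      then show ?thesis using k(1) unfolding T_def by blast
    qed
    have fst_T: "(\<Union>k\<in>underS \<mu> i. ans ?S k) = fst ` T"
      unfolding T_def image_UN using ans uS by (intro SUP_cong) auto
    \<comment> \<open>Legality at inning \<open>u\<close> concerns all pairs up to and including
      that inning, whereas \<open>?S u\<close> stops just before it; hence the detour through the
      larger set \<open>?L\<close>.\<close>
    let ?L = "\<Union>k\<in>under \<mu> u. ef_pairs (s k) (d k)"
    have L: "partial_isomorphism R M P ?L" using legal[OF u(1)] by (simp add: ef_legal_duplicator_def)
    have Lc: "?L \<subseteq> carrier M \<times> carrier P"
      using pairs unfolding under_def Field_def by blast
    have SL: "?S u \<subseteq> ?L" unfolding position_def by (intro UN_mono) (auto simp: under_def underS_def)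
    have Sc: "?S u \<subseteq> carrier M \<times> carrier P" using SL Lc by blast
    let ?QM = "quot_module (restrict_module M (gen_submodule R M (fst ` ?S u))) (gen_submodule R M (fst ` T))"
    let ?QP = "quot_module (restrict_module P (gen_submodule R P (snd ` ?S u))) (gen_submodule R P (snd ` T))"
    have iso: "module_isomorphic R ?QM ?QP"
      by (rule partial_isomorphism_quot[OF assms(5,8) L Lc Tu SL])
    have fc: "fst ` ?S u \<subseteq> carrier M" "fst ` T \<subseteq> carrier M" "snd ` ?S u \<subseteq> carrier P" "snd ` T \<subseteq> carrier P"
      using Sc Tu by fastforce+
    have QM: "left_module R ?QM"
      using left_module.quot_left_module[OF M.restrict_left_module[OF M.submodule_gen[OF fc(1)]]]
        M.submodule_restrict[OF M.submodule_gen[OF fc(1)] M.gen_mono[OF image_mono[OF Tu]]]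
        M.submodule_gen[OF fc(2)] by blast
    have QP: "left_module R ?QP"
      using left_module.quot_left_module[OF P.restrict_left_module[OF P.submodule_gen[OF fc(3)]]]
        P.submodule_restrict[OF P.submodule_gen[OF fc(3)] P.gen_mono[OF image_mono[OF Tu]]]
        P.submodule_gen[OF fc(4)] by blast
    have "class_filtered R C ?QP"
      by (rule hill[OF image_mono[OF Tu] fc(3)]) (use T_closed u(3) in blast)+
    then have cf: "class_filtered R C ?QM"
      by (rule class_filtered_iso[OF QP QM module_isomorphic_sym[OF QM QP iso]])
    have ef_finite: "finite (ef_pairs x y)" for x y :: "'m + 'p"
      by (cases x; cases y) auto
    have small: "|?S u| <o \<mu>"
      unfolding position_def using card_of_underS[OF card u(1)] small_finite[OF ef_finite] by (rule small_UN)
    have "filt_game_legal2 R C \<mu> M i (dem ?S) (ans ?S)"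
      unfolding filt_game_legal2_def fst_T ans[OF ii] u_def[symmetric]
      using fc(1) small_image[OF small] u(2) Tu M.gen_incl[of "fst ` ?S u"] cf by blast
    then show False using i(2) by blast
  qed
  then show ?thesis
    unfolding spoiler_wins_ef_game_def first_player_has_winning_strategy_def by blast
qed

end
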